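(* Let $s:=e_1^+\otimes e_1^+$ and $s':=e_2^+\otimes e_2^+$ for the standard basis elements $e_1^+,e_2^+\in\mathbf O^+$, and define \[ \phi:=16^2\,(s+s')\circ s\in\operatorname{Cl}(16)\cong\bigwedge\nolimits^{*}\mathbf R^{16}. \] Then $\phi=1+\cdots+\phi_{2k}+\cdots+\nu$, i.e. $\phi$ has only homogeneous components $\phi_{2k}\in\bigwedge^{2k}\mathbf R^{16}$ of even degree, its degree $0$ component is $1$ and its degree $16$ component is the volume form $\nu$ of $\mathbf R^{16}$; and every $\phi_{2k}$ is a calibration. Moreover, $\mathbf R^{16}$ admits an orthogonal complex structure, making it a complex $8$-dimensional Hermitian space $X$ with Kähler form $\omega$, such that for an orthogonal decomposition $X=X_1\oplus X_2$ into complex $4$-dimensional subspaces with holomorphic volume forms $\Omega_1,\Omega_2$ and for a holomorphic volume form $\Omega$ on $X$, \[ \phi_8=\operatorname{Re}\Omega+\tfrac1{4!}\omega^4+\operatorname{Re}(\Omega_1+\Omega_2)\wedge\tfrac12\omega^2 . \]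
   Context: Octonions: $\mathbf O=\mathbf H\oplus\mathbf H\mathbf e\cong\mathbf R^8$ with product $(a,b)(c,d)=(ac-\bar db,\,da+b\bar c)$, $a,b,c,d\in\mathbf H$, where $(a,b)$ stands for $a+b\mathbf e$, and orthonormal basis $e_1,\dots,e_8=\mathbf 1,\mathbf i,\mathbf j,\mathbf k,\mathbf e,\mathbf i\mathbf e,\mathbf j\mathbf e,\mathbf k\mathbf e$; $e_1=\mathbf 1$ is the unit. $R_v(w)=wv$ is right multiplication. Clifford algebras: $\operatorname{Cl}(n)$ is the Clifford algebra of $\mathbf R^n$ with $v^2=-|v|^2$. Let $\mathbf O^+,\mathbf O^-$ be two copies of $\mathbf O$ with standard bases $e_i^\pm$, and $\mathbf P(8)=\mathbf O^+\oplus\mathbf O^-$ with its standard inner product. $\operatorname{Cl}(8)\cong\operatorname{End}(\mathbf P(8))$ via the extension of \[ \mathbf R^8\ni v\mapsto\begin{pmatrix}0&R_v\\-R_{\bar v}&0\end{pmatrix}\in\operatorname{End}(\mathbf O^+\oplus\mathbf O^-). \] In this model the volume element $\nu_8:=e_1\cdots e_8$ of $\operatorname{Cl}(8)$ is $\operatorname{diag}(\mathrm{id},-\mathrm{id})$. Let $\mathbf P(16)=\mathbf P(8)\otimes\mathbf P(8)$ with inner product $\varepsilon$ given by $\varepsilon(v\otimes w,x\otimes y)=\langle v,x\rangle\langle w,y\rangle$. $\operatorname{Cl}(16)\cong\operatorname{End}(\mathbf P(16))\cong\operatorname{Cl}(8)\otimes\operatorname{Cl}(8)$, where the standard oriented orthonormal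 basis $E_1,\dots,E_{16}$ of $\mathbf R^{16}$ corresponds to $E_i=e_i\otimes\nu_8$ and $E_{8+i}=\mathrm{id}\otimes e_i$, $i=1,\dots,8$. The identification $\operatorname{Cl}(16)\cong\bigwedge_*\mathbf R^{16}$ is the canonical linear isomorphism sending $E_{i_1}\cdots E_{i_k}$ ($i_1<\dots<i_k$) to $E_{i_1}\wedge\dots\wedge E_{i_k}$, and $\bigwedge_*\mathbf R^{16}\cong\bigwedge^*\mathbf R^{16}$ by the inner product (for which these elements are orthonormal). The outer product of $x,y\in\mathbf P(16)$ is $x\circ y\in\operatorname{End}(\mathbf P(16))$, $(x\circ y)(z)=\varepsilon(y,z)x$. $\phi_j$ denotes the component of $\phi$ in $\bigwedge^j\mathbf R^{16}$. Calibrations: $\phi_j\in\bigwedge^j\mathbf R^{16}$ is a calibration if its comass $\|\phi_j\|=\sup\{\phi_j(\xi):\xi\text{ simple }j\text{-vector},|\xi|=1\}$ is at most $1$. The Hermitian product $H$ (conjugate linear in the first argument) of $X$ satisfies $H=\langle\cdot,\cdot\rangle+\mathbf i\,\omega$, $\langle\cdot,\cdot\rangle$ being the standard inner product on $\mathbf R^{16}$. A holomorphic volume form on a complex $d$-dimensional Hermitian space is $Z_1\wedge\dots\wedge Z_d$, with $Z_j$ the coordinate functions of a unitary basis; forms on $X_i$ are regarded as forms on $X$ via orthogonal projection. Powers are wedge powers, with $\alpha\wedge\beta=\frac{(k+l)!}{k!\,l!}\operatorname{Alt}(\alpha\otimes\beta)$. *)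

theory Defs
  imports "HOL-Analysis.Analysis"
begin

section \<open>Quaternions and octonions\<close>

type_synonym quat = "real^4"
type_synonym oct = "real^8"

text \<open>Coordinates refer to the bases \<open>1, i, j, k\<close> of the quaternions and
  \<open>1, i, j, k, e, ie, je, ke\<close> of the octonions. Indices of a numeral type are taken modulo
  its size, so the last coordinate \<open>x $ 8\<close> of an octonion is \<open>x $ 0\<close>.\<close>

definition qmult :: "quat \<Rightarrow> quat \<Rightarrow> quat" where
  "qmult a b = vector
    [a$1 * b$1 - a$2 * b$2 - a$3 * b$3 - a$4 * b$4,
     a$1 * b$2 + a$2 * b$1 + a$3 * b$4 - a$4 * b$3,
     a$1 * b$3 - a$2 * b$4 + a$3 * b$1 + a$4 * b$2,
     a$1 * b$4 + a$2 * b$3 - a$3 * b$2 + a$4 * b$1]"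

definition qcnj :: "quat \<Rightarrow> quat" where
  "qcnj a = vector [a$1, - a$2, - a$3, - a$4]"

definition opair :: "quat \<Rightarrow> quat \<Rightarrow> oct" where
  "opair a b = vector [a$1, a$2, a$3, a$4, b$1, b$2, b$3, b$4]"

definition ofst :: "oct \<Rightarrow> quat" where
  "ofst x = vector [x$1, x$2, x$3, x$4]"

definition osnd :: "oct \<Rightarrow> quat" where
  "osnd x = vector [x$5, x$6, x$7, x$8]"

definition omult :: "oct \<Rightarrow> oct \<Rightarrow> oct" where
  "omult x y = (let a = ofst x; b = osnd x; c = ofst y; d = osnd y in
     opair (qmult a c - qmult (qcnj d) b) (qmult d a + qmult b (qcnj c)))"

definition ocnj :: "oct \<Rightarrow> oct" where
  "ocnj x = opair (qcnj (ofst x)) (- osnd x)"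

definition oct_basis :: "nat \<Rightarrow> oct" where
  "oct_basis i = axis (of_nat i) 1"


section \<open>Clifford algebras as endomorphism algebras\<close>

text \<open>\<open>P8\<close> is the direct sum of two copies of the octonions, with \<open>Inl\<close> indexing the
  coordinates of the first and \<open>Inr\<close> those of the second. \<open>P16\<close> is the tensor square of \<open>P8\<close>,
  written in the product basis; the standard inner product of \<open>P16\<close> is then the
  tensor product inner product (lemma \<open>inner_tensor\<close>). Endomorphisms are square matrices.\<close>

type_synonym P8 = "real^(8 + 8)"
type_synonym P16 = "real^((8 + 8) \<times> (8 + 8))"
type_synonym Cl8 = "real^(8 + 8)^(8 + 8)"
type_synonym Cl16 = "real^((8 + 8) \<times> (8 + 8))^((8 + 8) \<times> (8 + 8))"

definition block_matrix ::
  "real^'n^'m \<Rightarrow> real^'k^'m \<Rightarrow> real^'n^'l \<Rightarrow> real^'k^'l \<Rightarrow> real^('n + 'k)^('m + 'l)" where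
  "block_matrix A B C D = (\<chi> i j.
     case i of
       Inl a \<Rightarrow> (case j of Inl b \<Rightarrow> A $ a $ b | Inr b \<Rightarrow> B $ a $ b)
     | Inr a \<Rightarrow> (case j of Inl b \<Rightarrow> C $ a $ b | Inr b \<Rightarrow> D $ a $ b))"

definition tensor_vec :: "real^'n \<Rightarrow> real^'m \<Rightarrow> real^('n \<times> 'm)" where
  "tensor_vec v w = (\<chi> p. v $ fst p * w $ snd p)"

definition tensor_mat :: "real^'n^'n \<Rightarrow> real^'m^'m \<Rightarrow> real^('n \<times> 'm)^('n \<times> 'm)" where
  "tensor_mat A B = (\<chi> p q. A $ fst p $ fst q * B $ snd p $ snd q)"

lemma inner_tensor:
  "tensor_vec v w \<bullet> tensor_vec x y = (v \<bullet> x) * (w \<bullet> y)"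
proof -
  have "tensor_vec v w \<bullet> tensor_vec x y =
      (\<Sum>(i, j) \<in> UNIV \<times> UNIV. (v $ i * x $ i) * (w $ j * y $ j))"
    by (simp add: inner_vec_def tensor_vec_def case_prod_unfold mult_ac)
  also have "\<dots> = (\<Sum>i\<in>UNIV. \<Sum>j\<in>UNIV. (v $ i * x $ i) * (w $ j * y $ j))"
    by (rule sum.cartesian_product[symmetric])
  also have "\<dots> = (v \<bullet> x) * (w \<bullet> y)"
    by (simp add: inner_vec_def sum_product)
  finally show ?thesis .
qed

lemma tensor_mat_vector:
  "tensor_mat A B *v tensor_vec v w = tensor_vec (A *v v) (B *v w)"
proof -
  have "(tensor_mat A B *v tensor_vec v w) $ p = tensor_vec (A *v v) (B *v w) $ p" for p
  proof -
    have "(tensor_mat A B *v tensor_vec v w) $ p =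
        (\<Sum>(i, j) \<in> UNIV \<times> UNIV. (A $ fst p $ i * v $ i) * (B $ snd p $ j * w $ j))"
      by (simp add: matrix_vector_mult_def tensor_mat_def tensor_vec_def case_prod_unfold mult_ac)
    also have "\<dots> = (\<Sum>i\<in>UNIV. \<Sum>j\<in>UNIV. (A $ fst p $ i * v $ i) * (B $ snd p $ j * w $ j))"
      by (rule sum.cartesian_product[symmetric])
    also have "\<dots> = tensor_vec (A *v v) (B *v w) $ p"
      by (simp add: matrix_vector_mult_def tensor_vec_def sum_product)
    finally show ?thesis .
  qed
  then show ?thesis by (simp add: vec_eq_iff)
qed

definition outer_prod :: "real^'n \<Rightarrow> real^'n \<Rightarrow> real^'n^'n" where
  "outer_prod x y = matrix (\<lambda>z. (y \<bullet> z) *\<^sub>R x)"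

definition mat_prod_list :: "(real^'n^'n) list \<Rightarrow> real^'n^'n" where
  "mat_prod_list As = foldr (**) As (mat 1)"

definition right_mult :: "oct \<Rightarrow> real^8^8" where
  "right_mult v = matrix (\<lambda>w. omult w v)"

definition cl8 :: "oct \<Rightarrow> Cl8" where
  "cl8 v = block_matrix 0 (right_mult v) (- right_mult (ocnj v)) 0"

definition nu8 :: Cl8 where
  "nu8 = mat_prod_list (map (\<lambda>i. cl8 (oct_basis i)) [1..<9])"

text \<open>The generators \<open>E 1, \<dots>, E 16\<close> of the Clifford algebra of \<open>real^16\<close>, and the products
  of generators over an index set, taken in increasing order.\<close>

definition E :: "nat \<Rightarrow> Cl16" where
  "E i = (if i \<le> 8 then tensor_mat (cl8 (oct_basis i)) nu8
          else tensor_mat (mat 1) (cl8 (oct_basis (i - 8))))"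

definition Eprod :: "nat set \<Rightarrow> Cl16" where
  "Eprod I = mat_prod_list (map E (sorted_list_of_set I))"

text \<open>The products \<open>Eprod I\<close> for \<open>I \<subseteq> {1..16}\<close> are pairwise distinct and form a basis of \<open>Cl16\<close>; both
  facts are needed for \<open>Ecoeff A I\<close> to be the coefficient of \<open>A\<close> at \<open>Eprod I\<close>.\<close>

definition Ecoeff :: "Cl16 \<Rightarrow> nat set \<Rightarrow> real" where
  "Ecoeff A I = representation (Eprod ` Pow {1..16}) A (Eprod I)"


section \<open>Exterior forms\<close>

text \<open>A \<open>k\<close>-form is a function of a sequence of vectors that only looks at the first \<open>k\<close> entries
  \<open>v 0, \<dots>, v (k - 1)\<close>. Values may be real or complex.\<close>

type_synonym ('v, 'a) form = "(nat \<Rightarrow> 'v) \<Rightarrow> 'a"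

definition alternating_form :: "nat \<Rightarrow> ('v::real_vector, 'a::real_vector) form \<Rightarrow> bool" where
  "alternating_form k \<alpha> \<longleftrightarrow>
     (\<forall>v w. (\<forall>i<k. v i = w i) \<longrightarrow> \<alpha> v = \<alpha> w) \<and>
     (\<forall>v. \<forall>i<k. linear (\<lambda>x. \<alpha> (v(i := x)))) \<and>
     (\<forall>v. \<forall>i<k. \<forall>j<k. i \<noteq> j \<and> v i = v j \<longrightarrow> \<alpha> v = 0)"

definition Alt :: "nat \<Rightarrow> ('v, 'a::real_field) form \<Rightarrow> ('v, 'a) form" where
  "Alt k \<alpha> v = (\<Sum>p | p permutes {..<k}. of_int (sign p) * \<alpha> (v \<circ> p)) / fact k"

definition tensor_form ::
  "nat \<Rightarrow> ('v, 'a::real_field) form \<Rightarrow> ('v, 'a) form \<Rightarrow> ('v, 'a) form" where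
  "tensor_form k \<alpha> \<beta> v = \<alpha> v * \<beta> (\<lambda>i. v (k + i))"

definition wedge ::
  "nat \<Rightarrow> nat \<Rightarrow> ('v, 'a::real_field) form \<Rightarrow> ('v, 'a) form \<Rightarrow> ('v, 'a) form" where
  "wedge k l \<alpha> \<beta> v =
     fact (k + l) / (fact k * fact l) * Alt (k + l) (tensor_form k \<alpha> \<beta>) v"

primrec wedge_power ::
  "nat \<Rightarrow> ('v, 'a::real_field) form \<Rightarrow> nat \<Rightarrow> ('v, 'a) form" where
  "wedge_power k \<alpha> 0 = (\<lambda>_. 1)"
| "wedge_power k \<alpha> (Suc n) = wedge k (k * n) \<alpha> (wedge_power k \<alpha> n)"

primrec wedge_list :: "('v \<Rightarrow> 'a::real_field) list \<Rightarrow> ('v, 'a) form" where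
  "wedge_list [] = (\<lambda>_. 1)"
| "wedge_list (f # fs) = wedge 1 (length fs) (\<lambda>v. f (v 0)) (wedge_list fs)"

text \<open>\<open>dx I\<close> is the form dual to the wedge product of the standard basis vectors with index in \<open>I\<close>,
  for \<open>I\<close> a subset of \<open>{1..16}\<close> (here \<open>of_nat 16 = 0\<close> as an index of \<open>real^16\<close>).\<close>

definition dx :: "nat set \<Rightarrow> (real^16, real) form" where
  "dx I = wedge_list (map (\<lambda>i x. x $ of_nat i) (sorted_list_of_set I))"

definition index_sets :: "nat \<Rightarrow> nat set set" where
  "index_sets k = {I. I \<subseteq> {1..16} \<and> card I = k}"

text \<open>Degree \<open>k\<close> component of \<open>A\<close> under the canonical isomorphism sending \<open>Eprod I\<close> to \<open>dx I\<close>.\<close>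

definition component :: "nat \<Rightarrow> Cl16 \<Rightarrow> (real^16, real) form" where
  "component k A v = (\<Sum>I\<in>index_sets k. Ecoeff A I * dx I v)"

definition volume_form :: "(real^16, real) form" where
  "volume_form = dx {1..16}"


section \<open>Comass and calibrations\<close>

text \<open>A simple \<open>k\<close>-vector \<open>\<xi>\<close> is a scalar multiple \<open>c\<close> of \<open>v 0 \<wedge> \<dots> \<wedge> v (k - 1)\<close> (the scalar matters
  only for \<open>k = 0\<close>). The coefficient of \<open>v 0 \<wedge> \<dots> \<wedge> v (k - 1)\<close> at the orthonormal basis
  element with index set \<open>I\<close> is \<open>dx I v\<close>.\<close>

definition mv_norm :: "nat \<Rightarrow> (nat \<Rightarrow> real^16) \<Rightarrow> real" where
  "mv_norm k v = sqrt (\<Sum>I\<in>index_sets k. (dx I v)\<^sup>2)"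

definition comass :: "nat \<Rightarrow> (real^16, real) form \<Rightarrow> ereal" where
  "comass k \<alpha> = Sup {ereal (c * \<alpha> v) | c v. \<bar>c\<bar> * mv_norm k v = 1}"

definition calibration :: "nat \<Rightarrow> (real^16, real) form \<Rightarrow> bool" where
  "calibration k \<alpha> \<longleftrightarrow> alternating_form k \<alpha> \<and> comass k \<alpha> \<le> 1"


section \<open>Hermitian structures\<close>

definition orthogonal_complex_structure :: "('v::euclidean_space \<Rightarrow> 'v) \<Rightarrow> bool" where
  "orthogonal_complex_structure J \<longleftrightarrow> orthogonal_transformation J \<and> (\<forall>v. J (J v) = - v)"

definition cscale :: "('v::real_vector \<Rightarrow> 'v) \<Rightarrow> complex \<Rightarrow> 'v \<Rightarrow> 'v" where
  "cscale J z v = Re z *\<^sub>R v + Im z *\<^sub>R J v"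

text \<open>The Hermitian product with real part the inner product, conjugate linear in the first argument
  and complex linear in the second.\<close>

definition hprod :: "('v::euclidean_space \<Rightarrow> 'v) \<Rightarrow> 'v \<Rightarrow> 'v \<Rightarrow> complex" where
  "hprod J v w = Complex (v \<bullet> w) (J v \<bullet> w)"

definition kaehler_form :: "('v::euclidean_space \<Rightarrow> 'v) \<Rightarrow> ('v, real) form" where
  "kaehler_form J v = Im (hprod J (v 0) (v 1))"

lemma hprod_sesquilinear:
  assumes "orthogonal_complex_structure J"
  shows "hprod J (u + v) w = hprod J u w + hprod J v w"
    and "hprod J u (v + w) = hprod J u v + hprod J u w"
    and "hprod J (cscale J z v) w = cnj z * hprod J v w"
    and "hprod J v (cscale J z w) = z * hprod J v w"
    and "hprod J w v = cnj (hprod J v w)"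
proof -
  have J: "linear J" "J (J x) = - x" "J x \<bullet> J y = x \<bullet> y" for x y
    using assms by (auto simp: orthogonal_complex_structure_def orthogonal_transformation_def)
  have skew: "x \<bullet> J y = - (J x \<bullet> y)" for x y
    using J(3)[of "J x" y] by (simp add: J(2))
  have skew': "J w \<bullet> v = - (J v \<bullet> w)"
    using skew[of v w] by (simp add: inner_commute)
  show "hprod J (u + v) w = hprod J u w + hprod J v w"
    and "hprod J u (v + w) = hprod J u v + hprod J u w"
    and "hprod J (cscale J z v) w = cnj z * hprod J v w"
    by (simp_all add: hprod_def cscale_def complex_eq_iff linear_add[OF J(1)]
        linear_cmul[OF J(1)] inner_add_left inner_add_right J algebra_simps)
  show "hprod J v (cscale J z w) = z * hprod J v w"
    by (simp add: hprod_def cscale_def complex_eq_iff inner_add_right J(3) skew[of v w])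
  show "hprod J w v = cnj (hprod J v w)"
    by (simp add: hprod_def complex_eq_iff skew' inner_commute[of w v])
qed

definition complex_subspace :: "('v::euclidean_space \<Rightarrow> 'v) \<Rightarrow> 'v set \<Rightarrow> nat \<Rightarrow> bool" where
  "complex_subspace J Y d \<longleftrightarrow> subspace Y \<and> J ` Y \<subseteq> Y \<and> dim Y = 2 * d"

definition unitary_basis ::
  "('v::euclidean_space \<Rightarrow> 'v) \<Rightarrow> 'v set \<Rightarrow> nat \<Rightarrow> (nat \<Rightarrow> 'v) \<Rightarrow> bool" where
  "unitary_basis J Y d b \<longleftrightarrow>
     (\<forall>i<d. b i \<in> Y) \<and>
     (\<forall>i<d. \<forall>j<d. hprod J (b i) (b j) = (if i = j then 1 else 0)) \<and>
     (\<forall>v\<in>Y. \<exists>z. v = (\<Sum>i<d. cscale J (z i) (b i)))"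

definition orth_proj :: "'v::euclidean_space set \<Rightarrow> 'v \<Rightarrow> 'v" where
  "orth_proj Y v = (THE y. y \<in> Y \<and> (\<forall>w\<in>Y. (v - y) \<bullet> w = 0))"

text \<open>The coordinate functions on \<open>Y\<close> are extended to the whole space by precomposition with the
  orthogonal projection onto \<open>Y\<close>.\<close>

definition coordinate_functions ::
  "('v::euclidean_space \<Rightarrow> 'v) \<Rightarrow> 'v set \<Rightarrow> nat \<Rightarrow> (nat \<Rightarrow> 'v) \<Rightarrow> (nat \<Rightarrow> 'v \<Rightarrow> complex) \<Rightarrow> bool" where
  "coordinate_functions J Y d b Z \<longleftrightarrow>
     (\<forall>v. orth_proj Y v = (\<Sum>i<d. cscale J (Z i v) (b i)))"

definition holomorphic_volume_form ::
  "('v::euclidean_space \<Rightarrow> 'v) \<Rightarrow> 'v set \<Rightarrow> nat \<Rightarrow> ('v, complex) form \<Rightarrow> bool" where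
  "holomorphic_volume_form J Y d \<Omega> \<longleftrightarrow>
     (\<exists>b Z. unitary_basis J Y d b \<and> coordinate_functions J Y d b Z \<and>
        \<Omega> = wedge_list (map Z [0..<d]))"

definition spinor_plus :: "nat \<Rightarrow> P8" where
  "spinor_plus i = axis (Inl (of_nat i)) 1"

definition spinor_s :: P16 where
  "spinor_s = tensor_vec (spinor_plus 1) (spinor_plus 1)"

definition spinor_s' :: P16 where
  "spinor_s' = tensor_vec (spinor_plus 2) (spinor_plus 2)"

definition phi :: Cl16 where
  "phi = 16\<^sup>2 *\<^sub>R outer_prod (spinor_s + spinor_s') spinor_s"

end

theory Submission
  imports Defs "HOL-Combinatorics.Multiset_Permutations"
begin

text \<open>The products \<open>Eprod I\<close> are orthogonal for the trace form, so the coefficient of \<open>phi\<close> at \<open>I\<close> is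
  \<open>(s + s') \<bullet> Eprod I s\<close>, and on an orthonormal frame \<open>u\<close> the component of degree \<open>m\<close> takes the value
  \<open>(s + s') \<bullet> \<xi> s\<close> with \<open>\<xi>\<close> the Clifford product of the frame. Cauchy--Schwarz only bounds this by \<open>sqrt 2\<close>.
  For the sharp bound, let \<open>J\<close> be the complex structure of the theorem. There is a spinor \<open>t\<close> of norm \<open>sqrt 2\<close>
  with \<open>c(J v) (s + s') = - c(v) t\<close> for all \<open>v\<close>. Up to sign, Clifford conjugation by \<open>\<xi>\<close> is an orthogonal map \<open>\<rho>\<close> of \<open>real^16\<close>, so
  \<open>\<zeta> = \<xi>\<^sup>T (s + s')\<close>, \<open>\<zeta>' = \<xi>\<^sup>T t\<close> and \<open>K = \<rho> J \<rho>\<^sup>-\<^sup>1\<close> satisfy \<open>c(v) c(K v) \<zeta> = \<zeta>'\<close> for every unit vector \<open>v\<close>.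
  Take \<open>v\<close> in the first and \<open>w\<close> in the second summand of \<open>real^8 \<times> real^8\<close> with \<open>w\<close> orthogonal to \<open>K v\<close>.
  Then \<open>c(v) c(K v) s\<close> and \<open>c(w) c(K w) s\<close> are orthonormal and both have inner product \<open>s \<bullet> \<zeta>\<close> with \<open>\<zeta>'\<close>,
  whence \<open>2 (s \<bullet> \<zeta>)\<^sup>2 \<le> \<zeta>' \<bullet> \<zeta>' = 2\<close>.

  For the formula in degree 8, \<open>J\<close> rotates each coordinate plane \<open>{2 j + 1, 2 j + 2}\<close> with a sign \<open>eps j\<close>.
  The coefficient of \<open>phi\<close> at an index set vanishes unless the planes met in exactly one index form
  nothing, \<open>X1\<close>, \<open>X2\<close> or \<open>X\<close>; these cases give \<open>\<omega>\<^sup>4 / 4!\<close>, the two mixed terms and \<open>Re \<Omega>\<close>.\<close>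

section \<open>Octonions and the Clifford algebra of \<open>real^8\<close>\<close>

lemma vector_8 [simp]:
  "(vector [a,b,c,d,e,f,g,h] :: 'a::zero^8) $ 1 = a"
  "(vector [a,b,c,d,e,f,g,h] :: 'a::zero^8) $ 2 = b"
  "(vector [a,b,c,d,e,f,g,h] :: 'a::zero^8) $ 3 = c"
  "(vector [a,b,c,d,e,f,g,h] :: 'a::zero^8) $ 4 = d"
  "(vector [a,b,c,d,e,f,g,h] :: 'a::zero^8) $ 5 = e"
  "(vector [a,b,c,d,e,f,g,h] :: 'a::zero^8) $ 6 = f"
  "(vector [a,b,c,d,e,f,g,h] :: 'a::zero^8) $ 7 = g"
  "(vector [a,b,c,d,e,f,g,h] :: 'a::zero^8) $ 8 = h"
  unfolding vector_def by simp_all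

lemma vector_4 [simp]:
  "(vector [a,b,c,d] :: 'a::zero^4) $ 1 = a"
  "(vector [a,b,c,d] :: 'a::zero^4) $ 2 = b"
  "(vector [a,b,c,d] :: 'a::zero^4) $ 3 = c"
  "(vector [a,b,c,d] :: 'a::zero^4) $ 4 = d"
  unfolding vector_def by simp_all

text \<open>A difference strictly between 0 and the characteristic is not divisible by it. The range
  starts at 1, so \<open>1, ..., 8\<close> and \<open>1, ..., 16\<close> are complete sets of
  indices although the last one equals 0 in the numeral type.\<close>

lemma inj_on_of_nat_index: "inj_on (of_nat :: nat \<Rightarrow> 'a::comm_ring_1) {1..CHAR('a)}"
proof (rule linorder_inj_onI)
  fix i j :: nat assume *: "i < j" "i \<in> {1..CHAR('a)}" "j \<in> {1..CHAR('a)}"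
  then have "\<not> CHAR('a) dvd j - i"
    by (auto dest: dvd_imp_le)
  then have "of_nat (j - i) \<noteq> (0 :: 'a)"
    by (simp add: of_nat_eq_0_iff_char_dvd)
  with * show "(of_nat i :: 'a) \<noteq> of_nat j"
    by (simp add: of_nat_diff)
qed auto

lemma bij_betw_of_nat_8: "bij_betw (of_nat :: nat \<Rightarrow> 8) {1..8} UNIV"
  and bij_betw_of_nat_16: "bij_betw (of_nat :: nat \<Rightarrow> 16) {1..16} UNIV"
proof -
  have 8: "inj_on (of_nat :: nat \<Rightarrow> 8) {1..8}"
    using inj_on_of_nat_index[where 'a = 8] by simp
  then show "bij_betw (of_nat :: nat \<Rightarrow> 8) {1..8} UNIV"
    by (simp add: bij_betw_def card_subset_eq card_image)
  have 16: "inj_on (of_nat :: nat \<Rightarrow> 16) {1..16}"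
    using inj_on_of_nat_index[where 'a = 16] by simp
  then show "bij_betw (of_nat :: nat \<Rightarrow> 16) {1..16} UNIV"
    by (simp add: bij_betw_def card_subset_eq card_image)
qed

lemma interval_8: "{1..8::nat} = {1, 2, 3, 4, 5, 6, 7, 8}"
  by auto

lemma UNIV_8: "(UNIV :: 8 set) = {1, 2, 3, 4, 5, 6, 7, 8}"
  using bij_betw_imp_surj_on[OF bij_betw_of_nat_8] unfolding interval_8 by simp

lemma forall_8: "(\<forall>i::8. P i) \<longleftrightarrow> P 1 \<and> P 2 \<and> P 3 \<and> P 4 \<and> P 5 \<and> P 6 \<and> P 7 \<and> P 8"
  using UNIV_8 by (metis UNIV_I empty_iff insert_iff)

lemma sum_8: "sum f (UNIV :: 8 set) = f 1 + f 2 + f 3 + f 4 + f 5 + f 6 + f 7 + f 8"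
  unfolding UNIV_8 by (simp add: add_ac)

lemma eq_oct_iff: "(x :: oct) = y \<longleftrightarrow> x$1 = y$1 \<and> x$2 = y$2 \<and> x$3 = y$3 \<and> x$4 = y$4 \<and>
   x$5 = y$5 \<and> x$6 = y$6 \<and> x$7 = y$7 \<and> x$8 = y$8"
  by (simp add: vec_eq_iff forall_8)

lemmas oct_mult_defs = omult_def Let_def opair_def ofst_def osnd_def qmult_def qcnj_def

lemma linear_omult: "linear (\<lambda>w. omult w v)" "linear (omult w)"
  by (rule linearI; simp add: eq_oct_iff oct_mult_defs algebra_simps)+

lemma linear_ocnj: "linear ocnj"
  by (rule linearI; simp add: eq_oct_iff ocnj_def oct_mult_defs algebra_simps)

text \<open>This instance of alternativity, checked in coordinates, is the octonion identity behind
  the Clifford relation in dimension 8.\<close>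

lemma omult_ocnj: "omult (omult w v) (ocnj v) = (v \<bullet> v) *\<^sub>R w"
  by (simp add: eq_oct_iff oct_mult_defs ocnj_def inner_vec_def sum_8 algebra_simps)

text \<open>What makes \<open>cl8 v\<close> skew-symmetric: its two off-diagonal blocks are minus
  the transposes of each other.\<close>

lemma inner_omult: "omult w v \<bullet> x = w \<bullet> omult x (ocnj v)"
  by (simp add: oct_mult_defs ocnj_def inner_vec_def sum_8 algebra_simps)

lemma ocnj_ocnj [simp]: "ocnj (ocnj v) = v"
  by (simp add: eq_oct_iff oct_mult_defs ocnj_def)

lemma inner_ocnj: "ocnj v \<bullet> ocnj w = v \<bullet> w"
  by (simp add: oct_mult_defs ocnj_def inner_vec_def sum_8)

lemma right_mult_works: "right_mult v *v w = omult w v"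
  by (simp add: right_mult_def matrix_works linear_omult linear_matrix_vector_mul_eq)

section \<open>The spinor module \<open>P8\<close> and its Clifford action\<close>

definition inl :: "oct \<Rightarrow> P8" where
  "inl x = (\<chi> i. case i of Inl a \<Rightarrow> x $ a | Inr b \<Rightarrow> 0)"

definition inr :: "oct \<Rightarrow> P8" where
  "inr x = (\<chi> i. case i of Inl a \<Rightarrow> 0 | Inr b \<Rightarrow> x $ b)"

lemma linear_inl: "linear inl" and linear_inr: "linear inr"
  by (auto intro!: linearI simp: inl_def inr_def vec_eq_iff split: sum.splits)

lemmas inl_simps = linear_add[OF linear_inl] linear_cmul[OF linear_inl] linear_neg[OF linear_inl] linear_diff[OF linear_inl] linear_0[OF linear_inl]
lemmas inr_simps = linear_add[OF linear_inr] linear_cmul[OF linear_inr] linear_neg[OF linear_inr] linear_diff[OF linear_inr] linear_0[OF linear_inr]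

lemma sum_Plus: "(\<Sum>i\<in>(UNIV :: ('a::finite + 'b::finite) set). f i) = (\<Sum>a\<in>UNIV. f (Inl a)) + (\<Sum>b\<in>UNIV. f (Inr b))"
  by (simp add: UNIV_Plus_UNIV[symmetric] sum.Plus del: UNIV_Plus_UNIV)

lemma inner_inl_inr [simp]:
  "inl x \<bullet> inl y = x \<bullet> y" "inr x \<bullet> inr y = x \<bullet> y" "inl x \<bullet> inr y = 0" "inr x \<bullet> inl y = 0"
  by (simp_all add: inner_vec_def sum_Plus inl_def inr_def)

lemma P8_cases:
  obtains x y where "p = inl x + inr y"
proof
  show "p = inl (\<chi> i. p $ Inl i) + inr (\<chi> i. p $ Inr i)"
    by (simp add: vec_eq_iff inl_def inr_def split: sum.splits)
qed

lemma Cl8_eqI: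
  assumes "\<And>x. (A :: Cl8) *v inl x = B *v inl x" "\<And>x. A *v inr x = B *v inr x"
  shows "A = B"
  unfolding matrix_eq using assms by (metis P8_cases matrix_vector_right_distrib)

lemma spinor_plus_eq: "spinor_plus i = inl (oct_basis i)"
  by (simp add: vec_eq_iff spinor_plus_def inl_def oct_basis_def axis_def split: sum.splits)

lemma cl8_inl: "cl8 v *v inl x = - inr (omult x (ocnj v))"
  and cl8_inr: "cl8 v *v inr x = inl (omult x v)"
  unfolding right_mult_works[symmetric]
  by (simp_all add: cl8_def block_matrix_def vec_eq_iff matrix_vector_mult_def inl_def inr_def sum_Plus
      sum_negf split: sum.splits)

lemma linear_cl8: "linear cl8"
  by (rule linearI; rule Cl8_eqI; simp add: cl8_inl cl8_inr matrix_vector_mult_add_rdistrib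
      scaleR_matrix_vector_assoc[symmetric] linear_add[OF linear_omult(2)] linear_cmul[OF linear_omult(2)]
      linear_add[OF linear_ocnj] linear_cmul[OF linear_ocnj] inl_simps inr_simps)

lemma cl8_cl8_vec: "cl8 v *v (cl8 v *v p) = - (v \<bullet> v) *\<^sub>R p"
proof -
  obtain x y where p: "p = inl x + inr y" by (rule P8_cases)
  have "omult (omult x (ocnj v)) v = (v \<bullet> v) *\<^sub>R x"
    using omult_ocnj[of x "ocnj v"] by (simp add: inner_ocnj)
  then show ?thesis
    by (simp add: p matrix_vector_right_distrib matrix_vector_mult_diff_distrib cl8_inl cl8_inr linear_neg[OF linear_omult(1)]
      linear_neg[OF linear_omult(2)] linear_neg[OF linear_ocnj] inl_simps inr_simps omult_ocnj scaleR_add_right)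
qed

lemma cl8_skew: "(cl8 v *v p) \<bullet> q = - (p \<bullet> (cl8 v *v q))"
proof -
  obtain x y where p: "p = inl x + inr y" by (rule P8_cases)
  obtain x' y' where q: "q = inl x' + inr y'" by (rule P8_cases)
  show ?thesis
    using inner_omult[of x "ocnj v" y'] inner_omult[of y v x']
    by (simp add: p q matrix_vector_right_distrib cl8_inl cl8_inr inner_add_left inner_add_right inner_diff_left inner_diff_right)
qed

lemma inner_cl8: "(cl8 v *v p) \<bullet> (cl8 v *v p) = (v \<bullet> v) * (p \<bullet> p)"
  by (simp add: cl8_skew cl8_cl8_vec)

lemma oct_basis_eq:
  "oct_basis (Suc 0) = vector [1, 0, 0, 0, 0, 0, 0, 0]"
  "oct_basis 2 = vector [0, 1, 0, 0, 0, 0, 0, 0]"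
  "oct_basis 3 = vector [0, 0, 1, 0, 0, 0, 0, 0]"
  "oct_basis 4 = vector [0, 0, 0, 1, 0, 0, 0, 0]"
  "oct_basis 5 = vector [0, 0, 0, 0, 1, 0, 0, 0]"
  "oct_basis 6 = vector [0, 0, 0, 0, 0, 1, 0, 0]"
  "oct_basis 7 = vector [0, 0, 0, 0, 0, 0, 1, 0]"
  "oct_basis 8 = vector [0, 0, 0, 0, 0, 0, 0, 1]"
  unfolding eq_oct_iff oct_basis_def by (simp_all add: axis_def)

text \<open>Each basis octonion permutes the coordinates up to sign. With this table, words of up to
  eight generators can be evaluated by rewriting, first for \<open>nu8\<close> and later for the
  coefficients of \<open>phi\<close>.\<close>

lemma omult_oct_basis:
  "omult x (oct_basis (Suc 0)) = vector [x$1, x$2, x$3, x$4, x$5, x$6, x$7, x$8]"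
  "omult x (oct_basis 2) = vector [- x$2, x$1, x$4, - x$3, x$6, - x$5, - x$8, x$7]"
  "omult x (oct_basis 3) = vector [- x$3, - x$4, x$1, x$2, x$7, x$8, - x$5, - x$6]"
  "omult x (oct_basis 4) = vector [- x$4, x$3, - x$2, x$1, x$8, - x$7, x$6, - x$5]"
  "omult x (oct_basis 5) = vector [- x$5, - x$6, - x$7, - x$8, x$1, x$2, x$3, x$4]"
  "omult x (oct_basis 6) = vector [- x$6, x$5, - x$8, x$7, - x$2, x$1, - x$4, x$3]"
  "omult x (oct_basis 7) = vector [- x$7, x$8, x$5, - x$6, - x$3, x$4, x$1, - x$2]"
  "omult x (oct_basis 8) = vector [- x$8, - x$7, x$6, x$5, - x$4, - x$3, x$2, x$1]"
  by (simp_all add: oct_basis_eq eq_oct_iff oct_mult_defs)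

lemma ocnj_oct_basis:
  "ocnj (oct_basis (Suc 0)) = oct_basis (Suc 0)"
  "ocnj (oct_basis 2) = - oct_basis 2"
  "ocnj (oct_basis 3) = - oct_basis 3"
  "ocnj (oct_basis 4) = - oct_basis 4"
  "ocnj (oct_basis 5) = - oct_basis 5"
  "ocnj (oct_basis 6) = - oct_basis 6"
  "ocnj (oct_basis 7) = - oct_basis 7"
  "ocnj (oct_basis 8) = - oct_basis 8"
  by (simp_all add: oct_basis_eq eq_oct_iff oct_mult_defs ocnj_def)

lemma upt_1_9: "[1..<9] = [1, 2, 3, 4, 5, 6, 7, 8 :: nat]"
  by (simp add: upt_conv_Cons)

lemmas cl8_oct_basis = cl8_inl cl8_inr omult_oct_basis ocnj_oct_basis linear_neg[OF linear_omult(2)]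

lemma nu8_inl: "nu8 *v inl x = inl x" and nu8_inr: "nu8 *v inr x = - inr x"
proof -
  show "nu8 *v inl x = inl x"
    unfolding nu8_def mat_prod_list_def upt_1_9
    by (simp add: matrix_vector_mul_assoc[symmetric] cl8_oct_basis inr_simps(3)[symmetric] inl_simps(3)[symmetric])
      (rule arg_cong[where f = inl], simp add: eq_oct_iff)
  show "nu8 *v inr x = - inr x"
    unfolding nu8_def mat_prod_list_def upt_1_9 inr_simps(3)[symmetric]
    by (simp add: matrix_vector_mul_assoc[symmetric] cl8_oct_basis inr_simps(3)[symmetric] inl_simps(3)[symmetric])
      (rule arg_cong[where f = inr], simp add: eq_oct_iff)
qed

lemma nu8_nu8: "nu8 *v (nu8 *v p) = p"
  by (rule P8_cases[of p]) (simp add: matrix_vector_right_distrib matrix_vector_mult_diff_distrib nu8_inl nu8_inr)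

text \<open>\<open>nu8\<close> is the grading of the two summands and \<open>cl8 v\<close> exchanges
  them. This is why the first eight generators \<open>E i\<close>, which carry \<open>nu8\<close> in
  the second factor, anticommute with the last eight.\<close>

lemma cl8_nu8: "cl8 v *v (nu8 *v p) = - (nu8 *v (cl8 v *v p))"
  by (rule P8_cases[of p]) (simp add: matrix_vector_right_distrib matrix_vector_mult_diff_distrib
    nu8_inl nu8_inr cl8_inl cl8_inr)

lemma nu8_symmetric: "(nu8 *v p) \<bullet> q = p \<bullet> (nu8 *v q)"
  by (rule P8_cases[of p]; rule P8_cases[of q])
    (simp add: matrix_vector_right_distrib nu8_inl nu8_inr inner_add_left inner_add_right inner_diff_left inner_diff_right)

section \<open>The Clifford algebra of \<open>real^16\<close>\<close>

lemma inner_transpose: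
  fixes A :: "real^'n^'n"
  shows "(transpose A *v x) \<bullet> y = x \<bullet> (A *v y)"
  by (simp add: dot_lmul_matrix)

lemma transpose_eqI:
  fixes A B :: "real^'n^'n"
  assumes "\<And>x y. (A *v x) \<bullet> y = x \<bullet> (B *v y)"
  shows "transpose A = B"
  unfolding matrix_eq
proof
  fix y
  have "x \<bullet> (transpose A *v y - B *v y) = 0" for x
    using assms[of x y] inner_transpose[of A y x]
    by (simp add: inner_diff_right inner_commute del: transpose_matrix_vector)
  from this[of "transpose A *v y - B *v y"] show "transpose A *v y = B *v y"
    by simp
qed

lemma minus_matrix_vector_mult: "(- A :: real^'n^'m) *v x = - (A *v x)"
  by (simp add: matrix_vector_mult_def vec_eq_iff sum_negf)

lemma minus_matrix_mult: "(- A :: real^'n^'m) ** B = - (A ** B)"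
  by (simp add: matrix_matrix_mult_def vec_eq_iff sum_negf)

lemma matrix_mult_add_left: "(A + B :: real^'n^'m) ** C = A ** C + B ** C"
  by (simp add: matrix_matrix_mult_def vec_eq_iff sum.distrib algebra_simps)

lemma transpose_tensor_mat: "transpose (tensor_mat A B) = tensor_mat (transpose A) (transpose B)"
  by (simp add: tensor_mat_def transpose_def vec_eq_iff)

lemma tensor_vec_bilinear:
  "tensor_vec (x + y) z = tensor_vec x z + tensor_vec y z"
  "tensor_vec (x - y) z = tensor_vec x z - tensor_vec y z"
  "tensor_vec (- x) z = - tensor_vec x z"
  "tensor_vec (c *\<^sub>R x) z = c *\<^sub>R tensor_vec x z"
  "tensor_vec u (v + w) = tensor_vec u v + tensor_vec u w"
  "tensor_vec u (v - w) = tensor_vec u v - tensor_vec u w"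
  "tensor_vec u (- v) = - tensor_vec u v"
  "tensor_vec u (c *\<^sub>R v) = c *\<^sub>R tensor_vec u v"
  "tensor_vec 0 z = 0" "tensor_vec u 0 = 0"
  by (simp_all add: tensor_vec_def vec_eq_iff algebra_simps)

lemma tensor_mat_bilinear:
  "tensor_mat (A + B) C = tensor_mat A C + tensor_mat B C"
  "tensor_mat (c *\<^sub>R A) C = c *\<^sub>R tensor_mat A C"
  "tensor_mat A (C + D) = tensor_mat A C + tensor_mat A D"
  "tensor_mat A (c *\<^sub>R C) = c *\<^sub>R tensor_mat A C"
  "tensor_mat (- A) C = - tensor_mat A C"
  "tensor_mat A (- C) = - tensor_mat A C"
  by (simp_all add: tensor_mat_def vec_eq_iff algebra_simps)

text \<open>The standard basis vectors of the tensor product are pure tensors, so all columns can be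
  compared on these.\<close>

lemma tensor_mat_eqI:
  fixes A B :: "real^('n::finite \<times> 'm::finite)^('n \<times> 'm)"
  assumes "\<And>v w. A *v tensor_vec v w = B *v tensor_vec v w"
  shows "A = B"
proof -
  have "column p A = column p B" for p
  proof -
    have "axis p 1 = tensor_vec (axis (fst p) 1) (axis (snd p) (1 :: real))"
      by (simp add: vec_eq_iff axis_def tensor_vec_def prod_eq_iff)
    then have "A *v axis p 1 = B *v axis p 1"
      using assms by metis
    then show ?thesis by (simp add: matrix_vector_mult_basis)
  qed
  then show ?thesis by (simp add: vec_eq_iff column_def)
qed

section \<open>The Clifford map on all of \<open>real^16\<close>\<close>

definition lo :: "real^16 \<Rightarrow> oct" where
  "lo v = vector [v$1, v$2, v$3, v$4, v$5, v$6, v$7, v$8]"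

definition hi :: "real^16 \<Rightarrow> oct" where
  "hi v = vector [v$9, v$10, v$11, v$12, v$13, v$14, v$15, v$16]"

lemma linear_lo: "linear lo" and linear_hi: "linear hi"
  by (auto intro!: linearI simp: lo_def hi_def eq_oct_iff)

lemma interval_16: "{1..16::nat} = {1, 2, 3, 4, 5, 6, 7, 8, 9, 10, 11, 12, 13, 14, 15, 16}"
  by (auto simp: le_Suc_eq numeral_eq_Suc)

lemma UNIV_16: "(UNIV :: 16 set) = {1, 2, 3, 4, 5, 6, 7, 8, 9, 10, 11, 12, 13, 14, 15, 16}"
  using bij_betw_imp_surj_on[OF bij_betw_of_nat_16] unfolding interval_16 by simp

lemma forall_16: "(\<forall>i::16. P i) \<longleftrightarrow> P 1 \<and> P 2 \<and> P 3 \<and> P 4 \<and> P 5 \<and> P 6 \<and> P 7 \<and> P 8 \<and>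
    P 9 \<and> P 10 \<and> P 11 \<and> P 12 \<and> P 13 \<and> P 14 \<and> P 15 \<and> P 16"
proof -
  have "(\<forall>i::16. P i) \<longleftrightarrow> (\<forall>i\<in>UNIV. P i)" by simp
  then show ?thesis unfolding UNIV_16 by simp
qed

lemma sum_16: "sum f (UNIV :: 16 set) = f 1 + f 2 + f 3 + f 4 + f 5 + f 6 + f 7 + f 8 +
    f 9 + f 10 + f 11 + f 12 + f 13 + f 14 + f 15 + f 16"
  unfolding UNIV_16 by (simp add: add_ac)

lemma inner_lo_hi: "v \<bullet> w = lo v \<bullet> lo w + hi v \<bullet> hi w"
  by (simp add: inner_vec_def sum_16 sum_8 lo_def hi_def)

text \<open>The linear extension of the generators (see \<open>clifford_axis\<close>). The comass
  bound concerns arbitrary orthonormal frames, so arbitrary vectors have to act.\<close>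

definition clifford :: "real^16 \<Rightarrow> Cl16" where
  "clifford v = tensor_mat (cl8 (lo v)) nu8 + tensor_mat (mat 1) (cl8 (hi v))"

lemma linear_clifford: "linear clifford"
  by (rule linearI) (simp_all add: clifford_def tensor_mat_bilinear linear_add[OF linear_lo] linear_cmul[OF linear_lo]
    linear_add[OF linear_hi] linear_cmul[OF linear_hi] linear_add[OF linear_cl8] linear_cmul[OF linear_cl8]
    scaleR_add_right)

lemma clifford_axis:
  assumes "i \<in> {1..16}"
  shows "clifford (axis (of_nat i) 1) = E i"
proof -
  have "cl8 0 = 0" by (rule linear_0[OF linear_cl8])
  moreover have "tensor_mat (0 :: Cl8) B = 0" "tensor_mat A (0 :: Cl8) = 0" for A B :: Cl8
    by (simp_all add: tensor_mat_def vec_eq_iff)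
  moreover have "\<forall>i\<in>{1..16}. (lo (axis (of_nat i) 1) = (if i \<le> 8 then oct_basis i else 0) \<and>
     hi (axis (of_nat i) 1) = (if i \<le> 8 then 0 else oct_basis (i - 8)))"
    unfolding interval_16 by (simp add: lo_def hi_def eq_oct_iff oct_basis_eq axis_def)
  ultimately show ?thesis
    using assms by (auto simp: clifford_def E_def)
qed

lemma clifford_tensor:
  "clifford v *v tensor_vec p q =
    tensor_vec (cl8 (lo v) *v p) (nu8 *v q) + tensor_vec p (cl8 (hi v) *v q)"
  by (simp add: clifford_def matrix_vector_mult_add_rdistrib tensor_mat_vector)

text \<open>In the square of \<open>cl8 a \<otimes> nu8 + 1 \<otimes> cl8 b\<close> the mixed terms
  cancel because \<open>nu8\<close> anticommutes with \<open>cl8 b\<close>; the others combine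
  because \<open>nu8\<close> is an involution.\<close>

lemma clifford_square: "clifford v ** clifford v = - (v \<bullet> v) *\<^sub>R mat 1"
proof (rule tensor_mat_eqI)
  fix p q
  show "(clifford v ** clifford v) *v tensor_vec p q = - (v \<bullet> v) *\<^sub>R mat 1 *v tensor_vec p q"
    by (simp add: matrix_vector_mul_assoc[symmetric] clifford_tensor matrix_vector_right_distrib
      cl8_cl8_vec nu8_nu8 cl8_nu8 tensor_vec_bilinear scaleR_matrix_vector_assoc[symmetric]
      inner_lo_hi[of v v] scaleR_left_diff_distrib matrix_vector_mult_diff_rdistrib minus_matrix_vector_mult)
qed

lemma clifford_anticommute: "clifford v ** clifford w = - (clifford w ** clifford v) - (2 * (v \<bullet> w)) *\<^sub>R mat 1"
proof -
  \<comment> \<open>Polarisation of the square of \<open>clifford (v + w)\<close>.\<close>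
  have "clifford v ** clifford w + clifford w ** clifford v + (2 * (v \<bullet> w)) *\<^sub>R mat 1 = 0"
    using clifford_square[of "v + w"]
    by (simp add: linear_add[OF linear_clifford] matrix_add_ldistrib matrix_mult_add_left clifford_square
      inner_add_left inner_add_right inner_commute[of w v] algebra_simps)
  then show ?thesis
    by (simp add: eq_neg_iff_add_eq_0 algebra_simps)
qed

lemma transpose_clifford: "transpose (clifford v) = - clifford v"
proof -
  have "transpose (A + B) = transpose A + transpose B" for A B :: Cl16
    by (simp add: transpose_def vec_eq_iff)
  moreover have "transpose (cl8 x) = - cl8 x" for x
    by (rule transpose_eqI) (simp add: cl8_skew minus_matrix_vector_mult)
  moreover have "transpose nu8 = nu8"
    by (rule transpose_eqI) (rule nu8_symmetric)
  ultimately show ?thesis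
    by (simp add: clifford_def transpose_tensor_mat tensor_mat_bilinear)
qed

lemma clifford_skew: "(clifford v *v x) \<bullet> y = - (x \<bullet> (clifford v *v y))"
  using inner_transpose[of "clifford v" x y] by (simp add: transpose_clifford minus_matrix_vector_mult del: transpose_matrix_vector)

lemma clifford_clifford_vec: "clifford v *v (clifford v *v x) = - (v \<bullet> v) *\<^sub>R x"
  by (simp add: matrix_vector_mul_assoc clifford_square scaleR_matrix_vector_assoc[symmetric] minus_matrix_vector_mult)

lemma orthogonal_clifford: "norm v = 1 \<Longrightarrow> orthogonal_matrix (clifford v)"
  by (simp add: orthogonal_matrix transpose_clifford clifford_square dot_square_norm minus_matrix_mult)

lemma E_anticommute:
  assumes "i \<in> {1..16}" "j \<in> {1..16}" "i \<noteq> j"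
  shows "E i ** E j = - (E j ** E i)"
proof -
  have "(of_nat i :: 16) \<noteq> of_nat j"
    using assms inj_on_eq_iff[OF bij_betw_imp_inj_on[OF bij_betw_of_nat_16], of i j] by blast
  then show ?thesis
    using clifford_anticommute[of "axis (of_nat i) 1" "axis (of_nat j) 1"] assms(1,2)
    by (simp add: clifford_axis inner_axis_axis)
qed

lemma orthogonal_E: "i \<in> {1..16} \<Longrightarrow> orthogonal_matrix (E i)"
  using orthogonal_clifford[of "axis (of_nat i) 1"] by (simp add: clifford_axis)

section \<open>Products of generators as an orthogonal basis\<close>

lemma mat_prod_list_simps [simp]:
  "mat_prod_list [] = mat 1" "mat_prod_list (A # As) = A ** mat_prod_list As"
  by (simp_all add: mat_prod_list_def)

lemma mat_prod_list_append: "mat_prod_list (As @ Bs) = mat_prod_list As ** mat_prod_list Bs"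
  by (induction As) (simp_all add: matrix_mul_assoc)

lemma orthogonal_mat_prod_list:
  "\<forall>A\<in>set As. orthogonal_matrix A \<Longrightarrow> orthogonal_matrix (mat_prod_list As)"
  by (induction As) (auto simp: orthogonal_matrix_id orthogonal_matrix_mul)

lemma inner_matrix_trace:
  fixes A B :: "real^'n^'n"
  shows "A \<bullet> B = trace (transpose A ** B)"
proof -
  have "A \<bullet> B = (\<Sum>i\<in>UNIV. \<Sum>j\<in>UNIV. A $ i $ j * B $ i $ j)"
    by (simp add: inner_vec_def)
  also have "\<dots> = (\<Sum>j\<in>UNIV. \<Sum>i\<in>UNIV. A $ i $ j * B $ i $ j)"
    by (rule sum.swap)
  finally show ?thesis
    by (simp add: trace_def matrix_matrix_mult_def transpose_def)
qed

text \<open>The matrix inner product is the trace form, and a trace is unchanged under cyclic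
  permutation. Used on both sides, this gives invariance under conjugation by a generator.\<close>

lemma inner_orthogonal_conj:
  fixes A B X :: "real^'n^'n"
  assumes "orthogonal_matrix X"
  shows "(X ** A) \<bullet> (X ** B) = A \<bullet> B" "(A ** X) \<bullet> (B ** X) = A \<bullet> B"
proof -
  have X: "transpose X ** X = mat 1" "X ** transpose X = mat 1"
    using assms by (auto simp: orthogonal_matrix_def)
  have "transpose (X ** A) ** (X ** B) = transpose A ** (transpose X ** X) ** B"
    by (simp add: matrix_transpose_mul matrix_mul_assoc)
  then show "(X ** A) \<bullet> (X ** B) = A \<bullet> B"
    by (simp add: inner_matrix_trace X)
  have "trace (transpose (A ** X) ** (B ** X)) = trace (transpose X ** (transpose A ** B ** X))"
    by (simp add: matrix_transpose_mul matrix_mul_assoc)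
  also have "\<dots> = trace ((transpose A ** B ** X) ** transpose X)"
    by (rule trace_mul_sym)
  also have "\<dots> = trace (transpose A ** B)"
    by (simp add: matrix_mul_assoc[symmetric] X)
  finally show "(A ** X) \<bullet> (B ** X) = A \<bullet> B"
    by (simp add: inner_matrix_trace)
qed

lemma inner_orthogonal_matrix_self:
  fixes X :: "real^'n^'n"
  assumes "orthogonal_matrix X"
  shows "X \<bullet> X = real CARD('n)"
  using assms by (simp add: inner_matrix_trace orthogonal_matrix_def trace_I)

text \<open>Moving \<open>E i\<close> through the word costs a sign at every letter except
  \<open>i\<close>, which commutes with it.\<close>

lemma E_mat_prod_list:
  assumes "i \<in> {1..16}" "set xs \<subseteq> {1..16}"
  shows "E i ** mat_prod_list (map E xs) =
    (\<Prod>x\<leftarrow>xs. if x = i then 1 else -1) *\<^sub>R (mat_prod_list (map E xs) ** E i)"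
  using assms(2)
proof (induction xs)
  case (Cons x xs)
  let ?P = "mat_prod_list (map E xs)"
  have "E i ** E x = (if x = i then 1 else -1) *\<^sub>R (E x ** E i)"
    using E_anticommute[of i x] assms Cons.prems by auto
  then have "E i ** (E x ** ?P) = (if x = i then 1 else -1) *\<^sub>R (E x ** (E i ** ?P))"
    by (simp add: matrix_mul_assoc scalar_matrix_assoc)
  with Cons show ?case
    by (simp add: matrix_mul_assoc matrix_scalar_ac scalar_matrix_assoc)
qed simp

lemma orthogonal_Eprod:
  assumes "I \<subseteq> {1..16}"
  shows "orthogonal_matrix (Eprod I)"
proof -
  have "set (sorted_list_of_set I) = I"
    using finite_subset[OF assms] by simp
  then show ?thesis
    unfolding Eprod_def using assms by (intro orthogonal_mat_prod_list) (auto intro!: orthogonal_E)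
qed

lemma E_Eprod:
  assumes "i \<in> {1..16}" "I \<subseteq> {1..16}"
  shows "E i ** Eprod I = (\<Prod>x\<in>I. if x = i then 1 else -1) *\<^sub>R (Eprod I ** E i)"
proof -
  have "finite I" using assms(2) finite_subset by blast
  then show ?thesis
    using E_mat_prod_list[OF assms(1), of "sorted_list_of_set I"] assms(2)
    by (simp add: Eprod_def prod.distinct_set_conv_list[symmetric])
qed

text \<open>Conjugation by \<open>E i\<close> preserves the inner product and multiplies
  \<open>Eprod I\<close> by \<open>(-1) ^ card (I - {i})\<close>. If some \<open>i\<close> gives
  opposite signs for \<open>I\<close> and \<open>J\<close>, the inner product equals its own
  negative. The value 256 is the dimension of \<open>P16\<close>.\<close>

lemma inner_Eprod:
  assumes "I \<subseteq> {1..16}" "J \<subseteq> {1..16}"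
  shows "Eprod I \<bullet> Eprod J = (if I = J then 256 else 0)"
proof (cases "I = J")
  case True
  then show ?thesis
    using inner_orthogonal_matrix_self[OF orthogonal_Eprod[OF assms(1)]] by simp
next
  case False
  have fin: "finite I" "finite J" using assms finite_subset by blast+
  define sg :: "nat \<Rightarrow> nat set \<Rightarrow> real" where "sg i I = (\<Prod>x\<in>I. if x = i then 1 else -1)" for i I
  have sg: "sg i K = (-1) ^ card (K - {i})" if "finite K" for i K
  proof -
    have "sg i K = (\<Prod>x\<in>K - {i}. -1)"
      unfolding sg_def by (intro prod.mono_neutral_cong_right) (use that in auto)
    then show ?thesis by simp
  qed
  obtain i where i: "i \<in> {1..16}" "sg i I * sg i J = -1"
  proof (cases "even (card I + card J)")
    case True
    \<comment> \<open>Such an \<open>i\<close> lies in exactly one of the two sets, so removing it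
      changes the parity of one cardinality only.\<close>
    obtain i where i: "i \<in> (I - J) \<union> (J - I)" using False by blast
    have "odd (card (I - {i}) + card (J - {i}))"
    proof (cases "i \<in> I")
      case True
      with i fin have "card I = Suc (card (I - {i}))" "J - {i} = J"
        by (metis card_Suc_Diff1, auto)
      with \<open>even (card I + card J)\<close> show ?thesis by simp
    next
      case False
      with i fin have "card J = Suc (card (J - {i}))" "I - {i} = I"
        by (metis Un_iff Diff_iff card_Suc_Diff1, auto)
      with \<open>even (card I + card J)\<close> show ?thesis by simp
    qed
    then show ?thesis
      using i assms by (intro that[of i]) (auto simp: sg fin power_add[symmetric])
  next
    case odd: False
    \<comment> \<open>In the odd case the symmetric difference has odd size and so misses one of the
      16 indices. Removing a missed index changes both cardinalities or neither, which keeps the sum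
      odd.\<close>
    have "(I - J) \<union> (J - I) \<noteq> {1..16}"
    proof
      assume "(I - J) \<union> (J - I) = {1..16}"
      moreover have "card ((I - J) \<union> (J - I)) = card (I - J) + card (J - I)"
        using fin by (intro card_Un_disjoint) auto
      moreover have "card I = card (I - J) + card (I \<inter> J)" "card J = card (J - I) + card (I \<inter> J)"
        using fin by (metis add.commute card_Int_Diff Int_commute)+
      ultimately have "card I + card J = 16 + 2 * card (I \<inter> J)" by simp
      with odd show False by simp
    qed
    then obtain i where i: "i \<in> {1..16}" "i \<in> I \<longleftrightarrow> i \<in> J" using assms by blast
    have "odd (card (I - {i}) + card (J - {i}))"
    proof (cases "i \<in> I")
      case True
      with i fin have "card I = Suc (card (I - {i}))" "card J = Suc (card (J - {i}))"
        by (metis card_Suc_Diff1)+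
      with odd show ?thesis by simp
    qed (use i odd in auto)
    then show ?thesis
      using i by (intro that[of i]) (auto simp: sg fin power_add[symmetric])
  qed
  have "Eprod I \<bullet> Eprod J = (E i ** Eprod I) \<bullet> (E i ** Eprod J)"
    using i by (simp add: inner_orthogonal_conj orthogonal_E)
  also have "\<dots> = (sg i I * sg i J) * ((Eprod I ** E i) \<bullet> (Eprod J ** E i))"
    unfolding E_Eprod[OF i(1) assms(1)] E_Eprod[OF i(1) assms(2)] sg_def[symmetric] by simp
  also have "\<dots> = - (Eprod I \<bullet> Eprod J)"
    using i by (simp add: inner_orthogonal_conj orthogonal_E)
  finally show ?thesis using False by simp
qed

text \<open>There are \<open>2 ^ 16 = 256 * 256\<close> products, nonzero and mutually orthogonal,
  hence they form a basis of the matrices and coefficients are inner products divided by the squared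
  norm 256.\<close>

lemma Ecoeff_eq:
  assumes "I \<subseteq> {1..16}"
  shows "Ecoeff A I = (A \<bullet> Eprod I) / 256"
proof -
  let ?B = "Eprod ` Pow {1..16}"
  have inj: "inj_on Eprod (Pow {1..16})"
  proof (rule inj_onI)
    fix I J assume *: "I \<in> Pow {1..16}" "J \<in> Pow {1..16}" "Eprod I = Eprod J"
    then have "Eprod I \<bullet> Eprod J \<noteq> 0"
      using inner_Eprod[of I I] by simp
    with * show "I = J" using inner_Eprod[of I J] by (auto split: if_splits)
  qed
  have "pairwise orthogonal ?B"
    using inner_Eprod by (auto simp: pairwise_def orthogonal_def)
  moreover have "0 \<notin> ?B"
    using inner_Eprod by (metis (no_types, lifting) PowD image_iff inner_zero_left zero_neq_numeral)
  ultimately have indep: "independent ?B"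
    by (rule pairwise_orthogonal_independent)
  have "card ?B = DIM(Cl16)"
    unfolding card_image[OF inj] by (simp add: card_Pow)
  then have span: "span ?B = UNIV"
    using indep by (metis dim_UNIV card_eq_dim subset_UNIV top.extremum_uniqueI finite_Pow_iff finite_atLeastAtMost finite_imageI)
  have "A \<bullet> Eprod I = (\<Sum>b\<in>?B. representation ?B A b *\<^sub>R b) \<bullet> Eprod I"
    using indep span by (subst real_vector.sum_representation_eq) auto
  also have "\<dots> = (\<Sum>J\<in>Pow {1..16}. representation ?B A (Eprod J) * (Eprod J \<bullet> Eprod I))"
    unfolding sum.reindex[OF inj] by (simp add: inner_sum_left)
  also have "\<dots> = (\<Sum>J\<in>Pow {1..16}. if J = I then 256 * representation ?B A (Eprod J) else 0)"
    by (intro sum.cong) (use assms in \<open>auto simp: inner_Eprod\<close>)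
  also have "\<dots> = 256 * Ecoeff A I"
    using assms by (simp add: Ecoeff_def)
  finally show ?thesis by simp
qed

lemma inner_outer_prod:
  fixes M :: "real^'n^'n"
  shows "outer_prod x y \<bullet> M = x \<bullet> (M *v y)"
proof -
  have "outer_prod x y $ i $ j = x $ i * y $ j" for i j
    by (simp add: outer_prod_def matrix_def inner_axis)
  then show ?thesis
    by (simp add: inner_vec_def matrix_vector_mult_def sum_distrib_left mult_ac)
qed

text \<open>The factor \<open>16\<^sup>2\<close> of \<open>phi\<close> cancels the squared norm 256,
  and pairing an outer product with a matrix gives a matrix coefficient between the two
  spinors.\<close>

lemma Ecoeff_phi:
  assumes "I \<subseteq> {1..16}"
  shows "Ecoeff phi I = (spinor_s + spinor_s') \<bullet> (Eprod I *v spinor_s)"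
  using assms by (simp add: Ecoeff_eq phi_def inner_outer_prod)

section \<open>Exterior forms as determinants\<close>

text \<open>The determinant of the matrix of values \<open>(fs ! i) (v j)\<close>. With the
  normalisation of \<open>wedge\<close> it is the wedge product of the one-forms in the list, so
  reordering a wedge product becomes permuting a list.\<close>

definition det_form :: "('v \<Rightarrow> 'a::real_field) list \<Rightarrow> ('v, 'a) form" where
  "det_form fs v = (\<Sum>p | p permutes {..<length fs}.
     of_int (sign p) * (\<Prod>i<length fs. (fs ! i) (v (p i))))"

lemma of_int_sign_square: "of_int (sign p) * (of_int (sign p) * x) = (x :: 'a::ring_1)"
  by (simp add: sign_def)

lemma sign_compose_permutes:
  assumes "p permutes S" "q permutes S" "finite S"
  shows "sign (p \<circ> q) = sign p * sign q"
  using assms by (intro sign_compose) (auto intro: permutes_imp_permutation)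

lemma sum_permutations_compose_left:
  assumes q: "q permutes S"
  shows "sum f {p. p permutes S} = (\<Sum>p | p permutes S. f (q \<circ> p))"
proof -
  have "inj_on ((\<circ>) q) {p. p permutes S}"
    by (rule inj_onI) (metis comp_id fun.map_id0 o_assoc permutes_inv_o(2) q id_comp)
  moreover have "(\<circ>) q ` {p. p permutes S} = {p. p permutes S}"
    using image_compose_permutations_left[OF q] by (auto simp: image_iff set_eq_iff)
  ultimately show ?thesis
    using sum.reindex[of "(\<circ>) q" "{p. p permutes S}" f] by simp
qed

lemma det_form_compose:
  assumes "q permutes {..<length fs}"
  shows "det_form fs (v \<circ> q) = of_int (sign q) * det_form fs v"
proof -
  have "det_form fs v = (\<Sum>p | p permutes {..<length fs}.
     of_int (sign (q \<circ> p)) * (\<Prod>i<length fs. (fs ! i) (v ((q \<circ> p) i))))"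
    unfolding det_form_def using assms by (rule sum_permutations_compose_left)
  also have "\<dots> = (\<Sum>p | p permutes {..<length fs}.
     of_int (sign q) * (of_int (sign p) * (\<Prod>i<length fs. (fs ! i) (v (q (p i))))))"
    by (rule sum.cong) (use assms in \<open>auto simp: sign_compose_permutes[of _ "{..<length fs}"] mult_ac\<close>)
  finally show ?thesis
    by (simp add: det_form_def of_int_sign_square flip: sum_distrib_left)
qed

lemma det_form_permute:
  assumes q: "q permutes {..<length fs}"
  shows "det_form (permute_list q fs) v = of_int (sign q) * det_form fs v"
proof -
  let ?n = "length fs"
  have "det_form (permute_list q fs) v = (\<Sum>p | p permutes {..<?n}.
     of_int (sign (p \<circ> q)) * (\<Prod>i<?n. (permute_list q fs ! i) (v ((p \<circ> q) i))))"
    unfolding det_form_def length_permute_list using q by (rule sum_permutations_compose_right)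
  also have "\<dots> = (\<Sum>p | p permutes {..<?n}.
     of_int (sign q) * (of_int (sign p) * (\<Prod>i<?n. (fs ! i) (v (p i)))))"
  proof (rule sum.cong)
    fix p assume p: "p \<in> {p. p permutes {..<?n}}"
    have "(\<Prod>i<?n. (permute_list q fs ! i) (v ((p \<circ> q) i))) = (\<Prod>i<?n. (fs ! q i) (v (p (q i))))"
      by (rule prod.cong) (simp_all add: permute_list_nth[OF q])
    also have "\<dots> = (\<Prod>i<?n. (fs ! i) (v (p i)))"
      using prod.permute[OF q, of "\<lambda>i. (fs ! i) (v (p i))"] by (simp add: o_def)
    finally show "of_int (sign (p \<circ> q)) * (\<Prod>i<?n. (permute_list q fs ! i) (v ((p \<circ> q) i))) =
      of_int (sign q) * (of_int (sign p) * (\<Prod>i<?n. (fs ! i) (v (p i))))"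
      using p q by (auto simp: sign_compose_permutes[of _ "{..<length fs}"] mult_ac)
  qed simp
  finally show ?thesis
    by (simp add: det_form_def flip: sum_distrib_left)
qed

lemma det_form_eq_0:
  assumes "\<not> distinct fs"
  shows "det_form fs v = 0"
proof -
  obtain i j where ij: "i < length fs" "j < length fs" "i \<noteq> j" "fs ! i = fs ! j"
    using assms by (auto simp: distinct_conv_nth)
  let ?t = "Transposition.transpose i j"
  have t: "?t permutes {..<length fs}"
    using ij by (intro permutes_swap_id) auto
  have "permute_list ?t fs = fs"
    by (rule nth_equalityI) (use ij in \<open>auto simp: permute_list_nth[OF t] Transposition.transpose_def\<close>)
  then have "det_form fs v = - det_form fs v"
    using det_form_permute[OF t, of v] ij by (simp add: sign_swap_id)
  then show ?thesis
    by (simp add: eq_neg_iff_add_eq_0 flip: mult_2)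
qed

lemma alternating_det_form:
  assumes "\<forall>f\<in>set fs. linear f"
  shows "alternating_form (length fs) (det_form fs)"
  unfolding alternating_form_def
proof (intro conjI allI impI)
  let ?n = "length fs"
  fix v w :: "nat \<Rightarrow> 'a" assume "\<forall>i<?n. v i = w i"
  then show "det_form fs v = det_form fs w"
    unfolding det_form_def
    by (intro sum.cong refl arg_cong2[where f = "(*)"] prod.cong) (metis lessThan_iff mem_Collect_eq permutes_in_image)
next
  let ?n = "length fs"
  fix v :: "nat \<Rightarrow> 'a" and i assume i: "i < ?n"
  show "linear (\<lambda>x. det_form fs (v(i := x)))"
    unfolding det_form_def
  proof (intro linear_compose_sum ballI)
    fix p assume "p \<in> {p. p permutes {..<?n}}"
    then have p: "p permutes {..<?n}" by simp
    \<comment> \<open>The vector in slot \<open>i\<close> enters only the factor with number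
      \<open>inv p i\<close>.\<close>
    define j where "j = inv p i"
    have j: "j < ?n" "p k = i \<longleftrightarrow> k = j" for k
      using p i permutes_in_image[OF permutes_inv[OF p], of i] by (auto simp: j_def permutes_inverses)
    have "(\<Prod>k<?n. (fs ! k) ((v(i := x)) (p k))) = (fs ! j) x * (\<Prod>k\<in>{..<?n} - {j}. (fs ! k) (v (p k)))" for x
      using j by (subst prod.remove[of _ j]) (auto intro!: prod.cong)
    moreover have "linear (\<lambda>x. (of_int (sign p) * (\<Prod>k\<in>{..<?n} - {j}. (fs ! k) (v (p k)))) * (fs ! j) x)" (is "linear (\<lambda>x. ?c * _)")
      using assms j(1) linear_compose[of "fs ! j" "(*) ?c"]
      by (auto simp: o_def linear_iff algebra_simps)
    ultimately show "linear (\<lambda>x. of_int (sign p) * (\<Prod>k<?n. (fs ! k) ((v(i := x)) (p k))))"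
      by (simp add: mult_ac)
  qed
next
  let ?n = "length fs"
  fix v :: "nat \<Rightarrow> 'a" and i j assume ij: "i < ?n" "j < ?n" "i \<noteq> j \<and> v i = v j"
  let ?t = "Transposition.transpose i j"
  have t: "?t permutes {..<length fs}"
    using ij by (intro permutes_swap_id) auto
  have "v \<circ> ?t = v"
    using ij by (auto simp: fun_eq_iff Transposition.transpose_def)
  then have "det_form fs v = - det_form fs v"
    using det_form_compose[OF t, of v] ij by (simp add: sign_swap_id)
  then show "det_form fs v = 0"
    by (simp add: eq_neg_iff_add_eq_0 flip: mult_2)
qed

text \<open>For fixed permutations \<open>q\<close> and \<open>r\<close> of the two groups of
  arguments, the substitution of \<open>p \<circ> (q \<circ> ?shift r)\<close> for \<open>p\<close>
  turns the sum over \<open>p\<close> into the determinant of the joined list. The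
  \<open>k! l!\<close> choices of \<open>q\<close> and \<open>r\<close> cancel the denominator left
  by \<open>wedge\<close> and \<open>Alt\<close>.\<close>

lemma wedge_det_form:
  "wedge (length fs) (length gs) (det_form fs) (det_form gs) = det_form (fs @ gs)"
proof
  fix v
  let ?k = "length fs" and ?l = "length gs"
  let ?P = "\<lambda>n. {p. p permutes {..<n :: nat}}"
  let ?F = "\<lambda>p. of_int (sign p) * (\<Prod>i<?k + ?l. ((fs @ gs) ! i) (v (p i)))"
  \<comment> \<open>Transports a permutation of the last \<open>?l\<close> arguments to the block of
    positions starting at \<open>?k\<close>.\<close>
  let ?shift = "\<lambda>r. map_permutation {..<?l} ((+) ?k) r"
  have bij: "bij_betw ((+) ?k) {..<?l} {?k..<?k + ?l}"
      by (rule bij_betw_byWitness[where f' = "\<lambda>i. i - ?k"]) auto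
  have *: "of_int (sign p) * (of_int (sign q) * (\<Prod>i<?k. (fs ! i) (v (p (q i))))) *
      (of_int (sign r) * (\<Prod>i<?l. (gs ! i) (v (p (?k + r i))))) = ?F (p \<circ> (q \<circ> ?shift r))"
    if p: "p \<in> ?P (?k + ?l)" and q: "q \<in> ?P ?k" and r: "r \<in> ?P ?l" for p q r
  proof -
    have s: "?shift r permutes {?k..<?k + ?l}"
      using map_permutation_permutes[OF bij] r by simp
    have s1: "?shift r i = i" if "i < ?k" for i
      using permutes_not_in[OF s] that by simp
    have s2: "?shift r (?k + i) = ?k + r i" if "i < ?l" for i
      using that by (intro map_permutation_apply) auto
    have q2: "q (?k + i) = ?k + i" for i
      using q by (auto dest: permutes_not_in)
    have "sign (?shift r) = sign r"
      using r by (intro sign_map_permutation) auto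
    moreover have "permutation p" "permutation q" "permutation (?shift r)"
      using p q s by (auto intro: permutes_imp_permutation[rotated])
    ultimately have "sign (p \<circ> (q \<circ> ?shift r)) = sign p * (sign q * sign r)"
      by (simp add: sign_compose permutation_compose)
    moreover have "(\<Prod>i<?k + ?l. ((fs @ gs) ! i) (v ((p \<circ> (q \<circ> ?shift r)) i))) =
       (\<Prod>i<?k. (fs ! i) (v (p (q i)))) * (\<Prod>i<?l. (gs ! i) (v (p (?k + r i))))"
    proof -
      have "{..<?k + ?l} = {..<?k} \<union> {?k..<?k + ?l}" "{..<?k} \<inter> {?k..<?k + ?l} = {}" by auto
      then have "(\<Prod>i<?k + ?l. ((fs @ gs) ! i) (v ((p \<circ> (q \<circ> ?shift r)) i))) =
        (\<Prod>i<?k. ((fs @ gs) ! i) (v ((p \<circ> (q \<circ> ?shift r)) i))) *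
        (\<Prod>i\<in>{?k..<?k + ?l}. ((fs @ gs) ! i) (v ((p \<circ> (q \<circ> ?shift r)) i)))"
        by (simp only: prod.union_disjoint finite_lessThan finite_atLeastLessThan)
      also have "(\<Prod>i\<in>{?k..<?k + ?l}. ((fs @ gs) ! i) (v ((p \<circ> (q \<circ> ?shift r)) i))) =
         (\<Prod>i<?l. ((fs @ gs) ! (?k + i)) (v ((p \<circ> (q \<circ> ?shift r)) (?k + i))))"
        by (rule prod.reindex_bij_betw[OF bij, symmetric])
      also have "\<dots> = (\<Prod>i<?l. (gs ! i) (v (p (?k + r i))))"
        by (intro prod.cong) (auto simp: s2 q2)
      also have "(\<Prod>i<?k. ((fs @ gs) ! i) (v ((p \<circ> (q \<circ> ?shift r)) i))) = (\<Prod>i<?k. (fs ! i) (v (p (q i))))"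
        by (intro prod.cong) (auto simp: s1 nth_append)
      finally show ?thesis .
    qed
    ultimately show ?thesis by simp
  qed
  have "wedge ?k ?l (det_form fs) (det_form gs) v =
    (\<Sum>p\<in>?P (?k + ?l). of_int (sign p) *
      ((\<Sum>q\<in>?P ?k. of_int (sign q) * (\<Prod>i<?k. (fs ! i) (v (p (q i))))) *
       (\<Sum>r\<in>?P ?l. of_int (sign r) * (\<Prod>i<?l. (gs ! i) (v (p (?k + r i))))))) / (fact ?k * fact ?l)"
    by (simp add: wedge_def Alt_def tensor_form_def det_form_def o_def)
  also have "\<dots> = (\<Sum>p\<in>?P (?k + ?l). \<Sum>q\<in>?P ?k. \<Sum>r\<in>?P ?l. ?F (p \<circ> (q \<circ> ?shift r))) / (fact ?k * fact ?l)"
  proof (intro arg_cong2[where f = "(/)"] sum.cong refl)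
    fix p assume p: "p \<in> ?P (?k + ?l)"
    show "of_int (sign p) *
      ((\<Sum>q\<in>?P ?k. of_int (sign q) * (\<Prod>i<?k. (fs ! i) (v (p (q i))))) *
       (\<Sum>r\<in>?P ?l. of_int (sign r) * (\<Prod>i<?l. (gs ! i) (v (p (?k + r i)))))) =
       (\<Sum>q\<in>?P ?k. \<Sum>r\<in>?P ?l. ?F (p \<circ> (q \<circ> ?shift r)))"
      by (subst sum_product, subst sum_distrib_left, rule sum.cong[OF refl], subst sum_distrib_left,
        rule sum.cong[OF refl]) (simp only: *[OF p, symmetric] mult.assoc)
  qed
  also have "(\<Sum>p\<in>?P (?k + ?l). \<Sum>q\<in>?P ?k. \<Sum>r\<in>?P ?l. ?F (p \<circ> (q \<circ> ?shift r))) =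
    (\<Sum>q\<in>?P ?k. \<Sum>r\<in>?P ?l. \<Sum>p\<in>?P (?k + ?l). ?F (p \<circ> (q \<circ> ?shift r)))"
    by (subst sum.swap, rule sum.cong[OF refl], rule sum.swap)
  also have "\<dots> = (\<Sum>q\<in>?P ?k. \<Sum>r\<in>?P ?l. det_form (fs @ gs) v)"
  proof (intro sum.cong refl)
    fix q r assume q: "q \<in> ?P ?k" and r: "r \<in> ?P ?l"
    have "?shift r permutes {?k..<?k + ?l}"
      using map_permutation_permutes[OF bij] r by simp
    then have "?shift r permutes {..<?k + ?l}"
      by (rule permutes_subset) auto
    moreover have "q permutes {..<?k + ?l}"
      using q by (auto intro: permutes_subset)
    ultimately have "q \<circ> ?shift r permutes {..<?k + ?l}"
      by (intro permutes_compose)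
    from sum_permutations_compose_right[OF this, of ?F]
    show "(\<Sum>p\<in>?P (?k + ?l). ?F (p \<circ> (q \<circ> ?shift r))) = det_form (fs @ gs) v"
      by (simp add: det_form_def)
  qed
  finally show "wedge ?k ?l (det_form fs) (det_form gs) v = det_form (fs @ gs) v"
    by (simp add: card_permutations)
qed

lemma wedge_list_eq_det_form: "wedge_list fs = det_form fs"
proof (induction fs)
  case Nil
  have "{p. p permutes ({} :: nat set)} = {id}" by auto
  then show ?case by (auto simp: det_form_def fun_eq_iff)
next
  case (Cons f fs)
  have "{p. p permutes {..<Suc 0}} = {id}"
    by (simp add: lessThan_Suc permutes_sing)
  then have "det_form [f] = (\<lambda>v. f (v 0))"
    by (auto simp: det_form_def fun_eq_iff)
  with Cons wedge_det_form[of "[f]" fs] show ?case by simp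
qed

section \<open>Alternating forms and bilinearity of the wedge product\<close>

lemma alternating_formD:
  assumes "alternating_form k \<alpha>"
  shows "(\<forall>i<k. v i = w i) \<Longrightarrow> \<alpha> v = \<alpha> w"
    and "i < k \<Longrightarrow> linear (\<lambda>x. \<alpha> (v(i := x)))"
    and "i < k \<Longrightarrow> j < k \<Longrightarrow> i \<noteq> j \<Longrightarrow> v i = v j \<Longrightarrow> \<alpha> v = 0"
  using assms[unfolded alternating_form_def, THEN conjunct1]
    assms[unfolded alternating_form_def, THEN conjunct2, THEN conjunct1]
    assms[unfolded alternating_form_def, THEN conjunct2, THEN conjunct2] by simp_all

lemma alternating_form_sum:
  assumes "\<And>a. a \<in> A \<Longrightarrow> alternating_form k (\<alpha> a)"
  shows "alternating_form k (\<lambda>v. \<Sum>a\<in>A. c a * (\<alpha> a v :: real))"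
  unfolding alternating_form_def
proof (intro conjI allI impI)
  fix v w :: "nat \<Rightarrow> 'b" assume vw: "\<forall>i<k. v i = w i"
  have "\<alpha> a v = \<alpha> a w" if "a \<in> A" for a
    by (rule alternating_formD(1)[OF assms[OF that] vw])
  then show "(\<Sum>a\<in>A. c a * \<alpha> a v) = (\<Sum>a\<in>A. c a * \<alpha> a w)"
    by (intro sum.cong) auto
next
  fix v :: "nat \<Rightarrow> 'b" and i assume i: "i < k"
  show "linear (\<lambda>x. \<Sum>a\<in>A. c a * \<alpha> a (v(i := x)))"
  proof (intro linear_compose_sum ballI)
    fix a assume "a \<in> A"
    then have "linear (\<lambda>x. \<alpha> a (v(i := x)))"
      using assms i by (intro alternating_formD(2))
    then have "linear (\<lambda>x. c a *\<^sub>R \<alpha> a (v(i := x)))"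
      by (rule linear_compose_scale_right)
    then show "linear (\<lambda>x. c a * \<alpha> a (v(i := x)))"
      by simp
  qed
next
  fix v :: "nat \<Rightarrow> 'b" and i j assume ij: "i < k" "j < k" "i \<noteq> j \<and> v i = v j"
  have "\<alpha> a v = 0" if "a \<in> A" for a
    using assms[OF that] ij by (auto intro: alternating_formD(3))
  then show "(\<Sum>a\<in>A. c a * \<alpha> a v) = 0"
    by (intro sum.neutral) auto
qed

lemma Alt_sum: "Alt n (\<lambda>v. \<Sum>a\<in>A. c a * \<gamma> a v) v = (\<Sum>a\<in>A. c a * Alt n (\<gamma> a) v)"
proof -
  have "(\<Sum>p | p permutes {..<n}. of_int (sign p) * (\<Sum>a\<in>A. c a * \<gamma> a (v \<circ> p))) =
    (\<Sum>p | p permutes {..<n}. \<Sum>a\<in>A. c a * (of_int (sign p) * \<gamma> a (v \<circ> p)))"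
    by (simp only: sum_distrib_left mult.left_commute)
  also have "\<dots> = (\<Sum>a\<in>A. c a * (\<Sum>p | p permutes {..<n}. of_int (sign p) * \<gamma> a (v \<circ> p)))"
    unfolding sum_distrib_left by (rule sum.swap)
  finally show ?thesis
    unfolding Alt_def by (simp only:) (subst sum_divide_distrib, simp only: times_divide_eq_right)
qed

text \<open>Linear combinations over an index set cover sums and scalings at once: here and for the
  right factor, later uses take a two-point or a one-point index type.\<close>

lemma wedge_sum_left:
  "wedge k l (\<lambda>v. \<Sum>a\<in>A. c a * \<alpha> a v) \<beta> = (\<lambda>v. \<Sum>a\<in>A. c a * wedge k l (\<alpha> a) \<beta> v)"
proof
  fix v
  have "tensor_form k (\<lambda>v. \<Sum>a\<in>A. c a * \<alpha> a v) \<beta> = (\<lambda>v. \<Sum>a\<in>A. c a * tensor_form k (\<alpha> a) \<beta> v)"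
    by (rule ext) (simp only: tensor_form_def sum_distrib_right mult.assoc)
  then show "wedge k l (\<lambda>v. \<Sum>a\<in>A. c a * \<alpha> a v) \<beta> v = (\<Sum>a\<in>A. c a * wedge k l (\<alpha> a) \<beta> v)"
    by (simp only: wedge_def Alt_sum sum_distrib_left mult.left_commute)
qed

lemma wedge_sum_right:
  "wedge k l \<alpha> (\<lambda>v. \<Sum>b\<in>B. c b * \<beta> b v) = (\<lambda>v. \<Sum>b\<in>B. c b * wedge k l \<alpha> (\<beta> b) v)"
proof
  fix v
  have "tensor_form k \<alpha> (\<lambda>v. \<Sum>b\<in>B. c b * \<beta> b v) = (\<lambda>v. \<Sum>b\<in>B. c b * tensor_form k \<alpha> (\<beta> b) v)"
    by (rule ext) (simp only: tensor_form_def sum_distrib_left mult.left_commute)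
  then show "wedge k l \<alpha> (\<lambda>v. \<Sum>b\<in>B. c b * \<beta> b v) v = (\<Sum>b\<in>B. c b * wedge k l \<alpha> (\<beta> b) v)"
    by (simp only: wedge_def Alt_sum sum_distrib_left mult.left_commute)
qed

text \<open>Gram-Schmidt seen only through alternating forms. The factor \<open>d\<close> does not
  depend on the form, so the form to be bounded and all \<open>dx I\<close> measuring the norm are
  rescaled together; linear dependence of \<open>v\<close> appears as the vanishing of all
  alternating forms. The induction makes the first \<open>n\<close> vectors orthonormal and leaves
  the others alone.\<close>

lemma alternating_gram_schmidt:
  fixes v :: "nat \<Rightarrow> 'v::euclidean_space"
  obtains "\<And>\<alpha> :: ('v, real) form. alternating_form m \<alpha> \<Longrightarrow> \<alpha> v = 0"
    | u d where "\<And>i j. i < m \<Longrightarrow> j < m \<Longrightarrow> u i \<bullet> u j = (if i = j then 1 else 0)"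
      "\<And>\<alpha> :: ('v, real) form. alternating_form m \<alpha> \<Longrightarrow> \<alpha> v = d * \<alpha> u"
proof -
  have "(\<forall>\<alpha> :: ('v, real) form. alternating_form m \<alpha> \<longrightarrow> \<alpha> v = 0) \<or>
    (\<exists>u d. (\<forall>i<n. \<forall>j<n. u i \<bullet> u j = (if i = j then 1 else 0)) \<and>
      (\<forall>\<alpha> :: ('v, real) form. alternating_form m \<alpha> \<longrightarrow> \<alpha> v = d * \<alpha> u))" if "n \<le> m" for n
    using that
  proof (induction n)
    case 0
    show ?case by (intro disjI2 exI[of _ v] exI[of _ 1]) auto
  next
    case (Suc n)
    show ?case
    proof (cases "\<forall>\<alpha> :: ('v, real) form. alternating_form m \<alpha> \<longrightarrow> \<alpha> v = 0")
      case False
      with Suc.IH[OF Suc_leD[OF Suc.prems]] have "\<exists>u d. (\<forall>i<n. \<forall>j<n. u i \<bullet> u j = (if i = j then 1 else 0)) \<and>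
          (\<forall>\<alpha> :: ('v, real) form. alternating_form m \<alpha> \<longrightarrow> \<alpha> v = d * \<alpha> u)"
        by - (erule disjE, erule notE, assumption+)
      then obtain u d where u': "\<forall>i<n. \<forall>j<n. u i \<bullet> u j = (if i = j then 1 else 0)"
        and d': "\<forall>\<alpha> :: ('v, real) form. alternating_form m \<alpha> \<longrightarrow> \<alpha> v = d * \<alpha> u"
        by (elim exE conjE)
      have u: "u i \<bullet> u j = (if i = j then 1 else 0)" if "i < n" "j < n" for i j
        using u' that by simp
      have d: "\<alpha> v = d * \<alpha> u" if "alternating_form m \<alpha>" for \<alpha> :: "('v, real) form"
        using d' that by simp
      \<comment> \<open>The component of \<open>u n\<close> orthogonal to the earlier vectors. The
        subtracted multiples of \<open>u j\<close> do not affect an alternating form, because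
        \<open>u j\<close> already occupies slot \<open>j\<close>.\<close>
      define w where "w = u n - (\<Sum>j<n. (u n \<bullet> u j) *\<^sub>R u j)"
      have w: "\<alpha> u = \<alpha> (u(n := w))" if \<alpha>: "alternating_form m \<alpha>" for \<alpha> :: "('v, real) form"
      proof -
        have lin: "linear (\<lambda>x. \<alpha> (u(n := x)))"
          using \<alpha> Suc.prems by (intro alternating_formD(2)) auto
        have "\<alpha> (u(n := u j)) = 0" if "j < n" for j
        proof -
          have "n < m" "j < m" "n \<noteq> j" "(u(n := u j)) n = (u(n := u j)) j"
            using that Suc.prems by auto
          then show ?thesis
            by (rule alternating_formD(3)[OF \<alpha>, of n j])
        qed
        then show ?thesis
          using linear_diff[OF lin, of "u n"] by (simp add: w_def linear_sum[OF lin] linear_cmul[OF lin])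
      qed
      have uw: "u j \<bullet> w = 0" if "j < n" for j
      proof -
        have "(\<Sum>i<n. (u n \<bullet> u i) * (u j \<bullet> u i)) = (\<Sum>i<n. if i = j then u n \<bullet> u j else 0)"
          by (intro sum.cong) (use u that in auto)
        then show ?thesis
          using that by (simp add: w_def inner_diff_right inner_sum_right inner_commute)
      qed
      \<comment> \<open>Otherwise every alternating form would vanish at \<open>v\<close>, which is
        the case already split off.\<close>
      have "w \<noteq> 0"
      proof
        assume "w = 0"
        have "\<alpha> v = 0" if \<alpha>: "alternating_form m \<alpha>" for \<alpha> :: "('v, real) form"
        proof -
          have lin: "linear (\<lambda>x. \<alpha> (u(n := x)))"
            using \<alpha> Suc.prems by (intro alternating_formD(2)) auto
          show ?thesis
            using d[OF \<alpha>] w[OF \<alpha>] linear_0[OF lin] \<open>w = 0\<close> by simp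
        qed
        with False show False by simp
      qed
      define e where "e = w /\<^sub>R norm w"
      have e: "e \<bullet> e = 1" "\<And>j. j < n \<Longrightarrow> u j \<bullet> e = 0" "\<And>j. j < n \<Longrightarrow> e \<bullet> u j = 0"
        using \<open>w \<noteq> 0\<close> uw by (simp_all add: e_def dot_square_norm power2_eq_square inner_commute[of _ "u _"])
      define u' where "u' = u(n := e)"
      have "u' i \<bullet> u' j = (if i = j then 1 else 0)" if "i < Suc n" "j < Suc n" for i j
        using that u e by (auto simp: u'_def less_Suc_eq)
      moreover have "\<alpha> v = (d * norm w) * \<alpha> u'" if \<alpha>: "alternating_form m \<alpha>" for \<alpha> :: "('v, real) form"
      proof -
        have lin: "linear (\<lambda>x. \<alpha> (u(n := x)))"
          using \<alpha> Suc.prems by (intro alternating_formD(2)) auto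
        show ?thesis
          using d[OF \<alpha>] w[OF \<alpha>] \<open>w \<noteq> 0\<close> linear_cmul[OF lin, of "inverse (norm w)" w] by (simp add: u'_def e_def)
      qed
      ultimately show ?thesis
        by (intro disjI2 exI[of _ u'] exI[of _ "d * norm w"]) simp
    qed auto
  qed
  from this[OF order_refl] show thesis
  proof (elim disjE exE conjE)
    assume "\<forall>\<alpha> :: ('v, real) form. alternating_form m \<alpha> \<longrightarrow> \<alpha> v = 0"
    then show thesis by (intro that(1)) simp
  next
    fix u d
    assume "\<forall>i<m. \<forall>j<m. u i \<bullet> u j = (if i = j then 1 else 0)"
      and "\<forall>\<alpha> :: ('v, real) form. alternating_form m \<alpha> \<longrightarrow> \<alpha> v = d * \<alpha> u"
    then show thesis by (intro that(2)[of u d]) simp_all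
  qed
qed

section \<open>Clifford products of orthonormal frames\<close>

definition coord :: "nat \<Rightarrow> real^16 \<Rightarrow> real" where
  "coord i x = x $ of_nat i"

lemma linear_coord: "linear (coord i)"
  by (rule linearI) (simp_all add: coord_def)

lemma dx_eq: "dx I = det_form (map coord (sorted_list_of_set I))"
  by (simp add: dx_def wedge_list_eq_det_form coord_def[abs_def])

lemma alternating_dx: "finite I \<Longrightarrow> alternating_form (card I) (dx I)"
  using alternating_det_form[of "map coord (sorted_list_of_set I)"]
  by (auto simp: dx_eq linear_coord)

lemma index_setsD:
  assumes "I \<in> index_sets k"
  shows "I \<subseteq> {1..16}" "finite I" "card I = k"
  using assms finite_subset[of I "{1..16}"] by (auto simp: index_sets_def)

lemma finite_index_sets: "finite (index_sets k)"
  by (rule finite_subset[of _ "Pow {1..16}"]) (auto simp: index_sets_def)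

lemma alternating_component: "alternating_form k (component k A)"
  unfolding component_def[abs_def]
  by (rule alternating_form_sum) (use alternating_dx index_setsD in metis)

lemma linear_matrix_mult_left: "linear (\<lambda>A :: real^'n^'m. A ** B)"
  by (rule linearI) (simp_all add: matrix_mult_add_left scalar_matrix_assoc)

lemma linear_matrix_mult_right: "linear (\<lambda>B :: real^'k^'n. (A :: real^'n^'m) ** B)"
  by (rule linearI) (simp_all add: matrix_add_ldistrib matrix_scalar_ac scalar_matrix_assoc)

lemma mat_prod_list_anticommute:
  fixes A :: "'i \<Rightarrow> real^'n^'n"
  assumes "\<And>i. i \<in> set xs \<Longrightarrow> B ** A i = - (A i ** B)"
  shows "B ** mat_prod_list (map A xs) = (-1) ^ length xs *\<^sub>R (mat_prod_list (map A xs) ** B)"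
  using assms
proof (induction xs)
  case (Cons x xs)
  let ?P = "mat_prod_list (map A xs)"
  have "B ** (A x ** ?P) = - (A x ** (B ** ?P))"
    using Cons.prems[of x] by (simp add: matrix_mul_assoc minus_matrix_mult)
  with Cons show ?case
    by (simp add: matrix_mul_assoc matrix_scalar_ac scalar_matrix_assoc minus_matrix_mult)
qed simp

text \<open>Both outer factors pass the middle block with the same sign, so exchanging them leaves
  only the sign from \<open>A a\<close> against \<open>A b\<close>.\<close>

lemma mat_prod_list_swap:
  fixes A :: "'i \<Rightarrow> real^'n^'n"
  assumes "distinct (a # b # xs)"
    and anti: "\<And>i j. i \<in> set (a # b # xs) \<Longrightarrow> j \<in> set (a # b # xs) \<Longrightarrow> i \<noteq> j \<Longrightarrow> A i ** A j = - (A j ** A i)"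
  shows "A a ** mat_prod_list (map A xs) ** A b = - (A b ** mat_prod_list (map A xs) ** A a)"
proof -
  let ?P = "mat_prod_list (map A xs)" and ?s = "(-1) ^ length xs :: real"
  have a: "A a ** ?P = ?s *\<^sub>R (?P ** A a)" and b: "A b ** ?P = ?s *\<^sub>R (?P ** A b)"
    using assms by (auto intro!: mat_prod_list_anticommute)
  have "A a ** A b = - (A b ** A a)"
    using assms by auto
  then have "?P ** A a ** A b = - (?P ** A b ** A a)"
    by (simp add: matrix_mul_assoc[symmetric] linear_neg[OF linear_matrix_mult_right])
  then show ?thesis
    by (simp add: a b scalar_matrix_assoc[symmetric])
qed

text \<open>Composing with a transposition on the left exchanges two entries of the list, wherever
  they stand, and each exchange gives one sign.\<close>

lemma mat_prod_list_permute:
  fixes A :: "nat \<Rightarrow> real^'n^'n"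
  assumes p: "p permutes {..<m}"
    and anti: "\<And>i j. i < m \<Longrightarrow> j < m \<Longrightarrow> i \<noteq> j \<Longrightarrow> A i ** A j = - (A j ** A i)"
  shows "mat_prod_list (map (A \<circ> p) [0..<m]) = of_int (sign p) *\<^sub>R mat_prod_list (map A [0..<m])"
  using p finite_lessThan
proof (induction rule: permutes_induct)
  case (swap a b p)
  let ?t = "Transposition.transpose a b"
  let ?xs = "map p [0..<m]"
  have p: "p permutes {..<m}" using swap by simp
  have dist: "distinct ?xs" and set: "set ?xs = {..<m}"
    using permutes_inj_on[OF p] permutes_image[OF p] by (auto simp: distinct_map atLeast0LessThan)
  \<comment> \<open>Stated for \<open>c\<close> and \<open>d\<close> in their order of occurrence,
    since \<open>a\<close> may stand before or after \<open>b\<close>.\<close>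
  have main: "mat_prod_list (map A (map (Transposition.transpose c d) ?xs)) = - mat_prod_list (map A ?xs)"
    if cd: "?xs = xs @ c # ys @ d # zs" for c d xs ys zs
  proof -
    have d: "distinct (xs @ c # ys @ d # zs)" and s: "set (xs @ c # ys @ d # zs) = {..<m}"
      using dist set unfolding cd by - assumption+
    have "map (Transposition.transpose c d) ws = ws" if "c \<notin> set ws" "d \<notin> set ws" for ws
      using that by (intro map_idI) (auto simp: Transposition.transpose_def)
    then have "map (Transposition.transpose c d) ?xs = xs @ d # ys @ c # zs"
      unfolding cd using d by simp
    moreover have "A c ** mat_prod_list (map A ys) ** A d = - (A d ** mat_prod_list (map A ys) ** A c)"
      by (rule mat_prod_list_swap) (use d s in \<open>auto intro!: anti\<close>)
    then have "mat_prod_list (map A xs) ** (A c ** mat_prod_list (map A ys) ** A d) ** mat_prod_list (map A zs) =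
      - (mat_prod_list (map A xs) ** (A d ** mat_prod_list (map A ys) ** A c) ** mat_prod_list (map A zs))"
      by (simp add: linear_neg[OF linear_matrix_mult_right] minus_matrix_mult)
    ultimately show ?thesis
      by (simp only: cd map_append list.map mat_prod_list_append mat_prod_list_simps matrix_mul_assoc minus_minus)
  qed
  have "mat_prod_list (map A (map ?t ?xs)) = - mat_prod_list (map A ?xs)"
  proof -
    have "a \<in> set ?xs" using \<open>a \<in> {..<m}\<close> set by blast
    from split_list[OF this] obtain us vs where uv: "?xs = us @ a # vs" by blast
    have "b \<in> set ?xs" using \<open>b \<in> {..<m}\<close> set by blast
    then have "b \<in> set us \<or> b \<in> set vs"
      using \<open>a \<noteq> b\<close> unfolding uv by simp
    then consider "b \<in> set us" | "b \<in> set vs" by blast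
    then show ?thesis
    proof cases
      case 1
      then obtain ys zs where "us = ys @ b # zs" by (rule split_list[elim_format]) blast
      then have "?xs = ys @ b # zs @ a # vs" using uv by simp
      then show ?thesis unfolding Transposition.transpose_commute[of a b] by (rule main)
    next
      case 2
      then obtain ys zs where "vs = ys @ b # zs" by (rule split_list[elim_format]) blast
      then have "?xs = us @ a # ys @ b # zs" using uv by simp
      then show ?thesis by (rule main)
    qed
  qed
  moreover have "sign (?t \<circ> p) = - sign p"
    using swap by (subst sign_compose_permutes[of _ "{..<m}"]) (auto simp: permutes_swap_id sign_swap_id)
  ultimately show ?case
    using swap.IH by (simp only: map_map o_assoc of_int_minus scaleR_minus_left)
qed simp

lemma clifford_expand: "clifford u = (\<Sum>i\<in>{1..16}. coord i u *\<^sub>R E i)"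
proof -
  have "u = (\<Sum>k\<in>UNIV. u $ k *\<^sub>R axis k 1)"
    using basis_expansion[of u] by (simp add: scalar_mult_eq_scaleR)
  also have "\<dots> = (\<Sum>i\<in>{1..16}. coord i u *\<^sub>R axis (of_nat i) 1)"
    unfolding coord_def by (rule sum.reindex_bij_betw[OF bij_betw_of_nat_16, symmetric])
  finally have "clifford u = clifford (\<Sum>i\<in>{1..16}. coord i u *\<^sub>R axis (of_nat i) 1)"
    by (rule arg_cong)
  also have "\<dots> = (\<Sum>i\<in>{1..16}. coord i u *\<^sub>R clifford (axis (of_nat i) 1))"
    by (simp only: linear_sum[OF linear_clifford] linear_cmul[OF linear_clifford])
  also have "\<dots> = (\<Sum>i\<in>{1..16}. coord i u *\<^sub>R E i)"
    by (intro sum.cong refl) (simp add: clifford_axis)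
  finally show ?thesis .
qed

definition clifford_prod :: "nat \<Rightarrow> (nat \<Rightarrow> real^16) \<Rightarrow> Cl16" where
  "clifford_prod m u = mat_prod_list (map (\<lambda>i. clifford (u i)) [0..<m])"

lemma clifford_prod_Suc: "clifford_prod (Suc m) u = clifford (u 0) ** clifford_prod m (u \<circ> Suc)"
proof -
  have "[0..<Suc m] = 0 # map Suc [0..<m]"
    by (simp add: upt_conv_Cons map_Suc_upt del: upt_Suc)
  then show ?thesis
    by (simp add: clifford_prod_def o_def del: upt_Suc)
qed

abbreviation words :: "nat \<Rightarrow> nat list set" where
  "words m \<equiv> {xs. set xs \<subseteq> {1..16} \<and> length xs = m}"

text \<open>Full multilinear expansion. Words with repeated letters are still present; they
  disappear only on antisymmetrising.\<close>

lemma clifford_prod_expand: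
  "clifford_prod m u = (\<Sum>xs\<in>words m. (\<Prod>i<m. coord (xs ! i) (u i)) *\<^sub>R mat_prod_list (map E xs))"
proof (induction m arbitrary: u)
  case 0
  have "words 0 = {[]}" by auto
  then show ?case by (simp add: clifford_prod_def)
next
  case (Suc m)
  let ?g = "\<lambda>xs. (\<Prod>i<m. coord (xs ! i) (u (Suc i))) *\<^sub>R mat_prod_list (map E xs)"
  let ?f = "\<lambda>xs. (\<Prod>i<Suc m. coord (xs ! i) (u i)) *\<^sub>R mat_prod_list (map E xs)"
  have "clifford_prod (Suc m) u = (\<Sum>i\<in>{1..16}. coord i (u 0) *\<^sub>R E i) ** (\<Sum>xs\<in>words m. ?g xs)"
    by (simp only: clifford_prod_Suc clifford_expand[of "u 0"] Suc.IH o_def)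
  also have "\<dots> = (\<Sum>xs\<in>words m. \<Sum>i\<in>{1..16}. (coord i (u 0) *\<^sub>R E i) ** ?g xs)"
    by (simp only: linear_sum[OF linear_matrix_mult_right] linear_sum[OF linear_matrix_mult_left])
  also have "\<dots> = (\<Sum>xs\<in>words m. \<Sum>i\<in>{1..16}. ?f (i # xs))"
    by (intro sum.cong refl) (simp add: prod.lessThan_Suc_shift matrix_scalar_ac scalar_matrix_assoc[symmetric] mult.commute del: prod.lessThan_Suc)
  also have "\<dots> = (\<Sum>(xs, i)\<in>words m \<times> {1..16}. ?f (i # xs))"
    by (rule sum.cartesian_product)
  also have "\<dots> = sum ?f (words (Suc m))"
    unfolding lists_length_Suc_eq by (subst sum.reindex) (auto simp: inj_on_def case_prod_unfold)
  finally show ?case .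
qed

lemma permute_list_sorted:
  assumes "distinct xs"
  obtains q where "q permutes {..<length xs}" "xs = permute_list q (sorted_list_of_set (set xs))"
    "length (sorted_list_of_set (set xs)) = length xs"
proof -
  have "mset xs = mset (sorted_list_of_set (set xs))"
    using assms by (simp add: distinct_card mset_set_set sorted_list_of_mset_set[symmetric] del: sorted_list_of_mset_set)
  then obtain q where "q permutes {..<length (sorted_list_of_set (set xs))}" "permute_list q (sorted_list_of_set (set xs)) = xs"
    by (rule mset_eq_permutation)
  moreover have "length (sorted_list_of_set (set xs)) = length xs"
    using assms by (simp add: distinct_card)
  ultimately show thesis using that by metis
qed

text \<open>Sorting the word changes the determinant and the product of generators by the same sign,
  so the product of the two depends only on the set of letters.\<close>

lemma det_form_word:
  assumes "xs \<in> words m" "distinct xs"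
  shows "det_form (map coord xs) u *\<^sub>R mat_prod_list (map E xs) = dx (set xs) u *\<^sub>R Eprod (set xs)"
proof -
  let ?ys = "sorted_list_of_set (set xs)"
  obtain q where q: "q permutes {..<length xs}" "xs = permute_list q ?ys" and len: "length ?ys = length xs"
    using permute_list_sorted[OF assms(2)] by metis
  have q': "q permutes {..<length (map coord ?ys)}" "q permutes {..<length ?ys}"
    using q(1) len by simp_all
  have ys: "?ys ! i \<in> {1..16}" if "i < length xs" for i
    using that assms len nth_mem[of i ?ys] by auto
  have "det_form (map coord xs) u = of_int (sign q) * dx (set xs) u"
    by (subst q(2), simp only: permute_list_map[OF q'(2), symmetric] det_form_permute[OF q'(1)] dx_eq)
  moreover have "mat_prod_list (map E xs) = of_int (sign q) *\<^sub>R Eprod (set xs)"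
  proof -
    have anti: "E (?ys ! i) ** E (?ys ! j) = - (E (?ys ! j) ** E (?ys ! i))"
      if "i < length xs" "j < length xs" "i \<noteq> j" for i j
      using that ys len nth_eq_iff_index_eq[of ?ys i j] by (intro E_anticommute) auto
    have "map E xs = map ((\<lambda>i. E (?ys ! i)) \<circ> q) [0..<length xs]"
      by (subst q(2)) (simp add: permute_list_def distinct_card[OF assms(2)] o_def)
    moreover have "map (\<lambda>i. E (?ys ! i)) [0..<length xs] = map E ?ys"
    proof -
      have "map (\<lambda>i. E (?ys ! i)) [0..<length ?ys] = map E (map (\<lambda>i. ?ys ! i) [0..<length ?ys])"
        by (simp only: map_map o_def)
      also have "\<dots> = map E ?ys" by (simp only: map_nth)
      finally show ?thesis unfolding len .
    qed
    moreover have "mat_prod_list (map ((\<lambda>i. E (?ys ! i)) \<circ> q) [0..<length xs]) =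
        of_int (sign q) *\<^sub>R mat_prod_list (map (\<lambda>i. E (?ys ! i)) [0..<length xs])"
      by (rule mat_prod_list_permute[OF q(1) anti])
    ultimately show ?thesis
      by (simp only: Eprod_def)
  qed
  ultimately show ?thesis by (simp add: sign_def)
qed

text \<open>Pairwise orthogonal vectors anticommute in the Clifford algebra, so their product may be
  antisymmetrised; this turns products of coordinates into determinants.\<close>

lemma clifford_prod_orthogonal:
  assumes "\<And>i j. i < m \<Longrightarrow> j < m \<Longrightarrow> i \<noteq> j \<Longrightarrow> u i \<bullet> u j = 0"
  shows "clifford_prod m u = (\<Sum>I\<in>index_sets m. dx I u *\<^sub>R Eprod I)"
proof -
  let ?P = "{p. p permutes {..<m}}"
  have fin: "finite (words m)"
    by (rule finite_lists_length_eq) simp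
  have fin': "finite {xs \<in> words m. distinct xs}"
    by (rule finite_subset[OF _ fin]) auto
  have perm: "clifford_prod m u = of_int (sign p) *\<^sub>R clifford_prod m (u \<circ> p)" if "p \<in> ?P" for p
  proof -
    have p: "p permutes {..<m}" using that by simp
    have anti: "clifford (u i) ** clifford (u j) = - (clifford (u j) ** clifford (u i))"
      if "i < m" "j < m" "i \<noteq> j" for i j
      using assms[OF that] by (subst clifford_anticommute) simp
    have "mat_prod_list (map ((\<lambda>i. clifford (u i)) \<circ> p) [0..<m]) =
        of_int (sign p) *\<^sub>R mat_prod_list (map (\<lambda>i. clifford (u i)) [0..<m])"
      by (rule mat_prod_list_permute[OF p anti])
    then have "clifford_prod m (u \<circ> p) = of_int (sign p) *\<^sub>R clifford_prod m u"
      by (simp only: clifford_prod_def o_def)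
    moreover have "of_int (sign p) * of_int (sign p) = (1 :: real)"
      by (simp add: sign_def)
    ultimately show ?thesis by simp
  qed
  have "fact m *\<^sub>R clifford_prod m u = (\<Sum>p\<in>?P. clifford_prod m u)"
    by (simp add: card_permutations sum_constant_scaleR del: sum_constant)
  also have "\<dots> = (\<Sum>p\<in>?P. of_int (sign p) *\<^sub>R clifford_prod m (u \<circ> p))"
    using perm by (rule sum.cong[OF refl])
  also have "\<dots> = (\<Sum>xs\<in>words m. \<Sum>p\<in>?P. (of_int (sign p) * (\<Prod>i<m. coord (xs ! i) (u (p i)))) *\<^sub>R mat_prod_list (map E xs))"
    unfolding clifford_prod_expand scaleR_sum_right by (subst sum.swap) simp
  also have "\<dots> = (\<Sum>xs\<in>words m. det_form (map coord xs) u *\<^sub>R mat_prod_list (map E xs))"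
    unfolding scaleR_sum_left[symmetric] by (rule sum.cong) (auto simp: det_form_def intro!: sum.cong)
  \<comment> \<open>A repeated letter gives a determinant with two equal rows.\<close>
  also have "\<dots> = (\<Sum>xs\<in>{xs\<in>words m. distinct xs}. det_form (map coord xs) u *\<^sub>R mat_prod_list (map E xs))"
    using fin by (intro sum.mono_neutral_right) (auto dest: distinct_map[THEN iffD1] intro!: det_form_eq_0)
  also have "\<dots> = (\<Sum>xs\<in>{xs\<in>words m. distinct xs}. dx (set xs) u *\<^sub>R Eprod (set xs))"
    by (intro sum.cong det_form_word) auto
  also have "\<dots> = (\<Sum>I\<in>index_sets m. \<Sum>xs\<in>{xs\<in>{xs\<in>words m. distinct xs}. set xs = I}. dx (set xs) u *\<^sub>R Eprod (set xs))"
    by (rule sum.group[symmetric, OF fin' finite_index_sets]) (auto simp: index_sets_def distinct_card)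
  \<comment> \<open>Each index set has \<open>m!\<close> orderings, which matches the number of
    permutations summed over.\<close>
  also have "\<dots> = (\<Sum>I\<in>index_sets m. fact m *\<^sub>R (dx I u *\<^sub>R Eprod I))"
  proof (intro sum.cong refl)
    fix I assume I: "I \<in> index_sets m"
    have "{xs\<in>{xs\<in>words m. distinct xs}. set xs = I} = permutations_of_set I"
      using index_setsD[OF I] by (auto simp: permutations_of_set_def distinct_card)
    then have "(\<Sum>xs\<in>{xs\<in>{xs\<in>words m. distinct xs}. set xs = I}. dx (set xs) u *\<^sub>R Eprod (set xs)) =
      (\<Sum>xs\<in>permutations_of_set I. dx I u *\<^sub>R Eprod I)"
      by (rule sum.cong) (simp add: permutations_of_set_def)
    also have "\<dots> = fact m *\<^sub>R (dx I u *\<^sub>R Eprod I)"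
      by (simp add: sum_constant_scaleR index_setsD[OF I] del: sum_constant)
    finally show "(\<Sum>xs\<in>{xs\<in>{xs\<in>words m. distinct xs}. set xs = I}. dx (set xs) u *\<^sub>R Eprod (set xs)) =
      fact m *\<^sub>R (dx I u *\<^sub>R Eprod I)" .
  qed
  finally have "fact m *\<^sub>R clifford_prod m u = fact m *\<^sub>R (\<Sum>I\<in>index_sets m. dx I u *\<^sub>R Eprod I)"
    by (simp only: scaleR_sum_right)
  then show ?thesis by simp
qed

text \<open>The Cauchy-Binet identity for an orthonormal frame. The Clifford product of the frame is
  an orthogonal matrix, so its squared norm is 256; its expansion in the orthogonal basis
  \<open>Eprod I\<close> gives 256 times the sum.\<close>

lemma sum_dx_square:
  assumes "\<And>i j. i < m \<Longrightarrow> j < m \<Longrightarrow> u i \<bullet> u j = (if i = j then 1 else 0)"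
  shows "(\<Sum>I\<in>index_sets m. (dx I u)\<^sup>2) = 1"
proof -
  let ?S = "\<Sum>I\<in>index_sets m. dx I u *\<^sub>R Eprod I"
  have S: "clifford_prod m u = ?S"
    by (rule clifford_prod_orthogonal) (simp add: assms)
  have "orthogonal_matrix (clifford (u i))" if "i < m" for i
    using assms[OF that that] by (intro orthogonal_clifford) (simp add: norm_eq_sqrt_inner)
  then have "orthogonal_matrix (clifford_prod m u)"
    unfolding clifford_prod_def by (intro orthogonal_mat_prod_list) auto
  then have "256 = clifford_prod m u \<bullet> clifford_prod m u"
    using inner_orthogonal_matrix_self by fastforce
  also have "\<dots> = (\<Sum>I\<in>index_sets m. \<Sum>J\<in>index_sets m. dx I u * (dx J u * (Eprod I \<bullet> Eprod J)))"
    by (simp add: S inner_sum_left inner_sum_right sum_distrib_left) (simp add: inner_commute)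
  also have "\<dots> = (\<Sum>I\<in>index_sets m. \<Sum>J\<in>index_sets m. if J = I then 256 * (dx I u)\<^sup>2 else 0)"
    by (intro sum.cong refl; simp only: inner_Eprod[OF index_setsD(1) index_setsD(1)]) (auto simp: power2_eq_square)
  also have "\<dots> = 256 * (\<Sum>I\<in>index_sets m. (dx I u)\<^sup>2)"
    by (simp add: finite_index_sets sum_distrib_left)
  finally show ?thesis by simp
qed

text \<open>The map from \<open>A\<close> to \<open>(s + s') \<bullet> A s\<close> is linear and
  takes \<open>Eprod I\<close> to the coefficient of \<open>phi\<close> at \<open>I\<close>, so
  applying it to the expansion of the Clifford product produces the component.\<close>

lemma component_phi_orthogonal:
  assumes "\<And>i j. i < m \<Longrightarrow> j < m \<Longrightarrow> i \<noteq> j \<Longrightarrow> u i \<bullet> u j = 0"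
  shows "component m phi u = (spinor_s + spinor_s') \<bullet> (clifford_prod m u *v spinor_s)"
proof -
  have prod: "clifford_prod m u = (\<Sum>I\<in>index_sets m. dx I u *\<^sub>R Eprod I)"
    by (rule clifford_prod_orthogonal) (rule assms)
  have lin: "linear (\<lambda>A :: Cl16. (spinor_s + spinor_s') \<bullet> (A *v spinor_s))"
    by (rule linearI) (simp_all add: matrix_vector_mult_add_rdistrib inner_add_right scaleR_matrix_vector_assoc[symmetric])
  have "(spinor_s + spinor_s') \<bullet> (clifford_prod m u *v spinor_s) =
    (\<Sum>I\<in>index_sets m. dx I u * ((spinor_s + spinor_s') \<bullet> (Eprod I *v spinor_s)))"
    by (simp only: prod linear_sum[OF lin] linear_cmul[OF lin] real_scaleR_def)
  also have "\<dots> = component m phi u"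
    unfolding component_def by (intro sum.cong refl) (simp only: Ecoeff_phi[OF index_setsD(1)] mult.commute)
  finally show ?thesis ..
qed

text \<open>Comass needs testing on orthonormal frames only: by Gram-Schmidt a unit simple vector
  \<open>c v\<close> becomes \<open>c d u\<close> with \<open>\<bar>c d\<bar> = 1\<close>, and in
  the degenerate case the form vanishes.\<close>

lemma calibrationI:
  assumes alt: "alternating_form m \<alpha>"
    and bound: "\<And>u. (\<And>i j. i < m \<Longrightarrow> j < m \<Longrightarrow> u i \<bullet> u j = (if i = j then 1 else 0)) \<Longrightarrow> \<bar>\<alpha> u\<bar> \<le> 1"
  shows "calibration m \<alpha>"
proof -
  have "c * \<alpha> v \<le> 1" if cv: "\<bar>c\<bar> * mv_norm m v = 1" for c v
  proof (rule alternating_gram_schmidt[of m v])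
    assume zero: "\<And>\<beta> :: (real^16, real) form. alternating_form m \<beta> \<Longrightarrow> \<beta> v = 0"
    show ?thesis using zero[OF alt] by simp
  next
    fix u d
    assume u: "\<And>i j. i < m \<Longrightarrow> j < m \<Longrightarrow> u i \<bullet> u j = (if i = j then 1 else 0)"
      and d: "\<And>\<beta> :: (real^16, real) form. alternating_form m \<beta> \<Longrightarrow> \<beta> v = d * \<beta> u"
    have "dx I v = d * dx I u" if "I \<in> index_sets m" for I
      using d[of "dx I"] alternating_dx[of I] index_setsD[OF that] by simp
    then have "(\<Sum>I\<in>index_sets m. (dx I v)\<^sup>2) = (\<Sum>I\<in>index_sets m. d\<^sup>2 * (dx I u)\<^sup>2)"
      by (simp add: power_mult_distrib)
    also have "\<dots> = d\<^sup>2"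
      by (simp add: sum_dx_square[OF u] flip: sum_distrib_left)
    finally have "mv_norm m v = \<bar>d\<bar>"
      by (simp add: mv_norm_def)
    then have cd: "\<bar>c * d\<bar> = 1"
      using cv by (simp add: abs_mult)
    have "c * \<alpha> v = c * d * \<alpha> u"
      using d[OF alt] by simp
    also have "\<dots> \<le> \<bar>c * d\<bar> * \<bar>\<alpha> u\<bar>"
      by (metis abs_ge_self abs_mult)
    also have "\<bar>\<alpha> u\<bar> \<le> 1"
      by (rule bound) (rule u)
    finally show ?thesis by (simp add: cd)
  qed
  then have "comass m \<alpha> \<le> 1"
    unfolding comass_def by (intro Sup_least) (auto simp: one_ereal_def)
  with alt show ?thesis
    by (simp add: calibration_def)
qed

text \<open>The opposite orientation of \<open>cl8_nu8\<close>: it moves \<open>nu8\<close> inwards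
  to a basis spinor, where it can be evaluated.\<close>

lemma nu8_cl8: "nu8 *v (cl8 v *v p) = - (cl8 v *v (nu8 *v p))"
  by (simp add: cl8_nu8)

section \<open>The spinor estimate\<close>

lemma vector_16 [simp]:
  "(vector [a,b,c,d,e,f,g,h,i,j,k,l,m,n,p,q] :: 'a::zero^16) $ 1 = a"
  "(vector [a,b,c,d,e,f,g,h,i,j,k,l,m,n,p,q] :: 'a::zero^16) $ 2 = b"
  "(vector [a,b,c,d,e,f,g,h,i,j,k,l,m,n,p,q] :: 'a::zero^16) $ 3 = c"
  "(vector [a,b,c,d,e,f,g,h,i,j,k,l,m,n,p,q] :: 'a::zero^16) $ 4 = d"
  "(vector [a,b,c,d,e,f,g,h,i,j,k,l,m,n,p,q] :: 'a::zero^16) $ 5 = e"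
  "(vector [a,b,c,d,e,f,g,h,i,j,k,l,m,n,p,q] :: 'a::zero^16) $ 6 = f"
  "(vector [a,b,c,d,e,f,g,h,i,j,k,l,m,n,p,q] :: 'a::zero^16) $ 7 = g"
  "(vector [a,b,c,d,e,f,g,h,i,j,k,l,m,n,p,q] :: 'a::zero^16) $ 8 = h"
  "(vector [a,b,c,d,e,f,g,h,i,j,k,l,m,n,p,q] :: 'a::zero^16) $ 9 = i"
  "(vector [a,b,c,d,e,f,g,h,i,j,k,l,m,n,p,q] :: 'a::zero^16) $ 10 = j"
  "(vector [a,b,c,d,e,f,g,h,i,j,k,l,m,n,p,q] :: 'a::zero^16) $ 11 = k"
  "(vector [a,b,c,d,e,f,g,h,i,j,k,l,m,n,p,q] :: 'a::zero^16) $ 12 = l"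
  "(vector [a,b,c,d,e,f,g,h,i,j,k,l,m,n,p,q] :: 'a::zero^16) $ 13 = m"
  "(vector [a,b,c,d,e,f,g,h,i,j,k,l,m,n,p,q] :: 'a::zero^16) $ 14 = n"
  "(vector [a,b,c,d,e,f,g,h,i,j,k,l,m,n,p,q] :: 'a::zero^16) $ 15 = p"
  "(vector [a,b,c,d,e,f,g,h,i,j,k,l,m,n,p,q] :: 'a::zero^16) $ 16 = q"
  unfolding vector_def by simp_all

lemma lo_hi_exists: "\<exists>w. lo w = p \<and> hi w = q"
  by (rule exI[of _ "vector [p$1, p$2, p$3, p$4, p$5, p$6, p$7, p$8, q$1, q$2, q$3, q$4, q$5, q$6, q$7, q$8]"])
    (simp add: lo_def hi_def eq_oct_iff)

lemma inner_cl8_cl8: "(cl8 v *v p) \<bullet> (cl8 w *v p) = (v \<bullet> w) * (p \<bullet> p)"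
  using inner_cl8[of "v + w" p]
  by (simp add: linear_add[OF linear_cl8] matrix_vector_mult_add_rdistrib inner_add_left inner_add_right
    inner_cl8 inner_commute[of "cl8 w *v p"] inner_commute[of w v] algebra_simps)

lemma cl8_skew_self: "p \<bullet> (cl8 v *v p) = 0"
  using cl8_skew[of v p p] by (simp add: inner_commute)

lemma inner_clifford: "(clifford v *v x) \<bullet> (clifford v *v y) = (v \<bullet> v) * (x \<bullet> y)"
  by (simp add: clifford_skew clifford_clifford_vec)

text \<open>Octonionic right multiplication by \<open>\<i>\<close> on the first
  \<open>real^8\<close> and by its negative on the second. The opposite signs are what
  \<open>clifford_cplx\<close> requires.\<close>

definition cplx :: "real^16 \<Rightarrow> real^16" where
  "cplx v = vector [- v$2, v$1, v$4, - v$3, v$6, - v$5, - v$8, v$7,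
     v$10, - v$9, - v$12, v$11, - v$14, v$13, v$16, - v$15]"

lemma linear_cplx: "linear cplx"
  by (rule linearI) (simp_all add: cplx_def vec_eq_iff forall_16)

lemma inner_cplx: "cplx v \<bullet> cplx w = v \<bullet> w"
  by (simp add: inner_vec_def sum_16 cplx_def)

lemma cplx_cplx: "cplx (cplx v) = - v"
  by (simp add: cplx_def vec_eq_iff forall_16)

lemma orthogonal_complex_structure_cplx: "orthogonal_complex_structure cplx"
  by (simp add: orthogonal_complex_structure_def orthogonal_transformation_def linear_cplx inner_cplx cplx_cplx)

abbreviation spinor_one :: P8 where "spinor_one \<equiv> inl (oct_basis (Suc 0))"
abbreviation spinor_i :: P8 where "spinor_i \<equiv> inl (oct_basis 2)"

lemma spinor_s_eq: "spinor_s = tensor_vec spinor_one spinor_one" "spinor_s' = tensor_vec spinor_i spinor_i"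
  by (simp_all add: spinor_s_def spinor_s'_def spinor_plus_eq)

lemma inner_oct_basis:
  "oct_basis (Suc 0) \<bullet> oct_basis (Suc 0) = 1" "oct_basis 2 \<bullet> oct_basis 2 = 1"
  "oct_basis (Suc 0) \<bullet> oct_basis 2 = 0" "oct_basis 2 \<bullet> oct_basis (Suc 0) = 0"
  by (simp_all add: oct_basis_eq inner_vec_def[where 'b = 8] sum_8)

text \<open>With \<open>e1\<close> and \<open>e2\<close> the first two basis spinors, the complex
  spinor \<open>(e1 + \<i> e2) \<otimes> (e1 - \<i> e2)\<close> has real part \<open>s + s'\<close>
  and imaginary part \<open>spinor_t\<close>.\<close>

definition spinor_t :: P16 where
  "spinor_t = tensor_vec spinor_i spinor_one - tensor_vec spinor_one spinor_i"

text \<open>This expresses that the complex spinor with real part \<open>s + s'\<close> and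
  imaginary part \<open>spinor_t\<close> is pure: it is annihilated by all
  \<open>v + \<i> J v\<close>. On each tensor factor, replacing \<open>v\<close> by
  \<open>cplx v\<close> exchanges the first two basis spinors up to sign.\<close>

lemma clifford_cplx: "clifford (cplx v) *v (spinor_s + spinor_s') = - (clifford v *v spinor_t)"
proof -
  have lo: "cl8 (lo (cplx v)) *v spinor_one = - (cl8 (lo v) *v spinor_i)"
    "cl8 (lo (cplx v)) *v spinor_i = cl8 (lo v) *v spinor_one"
    and hi: "cl8 (hi (cplx v)) *v spinor_one = cl8 (hi v) *v spinor_i"
    "cl8 (hi (cplx v)) *v spinor_i = - (cl8 (hi v) *v spinor_one)"
    unfolding cl8_inl minus_minus inr_simps(3)[symmetric]
    by (rule arg_cong[where f = inr], simp add: oct_basis_eq eq_oct_iff oct_mult_defs ocnj_def lo_def hi_def cplx_def)+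
  show ?thesis
    by (simp add: spinor_s_eq spinor_t_def matrix_vector_right_distrib matrix_vector_mult_diff_distrib clifford_tensor
      lo hi nu8_inl tensor_vec_bilinear)
qed

text \<open>Bessel's inequality for two vectors with equal coefficients.\<close>

lemma orthonormal_pair_bound:
  assumes "t \<bullet> t = 1" "t' \<bullet> t' = 1" "t \<bullet> t' = 0" "z \<bullet> t = \<sigma>" "z \<bullet> t' = \<sigma>"
  shows "2 * \<sigma>\<^sup>2 \<le> z \<bullet> z"
proof -
  have "t' \<bullet> t = 0" "t \<bullet> z = \<sigma>" "t' \<bullet> z = \<sigma>"
    using assms by (simp_all add: inner_commute)
  moreover have "0 \<le> (z - \<sigma> *\<^sub>R t - \<sigma> *\<^sub>R t') \<bullet> (z - \<sigma> *\<^sub>R t - \<sigma> *\<^sub>R t')"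
    by (rule inner_ge_zero)
  ultimately show ?thesis
    by (simp add: inner_diff_left inner_diff_right assms power2_eq_square)
qed

lemma spinor_bound:
  assumes K: "\<And>a. clifford (K a) *v \<zeta> = - (clifford a *v \<zeta>')"
    and orth: "\<And>a. K a \<bullet> a = 0" and iso: "\<And>a. K a \<bullet> K a = a \<bullet> a"
    and norm: "\<zeta>' \<bullet> \<zeta>' = 2"
  shows "\<bar>spinor_s \<bullet> \<zeta>\<bar> \<le> 1"
proof -
  let ?a = spinor_one
  let ?c = "\<lambda>v x. clifford v *v x"
  define \<sigma> where "\<sigma> = spinor_s \<bullet> \<zeta>"
  have ss: "spinor_s \<bullet> spinor_s = 1"
    by (simp add: spinor_s_eq inner_tensor inner_oct_basis)
  \<comment> \<open>For a unit vector \<open>v\<close>, also \<open>K v\<close> has norm 1, so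
    \<open>c(v) c(K v)\<close> is an isometry; it carries \<open>\<zeta>\<close> to
    \<open>\<zeta>'\<close> and hence preserves the inner product \<open>\<sigma>\<close> with
    \<open>s\<close>.\<close>
  have proj: "\<zeta>' \<bullet> ?c v (?c (K v) spinor_s) = \<sigma>" if "v \<bullet> v = 1" for v
  proof -
    have "?c v (?c (K v) \<zeta>) = \<zeta>'"
      using that by (simp add: K clifford_clifford_vec linear_neg[OF matrix_vector_mul_linear])
    then have "\<zeta>' \<bullet> ?c v (?c (K v) spinor_s) = ?c v (?c (K v) \<zeta>) \<bullet> ?c v (?c (K v) spinor_s)"
      by simp
    also have "\<dots> = \<sigma>"
      using that by (simp add: inner_clifford iso \<sigma>_def inner_commute)
    finally show ?thesis .
  qed
  have unit: "?c v (?c (K v) spinor_s) \<bullet> ?c v (?c (K v) spinor_s) = 1" if "v \<bullet> v = 1" for v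
    using that by (simp add: inner_clifford iso ss)
  obtain v where v: "lo v = oct_basis (Suc 0)" "hi v = 0"
    using lo_hi_exists by blast
  have v1: "v \<bullet> v = 1"
    using inner_oct_basis(1) by (simp add: inner_lo_hi v)
  \<comment> \<open>The direction of \<open>w\<close> within the second summand, chosen orthogonal
    to the second component of \<open>K v\<close>.\<close>
  obtain y where y: "y \<noteq> 0" "hi (K v) \<bullet> y = 0"
    using orthogonal_to_vector_exists[of "hi (K v)"] by (auto simp: orthogonal_def)
  obtain w where w: "lo w = 0" "hi w = y /\<^sub>R norm y"
    using lo_hi_exists by blast
  have w1: "w \<bullet> w = 1"
    using y by (simp add: inner_lo_hi w dot_square_norm power2_eq_square)
  have cl0: "cl8 0 = 0" by (rule linear_0[OF linear_cl8])
  have lo_Kv: "lo (K v) \<bullet> lo v = 0"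
    using orth[of v] by (simp add: inner_lo_hi v)
  have "?c v (?c (K v) spinor_s) = tensor_vec (cl8 (lo v) *v (cl8 (lo (K v)) *v ?a)) ?a
      - tensor_vec (cl8 (lo v) *v ?a) (cl8 (hi (K v)) *v ?a)"
    by (simp add: spinor_s_eq clifford_tensor nu8_inl matrix_vector_right_distrib v(2) cl0 tensor_vec_bilinear nu8_cl8)
  moreover have "?c w (?c (K w) spinor_s) = tensor_vec (cl8 (lo (K w)) *v ?a) (cl8 (hi w) *v ?a)
      + tensor_vec ?a (cl8 (hi w) *v (cl8 (hi (K w)) *v ?a))"
    by (simp add: spinor_s_eq clifford_tensor nu8_inl matrix_vector_right_distrib w(1) cl0 tensor_vec_bilinear)
  \<comment> \<open>Of the four inner products of tensors, two vanish by skewness of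
    \<open>cl8\<close>, one because \<open>lo (K v)\<close> is orthogonal to \<open>lo v\<close>,
    and one by the choice of \<open>w\<close>.\<close>
  ultimately have ortho: "?c v (?c (K v) spinor_s) \<bullet> ?c w (?c (K w) spinor_s) = 0"
    using y lo_Kv by (simp add: inner_add_right inner_diff_left inner_tensor cl8_skew_self inner_commute[of "cl8 _ *v ?a" ?a]
      cl8_skew[of "lo v" "cl8 (lo (K v)) *v ?a" ?a] inner_cl8_cl8 w(2))
  have "2 * \<sigma>\<^sup>2 \<le> \<zeta>' \<bullet> \<zeta>'"
    by (rule orthonormal_pair_bound[OF unit[OF v1] unit[OF w1] ortho proj[OF v1] proj[OF w1]])
  then have "\<sigma>\<^sup>2 \<le> 1" by (simp only: norm)
  then show ?thesis
    unfolding \<sigma>_def[symmetric] by (simp only: abs_square_le_1)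
qed

text \<open>Each unit factor acts on vectors by conjugation as minus a hyperplane reflection; the
  reflections compose to \<open>\<rho>\<close> and the signs collect in \<open>\<delta>\<close>. The
  commutation form avoids inverting the product.\<close>

lemma clifford_conj:
  assumes "\<And>i. i < m \<Longrightarrow> u i \<bullet> u i = 1"
  obtains \<rho> \<delta> where "orthogonal_transformation \<rho>" "\<delta> \<noteq> 0"
    "\<And>a. clifford a ** clifford_prod m u = \<delta> *\<^sub>R (clifford_prod m u ** clifford (\<rho> a))"
proof -
  have "\<exists>\<rho> \<delta>. orthogonal_transformation \<rho> \<and> \<delta> \<noteq> 0 \<and>
    (\<forall>a. clifford a ** clifford_prod m u = \<delta> *\<^sub>R (clifford_prod m u ** clifford (\<rho> a)))"
    using assms
  proof (induction m arbitrary: u)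
    case 0
    show ?case
      by (intro exI[of _ id] exI[of _ 1]) (simp add: orthogonal_transformation_id clifford_prod_def)
  next
    case (Suc m)
    have "\<exists>\<rho> \<delta>. orthogonal_transformation \<rho> \<and> \<delta> \<noteq> 0 \<and>
      (\<forall>a. clifford a ** clifford_prod m (u \<circ> Suc) = \<delta> *\<^sub>R (clifford_prod m (u \<circ> Suc) ** clifford (\<rho> a)))"
      by (rule Suc.IH) (simp add: Suc.prems)
    then obtain \<rho> \<delta> where \<rho>: "orthogonal_transformation \<rho>" "\<delta> \<noteq> 0"
      and "\<forall>a. clifford a ** clifford_prod m (u \<circ> Suc) = \<delta> *\<^sub>R (clifford_prod m (u \<circ> Suc) ** clifford (\<rho> a))"
      by blast
    then have \<rho>3: "clifford a ** clifford_prod m (u \<circ> Suc) = \<delta> *\<^sub>R (clifford_prod m (u \<circ> Suc) ** clifford (\<rho> a))" for a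
      by simp
    \<comment> \<open>The reflection in the hyperplane orthogonal to \<open>u 0\<close>; the
      Clifford relation makes it appear when \<open>clifford a\<close> passes
      \<open>clifford (u 0)\<close>.\<close>
    define r where "r a = a - (2 * (u 0 \<bullet> a)) *\<^sub>R u 0" for a
    have u0: "u 0 \<bullet> u 0 = 1" using Suc.prems by simp
    have r: "orthogonal_transformation r"
      unfolding orthogonal_transformation_def
    proof
      show "linear r"
        by (rule linearI) (simp_all add: r_def inner_add_right algebra_simps)
      show "\<forall>v w. r v \<bullet> r w = v \<bullet> w"
      proof (intro allI)
        fix v w
        show "r v \<bullet> r w = v \<bullet> w"
          by (simp add: r_def inner_diff_left inner_diff_right u0 inner_commute[of v "u 0"])
      qed
    qed
    have swap: "clifford a ** clifford (u 0) = - (clifford (u 0) ** clifford (r a))" for a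
    proof -
      have "clifford (u 0) ** clifford (r a) =
          clifford (u 0) ** clifford a - (2 * (u 0 \<bullet> a)) *\<^sub>R (clifford (u 0) ** clifford (u 0))"
        by (simp add: r_def linear_diff[OF linear_clifford] linear_cmul[OF linear_clifford]
          linear_diff[OF linear_matrix_mult_right] linear_cmul[OF linear_matrix_mult_right])
      also have "\<dots> = - (clifford a ** clifford (u 0))"
        using clifford_anticommute[of a "u 0"] by (simp add: clifford_square u0 inner_commute[of a])
      finally show ?thesis by simp
    qed
    have *: "clifford a ** clifford_prod (Suc m) u = (- \<delta>) *\<^sub>R (clifford_prod (Suc m) u ** clifford (\<rho> (r a)))" for a
    proof -
      have "clifford a ** clifford_prod (Suc m) u = - (clifford (u 0) ** (clifford (r a) ** clifford_prod m (u \<circ> Suc)))"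
        by (simp only: clifford_prod_Suc matrix_mul_assoc minus_matrix_mult swap)
      also have "\<dots> = - (\<delta> *\<^sub>R (clifford (u 0) ** (clifford_prod m (u \<circ> Suc) ** clifford (\<rho> (r a)))))"
        by (simp only: \<rho>3 linear_cmul[OF linear_matrix_mult_right])
      finally show ?thesis
        by (simp only: clifford_prod_Suc matrix_mul_assoc scaleR_minus_left)
    qed
    show ?case
    proof (intro exI conjI allI)
      show "orthogonal_transformation (\<rho> \<circ> r)"
        using \<rho>(1) r by (rule orthogonal_transformation_compose)
      show "- \<delta> \<noteq> 0" using \<rho>(2) by simp
      show "clifford a ** clifford_prod (Suc m) u = (- \<delta>) *\<^sub>R (clifford_prod (Suc m) u ** clifford ((\<rho> \<circ> r) a))" for a
        unfolding o_apply by (rule *)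
    qed
  qed
  then show thesis
  proof (elim exE conjE)
    fix \<rho> \<delta>
    assume "orthogonal_transformation \<rho>" "\<delta> \<noteq> 0"
      and "\<forall>a. clifford a ** clifford_prod m u = \<delta> *\<^sub>R (clifford_prod m u ** clifford (\<rho> a))"
    then show thesis by (intro that[of \<rho> \<delta>]) (assumption, assumption, elim allE)
  qed
qed

lemma transpose_scaleR: "transpose (c *\<^sub>R A :: real^'n^'m) = c *\<^sub>R transpose A"
  by (simp add: transpose_def vec_eq_iff)

text \<open>The product of the frame is moved to the other side of the inner product as its
  transpose. This carries \<open>s + s'\<close> and \<open>spinor_t\<close> to the pair
  \<open>\<zeta>\<close>, \<open>\<zeta>'\<close> of \<open>spinor_bound\<close> and the relation of
  \<open>clifford_cplx\<close> to one for the conjugated complex structure \<open>K\<close>.\<close>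

lemma clifford_prod_bound:
  assumes "\<And>i. i < m \<Longrightarrow> u i \<bullet> u i = 1"
  shows "\<bar>(spinor_s + spinor_s') \<bullet> (clifford_prod m u *v spinor_s)\<bar> \<le> 1"
proof -
  let ?X = "transpose (clifford_prod m u)"
  obtain \<rho> \<delta> where \<rho>: "orthogonal_transformation \<rho>" "\<delta> \<noteq> 0"
    "\<And>a. clifford a ** clifford_prod m u = \<delta> *\<^sub>R (clifford_prod m u ** clifford (\<rho> a))"
    using clifford_conj[of m u] assms by metis
  have X: "?X ** clifford a = \<delta> *\<^sub>R (clifford (\<rho> a) ** ?X)" for a
    using arg_cong[OF \<rho>(3)[of a], of transpose]
    by (simp add: matrix_transpose_mul transpose_scaleR transpose_clifford minus_matrix_mult linear_neg[OF linear_matrix_mult_right])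
  have X': "clifford (\<rho> a) *v (?X *v x) = (1 / \<delta>) *\<^sub>R (?X *v (clifford a *v x))" for a x
    using \<rho>(2) by (simp add: matrix_vector_mul_assoc X scaleR_matrix_vector_assoc[symmetric] del: transpose_matrix_vector)
  have inv: "orthogonal_transformation (inv \<rho>)" "\<rho> (inv \<rho> a) = a" for a
    using \<rho>(1) by (auto simp: orthogonal_transformation_inv orthogonal_transformation_surj surj_f_inv_f)
  define K where "K a = \<rho> (cplx (inv \<rho> a))" for a
  \<comment> \<open>The factor \<open>1 / \<delta>\<close> from pulling
    \<open>clifford (K a)\<close> inside is absorbed again when
    \<open>clifford (inv \<rho> a)\<close> is taken out.\<close>
  have K: "clifford (K a) *v (?X *v (spinor_s + spinor_s')) = - (clifford a *v (?X *v spinor_t))" for a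
  proof -
    have "clifford (K a) *v (?X *v (spinor_s + spinor_s')) = - ((1 / \<delta>) *\<^sub>R (?X *v (clifford (inv \<rho> a) *v spinor_t)))"
      unfolding K_def X' clifford_cplx by (simp add: linear_neg[OF matrix_vector_mul_linear] del: transpose_matrix_vector)
    also have "\<dots> = - (clifford a *v (?X *v spinor_t))"
      unfolding X'[symmetric] inv(2) ..
    finally show ?thesis .
  qed
  have cplx_orth: "cplx a \<bullet> a = 0" for a
    using inner_cplx[of a "cplx a"] by (simp add: cplx_cplx inner_commute)
  have Korth: "K a \<bullet> a = 0" for a
    using \<rho>(1) cplx_orth[of "inv \<rho> a"] inv(2)[of a]
    by (metis K_def orthogonal_transformation_def)
  have Kiso: "K a \<bullet> K a = a \<bullet> a" for a
    using \<rho>(1) inv(1) by (simp add: K_def orthogonal_transformation_def inner_cplx)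
  have "orthogonal_matrix (clifford (u i))" if "i < m" for i
    using assms[OF that] by (intro orthogonal_clifford) (simp add: norm_eq_sqrt_inner)
  then have "orthogonal_matrix (clifford_prod m u)"
    unfolding clifford_prod_def by (intro orthogonal_mat_prod_list) auto
  then have "clifford_prod m u ** ?X = mat 1"
    by (simp add: orthogonal_matrix_def)
  then have "(?X *v spinor_t) \<bullet> (?X *v spinor_t) = spinor_t \<bullet> spinor_t"
    by (simp add: inner_transpose matrix_vector_mul_assoc del: transpose_matrix_vector)
  also have "\<dots> = 2"
    by (simp add: spinor_t_def inner_diff_left inner_diff_right inner_tensor inner_oct_basis)
  finally have "\<bar>spinor_s \<bullet> (?X *v (spinor_s + spinor_s'))\<bar> \<le> 1"
    by (intro spinor_bound[of K _ "?X *v spinor_t"] K Korth Kiso)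
  then show ?thesis
    by (simp only: inner_commute[of spinor_s] inner_transpose)
qed

lemma calibration_component_phi: "calibration m (component m phi)"
proof (rule calibrationI[OF alternating_component])
  fix u :: "nat \<Rightarrow> real^16"
  assume u: "\<And>i j. i < m \<Longrightarrow> j < m \<Longrightarrow> u i \<bullet> u j = (if i = j then 1 else 0)"
  have "component m phi u = (spinor_s + spinor_s') \<bullet> (clifford_prod m u *v spinor_s)"
    by (rule component_phi_orthogonal) (simp add: u)
  then show "\<bar>component m phi u\<bar> \<le> 1"
    using clifford_prod_bound[of m u] by (simp add: u)
qed

section \<open>The coefficients of \<open>phi\<close>\<close>

definition act :: "nat list \<Rightarrow> P8 \<Rightarrow> P8" where
  "act xs p = mat_prod_list (map (\<lambda>i. cl8 (oct_basis i)) xs) *v p"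

lemma act_simps: "act [] p = p" "act (i # xs) p = cl8 (oct_basis i) *v act xs p"
  by (simp_all add: act_def matrix_vector_mul_assoc)

text \<open>Every generator with index at most 8 leaves one \<open>nu8\<close> on the second
  factor.\<close>

lemma E_list_lo:
  "set xs \<subseteq> {1..8} \<Longrightarrow> mat_prod_list (map E xs) *v tensor_vec p q = tensor_vec (act xs p) (((*v) nu8 ^^ length xs) q)"
proof (induction xs)
  case (Cons i xs)
  then have "E i = tensor_mat (cl8 (oct_basis i)) nu8" by (simp add: E_def)
  with Cons show ?case
    by (simp add: matrix_vector_mul_assoc[symmetric] tensor_mat_vector act_simps)
qed (simp add: act_simps)

lemma E_list_hi:
  "set xs \<subseteq> {1..8} \<Longrightarrow> mat_prod_list (map E (map ((+) 8) xs)) *v tensor_vec p q = tensor_vec p (act xs q)"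
proof (induction xs)
  case (Cons i xs)
  then have "E (8 + i) = tensor_mat (mat 1) (cl8 (oct_basis i))" by (simp add: E_def)
  with Cons show ?case
    by (simp add: matrix_vector_mul_assoc[symmetric] tensor_mat_vector act_simps)
qed (simp add: act_simps)

lemma sorted_list_of_set_filter:
  assumes "I \<subseteq> {1..16}"
  shows "sorted_list_of_set I =
    filter (\<lambda>i. i \<in> I) [1..<9] @ map ((+) 8) (filter (\<lambda>i. 8 + i \<in> I) [1..<9])"
proof -
  have "finite I" using assms finite_subset by blast
  have "sorted_list_of_set I = filter (\<lambda>i. i \<in> I) [1..<17]"
    by (rule sorted_distinct_set_unique) (use assms \<open>finite I\<close> in \<open>auto intro!: sorted_wrt_filter\<close>)
  also have "[1..<17] = [1..<9] @ map ((+) 8) [1..<9]"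
    by (simp add: map_add_upt[of 8, unfolded add.commute[of _ 8]] upt_conv_Cons)
  finally show ?thesis
    by (simp add: filter_map o_def)
qed

text \<open>The inner products with \<open>e1+\<close> and \<open>e2+\<close> combine into one complex number because the even products
  of generators \<open>e(2 j + 1) e(2 j + 2)\<close> act on their span as multiplication by \<open>\<plusminus> \<i>\<close>.\<close>

definition half_coeff :: "(nat \<Rightarrow> bool) \<Rightarrow> complex" where
  "half_coeff P = Complex (spinor_one \<bullet> act (filter P [1..<9]) spinor_one) (spinor_i \<bullet> act (filter P [1..<9]) spinor_one)"

text \<open>On a pure tensor, \<open>s\<close> contributes the product of the two real parts and
  \<open>s'\<close> the product of the two imaginary parts. Their sum is the real part of one
  complex number times the conjugate of the other.\<close>

lemma Ecoeff_phi_half_coeff: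
  assumes "I \<subseteq> {1..16}"
  shows "Ecoeff phi I = Re (half_coeff (\<lambda>i. i \<in> I) * cnj (half_coeff (\<lambda>i. 8 + i \<in> I)))"
proof -
  let ?K = "filter (\<lambda>i. i \<in> I) [1..<9]" and ?L = "filter (\<lambda>i. 8 + i \<in> I) [1..<9]"
  \<comment> \<open>\<open>nu8\<close> is symmetric and fixes the first summand, so its powers
    disappear in inner products with \<open>inl x\<close>.\<close>
  have nu: "inl x \<bullet> ((*v) nu8 ^^ n) p = inl x \<bullet> p" for x n p
    by (induction n arbitrary: p) (simp_all add: nu8_symmetric[symmetric] nu8_inl)
  have "Eprod I *v spinor_s = tensor_vec (act ?K spinor_one) (((*v) nu8 ^^ length ?K) (act ?L spinor_one))"
    unfolding Eprod_def sorted_list_of_set_filter[OF assms] map_append mat_prod_list_append spinor_s_eq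
    by (subst matrix_vector_mul_assoc[symmetric], subst E_list_hi, force, subst E_list_lo) auto
  then show ?thesis
    by (simp add: Ecoeff_phi[OF assms] spinor_s_eq inner_add_left inner_tensor nu half_coeff_def)
qed

text \<open>The signs on the second \<open>real^8\<close> are opposite to those on the first: \<open>s + s'\<close> is the real part of
  \<open>(e1+ + \<i> e2+) \<otimes> (e1+ - \<i> e2+)\<close>.\<close>

definition eps :: "nat \<Rightarrow> real" where
  "eps j = (if j \<in> {0, 3, 5, 6} then 1 else -1)"

text \<open>If exactly one index is taken from some of the four planes but not from all,
  \<open>spinor_one\<close> is sent to a vector orthogonal to the span of \<open>spinor_one\<close>
  and \<open>spinor_i\<close>. The proof evaluates all 256 words from the multiplication
  table.\<close>

lemma half_coeff_eq:
  "half_coeff P =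
    (if (\<forall>j<4. P (2 * j + 1) = P (2 * j + 2)) \<or> (\<forall>j<4. P (2 * j + 1) \<noteq> P (2 * j + 2))
     then \<Prod>j<4. if P (2 * j + 2) then \<i> * eps j else 1 else 0)"
proof -
  have all4: "(\<forall>j<4. Q j) \<longleftrightarrow> Q 0 \<and> Q 1 \<and> Q 2 \<and> Q (3 :: nat)" for Q
    by (auto simp: less_Suc_eq numeral_eq_Suc)
  have prod4: "prod f {..<4 :: nat} = f 0 * f 1 * f 2 * f 3" for f :: "nat \<Rightarrow> complex"
    by (simp add: numeral_eq_Suc)
  have one: "spinor_one = inl (vector [1, 0, 0, 0, 0, 0, 0, 0])" and i: "spinor_i = inl (vector [0, 1, 0, 0, 0, 0, 0, 0])"
    by (simp_all add: oct_basis_eq)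
  note simps = act_simps cl8_oct_basis inl_simps(3)[symmetric] inr_simps(3)[symmetric]
    inner_vec_def[where 'b = 8] sum_8 complex_eq_iff eps_def
  have "half_coeff P =
    (if ((P (Suc 0) = P 2) \<and> (P 3 = P 4) \<and> (P 5 = P 6) \<and> (P 7 = P 8)) \<or>
       ((P (Suc 0) \<noteq> P 2) \<and> (P 3 \<noteq> P 4) \<and> (P 5 \<noteq> P 6) \<and> (P 7 \<noteq> P 8))
     then (if P 2 then \<i> else 1) * (if P 4 then - \<i> else 1) * (if P 6 then - \<i> else 1) * (if P 8 then \<i> else 1) else 0)"
    unfolding half_coeff_def upt_1_9 one i
    by (cases "P 8"; cases "P 7"; cases "P 6"; cases "P 5"; cases "P 4"; cases "P 3"; cases "P 2"; cases "P (Suc 0)")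
      (simp_all add: simps)
  then show ?thesis
    unfolding all4 prod4 by (simp add: numeral_2_eq_2[symmetric] eps_def)
qed

text \<open>Encoding of index sets by coordinate planes, numbered from 0. The planes met in exactly
  one index form the symmetric difference of \<open>A\<close> and \<open>B\<close>, those met in
  both indices form the intersection.\<close>

definition pairset :: "nat set \<Rightarrow> nat set \<Rightarrow> nat set" where
  "pairset A B = (\<lambda>j. 2 * j + 1) ` A \<union> (\<lambda>j. 2 * j + 2) ` B"

lemma mem_pairset: "2 * j + 1 \<in> pairset A B \<longleftrightarrow> j \<in> A" "2 * j + 2 \<in> pairset A B \<longleftrightarrow> j \<in> B"
  by (auto simp: pairset_def) presburger+

lemma pairset_subset:
  assumes "A \<subseteq> {..<8}" "B \<subseteq> {..<8}"
  shows "pairset A B \<subseteq> {1..16}"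
  using assms by (force simp: pairset_def)

lemma card_pairset:
  assumes "finite A" "finite B"
  shows "card (pairset A B) = card A + card B"
proof -
  have "(\<lambda>j. 2 * j + 1) ` A \<inter> (\<lambda>j. 2 * j + 2) ` B = {}"
    by auto presburger
  then show ?thesis
    using assms by (simp add: pairset_def card_Un_disjoint card_image inj_on_def)
qed

lemma pairset_exhaust:
  assumes "I \<subseteq> {1..16}"
  shows "I = pairset {j. j < 8 \<and> 2 * j + 1 \<in> I} {j. j < 8 \<and> 2 * j + 2 \<in> I}" (is "I = ?R")
proof (intro equalityI subsetI)
  fix i assume i: "i \<in> I"
  then have bounds: "1 \<le> i" "i \<le> 16" using assms by auto
  show "i \<in> ?R"
  proof (cases "even i")
    case True
    then obtain j where "i = 2 * j + 2" using bounds by (metis dvd_def le_add_diff_inverse2 mult_Suc_right not_one_le_zero add.commute nat.exhaust mult_0_right)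
    then show ?thesis using i bounds by (simp add: mem_pairset del: add_2_eq_Suc')
  next
    case False
    then obtain j where "i = 2 * j + 1" by (elim oddE)
    then show ?thesis using i bounds by (simp add: mem_pairset del: Suc_eq_plus1 One_nat_def add_Suc_right)
  qed
next
  fix i assume "i \<in> ?R"
  then show "i \<in> I" by (auto simp: pairset_def)
qed

abbreviation symm_diff :: "'a set \<Rightarrow> 'a set \<Rightarrow> 'a set" where
  "symm_diff A B \<equiv> (A - B) \<union> (B - A)"

definition supports :: "nat set set" where
  "supports = {{}, {..<4}, {4..<8}, {..<8}}"

lemma Ecoeff_phi_pairset:
  assumes "A \<subseteq> {..<8}" "B \<subseteq> {..<8}"
  shows "Ecoeff phi (pairset A B) = (if symm_diff A B \<in> supports then Re (\<Prod>j\<in>B. \<i> * eps j) else 0)"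
proof -
  let ?f = "\<lambda>j. if j \<in> B then \<i> * eps j else 1"
  have lo: "half_coeff (\<lambda>i. i \<in> pairset A B) =
    (if (\<forall>j<4. (j \<in> A) = (j \<in> B)) \<or> (\<forall>j<4. (j \<in> A) \<noteq> (j \<in> B)) then \<Prod>j<4. ?f j else 0)"
    by (simp only: half_coeff_eq mem_pairset)
  have shift: "8 + (2 * j + 1) = 2 * (4 + j) + 1" "8 + (2 * j + 2) = 2 * (4 + j) + 2" for j :: nat
    by simp_all
  \<comment> \<open>Since \<open>eps (4 + j) = - eps j\<close>, the conjugate in the second half
    coefficient turns the signs of the first four planes into those of the last four.\<close>
  have "cnj (if 4 + j \<in> B then \<i> * eps j else 1) = ?f (4 + j)" if "j < 4" for j
    using that by (auto simp: eps_def less_Suc_eq numeral_eq_Suc)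
  then have "cnj (\<Prod>j<4. if 4 + j \<in> B then \<i> * eps j else 1) = (\<Prod>j<4. ?f (4 + j))"
    unfolding cnj_prod by (intro prod.cong) auto
  also have "\<dots> = (\<Prod>j\<in>{4..<8}. ?f j)"
    by (rule prod.reindex_bij_witness[of _ "\<lambda>j. j - 4" "\<lambda>j. 4 + j"]) auto
  finally have hi: "cnj (half_coeff (\<lambda>i. 8 + i \<in> pairset A B)) =
    (if (\<forall>j<4. (4 + j \<in> A) = (4 + j \<in> B)) \<or> (\<forall>j<4. (4 + j \<in> A) \<noteq> (4 + j \<in> B)) then \<Prod>j\<in>{4..<8}. ?f j else 0)"
    by (simp only: half_coeff_eq shift mem_pairset if_distrib[of cnj] complex_cnj_zero)
  have ball: "(\<forall>j<4. Q (4 + j)) \<longleftrightarrow> (\<forall>j\<in>{4..<8}. Q j)" for Q :: "nat \<Rightarrow> bool"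
  proof
    assume *: "\<forall>j<4. Q (4 + j)"
    show "\<forall>j\<in>{4..<8}. Q j"
    proof
      fix j :: nat assume "j \<in> {4..<8}"
      then have "j - 4 < 4" "4 + (j - 4) = j" by auto
      then show "Q j" using spec[OF *, of "j - 4"] by simp
    qed
  qed simp
  have split: "{..<8 :: nat} = {..<4} \<union> {4..<8}" by auto
  have "(\<Prod>j<4. ?f j) * (\<Prod>j\<in>{4..<8}. ?f j) = (\<Prod>j<8. ?f j)"
    unfolding split by (subst prod.union_disjoint) auto
  also have "\<dots> = (\<Prod>j\<in>B. \<i> * eps j)"
    by (rule prod.mono_neutral_cong_right) (use assms in auto)
  finally have prod: "(\<Prod>j<4. ?f j) * (\<Prod>j\<in>{4..<8}. ?f j) = (\<Prod>j\<in>B. \<i> * eps j)" .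
  define H where "H = symm_diff A B"
  have H: "H \<subseteq> {..<8}" using assms by (auto simp: H_def)
  have c: "(\<forall>j<4. (j \<in> A) = (j \<in> B)) \<longleftrightarrow> H \<inter> {..<4} = {}" "(\<forall>j<4. (j \<in> A) \<noteq> (j \<in> B)) \<longleftrightarrow> {..<4} \<subseteq> H"
    "(\<forall>j\<in>{4..<8}. (j \<in> A) = (j \<in> B)) \<longleftrightarrow> H \<inter> {4..<8} = {}" "(\<forall>j\<in>{4..<8}. (j \<in> A) \<noteq> (j \<in> B)) \<longleftrightarrow> {4..<8} \<subseteq> H"
    by (auto simp: H_def)
  have disj: "{..<4} \<inter> {4..<8::nat} = {}" by auto
  \<comment> \<open>Membership in \<open>supports\<close> is a separate condition on each half, as
    the two half coefficients impose it.\<close>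
  have sup: "H \<in> supports \<longleftrightarrow> (H \<inter> {..<4} = {} \<or> {..<4} \<subseteq> H) \<and> (H \<inter> {4..<8} = {} \<or> {4..<8} \<subseteq> H)"
    using H disj unfolding supports_def split by blast
  show ?thesis
    unfolding Ecoeff_phi_half_coeff[OF pairset_subset[OF assms]] lo hi
      ball[of "\<lambda>j. (j \<in> A) = (j \<in> B)"] ball[of "\<lambda>j. (j \<in> A) \<noteq> (j \<in> B)"] c H_def[symmetric] sup
    by (simp add: prod[symmetric])
qed

definition phi_pairs :: "nat \<Rightarrow> (nat set \<times> nat set) set" where
  "phi_pairs k = {(A, B). A \<subseteq> {..<8} \<and> B \<subseteq> {..<8} \<and> card A + card B = k \<and> symm_diff A B \<in> supports}"

lemma component_phi_pairs:
  "component k phi v = (\<Sum>(A, B)\<in>phi_pairs k. Re (\<Prod>j\<in>B. \<i> * eps j) * dx (pairset A B) v)"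
proof -
  let ?S = "{(A, B). A \<subseteq> {..<8 :: nat} \<and> B \<subseteq> {..<8 :: nat} \<and> card A + card B = k}"
  have fin: "finite ?S"
    by (rule finite_subset[of _ "Pow {..<8} \<times> Pow {..<8}"]) auto
  have "component k phi v = (\<Sum>(A, B)\<in>?S. Ecoeff phi (pairset A B) * dx (pairset A B) v)"
    unfolding component_def
  proof (rule sum.reindex_bij_witness[of _ "\<lambda>(A, B). pairset A B"
        "\<lambda>I. ({j. j < 8 \<and> 2 * j + 1 \<in> I}, {j. j < 8 \<and> 2 * j + 2 \<in> I})"])
    fix I assume I: "I \<in> index_sets k"
    let ?A = "{j. j < 8 \<and> 2 * j + 1 \<in> I}" and ?B = "{j. j < 8 \<and> 2 * j + 2 \<in> I}"
    have eq: "pairset ?A ?B = I"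
      using pairset_exhaust[OF index_setsD(1)[OF I]] by (rule sym)
    then show "(case (?A, ?B) of (A, B) \<Rightarrow> pairset A B) = I"
      by (simp only: prod.case)
    have "card ?A + card ?B = card (pairset ?A ?B)"
      by (rule card_pairset[symmetric]) simp_all
    then show "(?A, ?B) \<in> ?S"
      unfolding eq using index_setsD(3)[OF I] by (simp only: mem_Collect_eq prod.case) auto
    show "(case (?A, ?B) of (A, B) \<Rightarrow> Ecoeff phi (pairset A B) * dx (pairset A B) v) = Ecoeff phi I * dx I v"
      by (simp only: prod.case eq)
  next
    fix p assume p: "p \<in> ?S"
    obtain A B where AB: "p = (A, B)" by (cases p)
    have fin: "finite A" "finite B" and sub: "A \<subseteq> {..<8}" "B \<subseteq> {..<8}"
      using p finite_subset[of _ "{..<8::nat}"] by (auto simp: AB)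
    show "({j. j < 8 \<and> 2 * j + 1 \<in> (case p of (A, B) \<Rightarrow> pairset A B)},
        {j. j < 8 \<and> 2 * j + 2 \<in> (case p of (A, B) \<Rightarrow> pairset A B)}) = p"
      unfolding AB prod.case mem_pairset using sub by auto
    show "(case p of (A, B) \<Rightarrow> pairset A B) \<in> index_sets k"
      using p card_pairset[OF fin] pairset_subset[OF sub] by (simp add: AB index_sets_def)
  qed
  also have "\<dots> = (\<Sum>(A, B)\<in>phi_pairs k. Re (\<Prod>j\<in>B. \<i> * eps j) * dx (pairset A B) v)"
    by (rule sum.mono_neutral_cong_right[OF fin]) (auto simp: phi_pairs_def Ecoeff_phi_pairset split: if_splits)
  finally show ?thesis .
qed

lemma even_card_supports: "H \<in> supports \<Longrightarrow> even (card H)"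
  by (auto simp: supports_def)

text \<open>The degree \<open>card A + card B\<close> has the parity of the size of the symmetric
  difference, and all \<open>supports\<close> have even size.\<close>

lemma component_phi_odd:
  assumes "odd k"
  shows "component k phi = (\<lambda>_. 0)"
proof
  fix v
  have "phi_pairs k = {}"
  proof (intro equals0I, unfold phi_pairs_def, clarify)
    fix A B :: "nat set"
    assume *: "A \<subseteq> {..<8}" "B \<subseteq> {..<8}" "k = card A + card B" "symm_diff A B \<in> supports"
    have fin: "finite A" "finite B" using * finite_subset by blast+
    note card_Int_Diff[OF fin(1), of B] card_Int_Diff[OF fin(2), of A, unfolded Int_commute[of B]]
    moreover have "card (symm_diff A B) = card (A - B) + card (B - A)"
      using fin by (intro card_Un_disjoint) auto
    moreover have "even (card (symm_diff A B))"
      using *(4) by (rule even_card_supports)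
    ultimately show False using assms *(3) by presburger
  qed
  then show "component k phi v = 0"
    unfolding component_phi_pairs by simp
qed

lemma component_phi_0: "component 0 phi = (\<lambda>_. 1)"
proof
  fix v
  have "A = {}" if "A \<subseteq> {..<8}" "card A = 0" for A :: "nat set"
    using that finite_subset[OF that(1)] by simp
  then have "phi_pairs 0 = {({}, {})}"
    by (auto simp: supports_def phi_pairs_def)
  then show "component 0 phi v = 1"
    unfolding component_phi_pairs by (simp add: dx_def pairset_def)
qed

lemma component_phi_16: "component 16 phi = volume_form"
proof
  fix v
  have full: "A = {..<8} \<and> B = {..<8}" if "A \<subseteq> {..<8}" "B \<subseteq> {..<8}" "card A + card B = 16" for A B :: "nat set"
  proof -
    have "card A \<le> 8" "card B \<le> 8"
      using card_mono[OF _ that(1)] card_mono[OF _ that(2)] by auto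
    then have "card A = card {..<8::nat}" "card B = card {..<8::nat}" using that by auto
    with that show ?thesis by (metis card_subset_eq finite_lessThan)
  qed
  have "phi_pairs 16 = {({..<8}, {..<8})}"
    using full by (auto simp: supports_def phi_pairs_def)
  moreover have "pairset {..<8} {..<8} = {1..16}"
  proof (rule card_subset_eq)
    show "pairset {..<8} {..<8} \<subseteq> {1..16}" by (rule pairset_subset) simp_all
  qed (simp_all add: card_pairset)
  \<comment> \<open>Eight factors \<open>\<i>\<close> multiply to 1, and four of the eight signs are
    negative.\<close>
  moreover have "(\<Prod>j<8. \<i> * eps j) = 1"
    by (simp add: numeral_eq_Suc eps_def)
  ultimately show "component 16 phi v = volume_form v"
    unfolding component_phi_pairs volume_form_def by simp
qed

section \<open>Forms adapted to the complex structure\<close>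

lemma det_form_swap: "det_form (xs @ a # b # ys) v = - det_form (xs @ b # a # ys) v"
proof -
  let ?t = "Transposition.transpose (length xs) (Suc (length xs))"
  let ?l = "xs @ b # a # ys"
  have t: "?t permutes {..<length ?l}"
    by (rule permutes_swap_id) simp_all
  have "permute_list ?t ?l = xs @ a # b # ys"
  proof (rule nth_equalityI)
    fix i assume "i < length (permute_list ?t ?l)"
    then have i: "i < length ?l" by simp
    consider "i < length xs" | "i = length xs" | "i = Suc (length xs)" | k where "i = length xs + Suc (Suc k)"
      by (metis add_Suc_right less_natE linorder_neqE_nat Suc_lessI)
    then show "permute_list ?t ?l ! i = (xs @ a # b # ys) ! i"
      unfolding permute_list_nth[OF t i] by cases (simp_all add: nth_append Transposition.transpose_def)
  qed simp
  then show ?thesis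
    using det_form_permute[OF t, of v] by (simp add: sign_swap_id)
qed

lemma det_form_move: "det_form (xs @ ys @ a # zs) v = (-1) ^ length ys * det_form (xs @ a # ys @ zs) v"
proof (induction ys arbitrary: xs)
  case (Cons y ys)
  have "det_form (xs @ (y # ys) @ a # zs) v = det_form ((xs @ [y]) @ ys @ a # zs) v" by simp
  also have "\<dots> = (-1) ^ length ys * det_form (xs @ y # a # ys @ zs) v"
    unfolding Cons.IH by simp
  also have "det_form (xs @ y # a # ys @ zs) v = - det_form (xs @ a # y # ys @ zs) v"
    by (rule det_form_swap)
  finally show ?case by simp
qed simp

text \<open>Two adjacent one-forms pass a block of the list with the same sign each, so together
  with none.\<close>

lemma det_form_move_pair: "det_form (xs @ ys @ a # b # zs) v = det_form (xs @ a # b # ys @ zs) v"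
proof -
  have "det_form (xs @ ys @ a # b # zs) v = (-1) ^ length ys * det_form ((xs @ [a]) @ ys @ b # zs) v"
    by (simp add: det_form_move)
  also have "\<dots> = (-1) ^ length ys * ((-1) ^ length ys * det_form (xs @ a # b # ys @ zs) v)"
    by (subst det_form_move) simp
  also have "\<dots> = det_form (xs @ a # b # ys @ zs) v"
    by (simp add: mult.assoc[symmetric] power_add[symmetric])
  finally show ?thesis .
qed

definition pair_block :: "nat set \<Rightarrow> nat set \<Rightarrow> nat \<Rightarrow> nat list" where
  "pair_block A B j = (if j \<in> A then [2 * j + 1] else []) @ (if j \<in> B then [2 * j + 2] else [])"

text \<open>For \<open>js = [0..<8]\<close> this is the increasing enumeration of
  \<open>pairset A B\<close>, cut into one block per plane; a general \<open>js\<close> is there for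
  induction.\<close>

definition pair_list :: "nat set \<Rightarrow> nat set \<Rightarrow> nat list \<Rightarrow> nat list" where
  "pair_list A B js = concat (map (pair_block A B) js)"

lemma pair_list_simps [simp]:
  "pair_list A B [] = []" "pair_list A B (j # js) = pair_block A B j @ pair_list A B js"
  "pair_list A B (js @ ks) = pair_list A B js @ pair_list A B ks"
  by (simp_all add: pair_list_def)

lemma set_pair_list: "set (pair_list A B js) = pairset (A \<inter> set js) (B \<inter> set js)"
  by (induction js) (auto simp: pair_block_def pairset_def)

text \<open>The bound on the entries is carried along so that the next block can be
  appended.\<close>

lemma sorted_pair_list: "sorted_wrt (<) (pair_list A B [0..<n]) \<and> (\<forall>x\<in>set (pair_list A B [0..<n]). x \<le> 2 * n)"
proof (induction n)
  case (Suc n)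
  have "x < y" if "x \<in> set (pair_list A B [0..<n])" "y \<in> set (pair_block A B n)" for x y
  proof -
    have "x \<le> 2 * n" using Suc that by blast
    moreover have "2 * n < y" using that(2) by (auto simp: pair_block_def split: if_splits)
    ultimately show ?thesis by simp
  qed
  moreover have "sorted_wrt (<) (pair_block A B n)" "\<forall>x\<in>set (pair_block A B n). x \<le> 2 * Suc n"
    by (auto simp: pair_block_def)
  ultimately show ?case
    using Suc by (auto simp: sorted_wrt_append)
qed simp

lemma sorted_list_of_pairset:
  assumes "A \<subseteq> {..<8}" "B \<subseteq> {..<8}"
  shows "sorted_list_of_set (pairset A B) = pair_list A B [0..<8]"
proof (rule sorted_distinct_set_unique)
  have "sorted (pair_list A B [0..<8]) \<and> distinct (pair_list A B [0..<8])"
    using sorted_pair_list[of A B 8] by (simp add: strict_sorted_iff)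
  then show "sorted (pair_list A B [0..<8])" "distinct (pair_list A B [0..<8])" by simp_all
  have "A \<inter> set [0..<8] = A" "B \<inter> set [0..<8] = B" using assms by auto
  then show "set (sorted_list_of_set (pairset A B)) = set (pair_list A B [0..<8])"
    using finite_subset[OF pairset_subset[OF assms]] by (simp only: set_pair_list) simp
qed simp_all

lemma dx_pairset:
  assumes "A \<subseteq> {..<8}" "B \<subseteq> {..<8}"
  shows "dx (pairset A B) = det_form (map coord (pair_list A B [0..<8]))"
  by (simp only: dx_eq sorted_list_of_pairset[OF assms])

text \<open>The complete planes of \<open>Q\<close> are moved one at a time to their place in the
  sorted list, without sign since they travel as pairs. The prefix \<open>xs\<close> holds the
  planes already done.\<close>

lemma det_form_merge:
  assumes "Q \<inter> (A \<union> B) = {}"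
  shows "det_form (map coord (xs @ pair_list A B js @ pair_list Q Q js)) v =
    det_form (map coord (xs @ pair_list (A \<union> Q) (B \<union> Q) js)) v"
proof (induction js arbitrary: xs)
  case (Cons j js)
  show ?case
  proof (cases "j \<in> Q")
    case True
    then have "pair_block A B j = []" "pair_block Q Q j = [2 * j + 1, 2 * j + 2]"
      "pair_block (A \<union> Q) (B \<union> Q) j = [2 * j + 1, 2 * j + 2]"
      using assms by (auto simp: pair_block_def)
    then show ?thesis
      using Cons.IH[of "xs @ [2 * j + 1, 2 * j + 2]"]
        det_form_move_pair[of "map coord xs" "map coord (pair_list A B js)" "coord (2 * j + 1)" "coord (2 * j + 2)"
          "map coord (pair_list Q Q js)" v]
      by simp
  next
    case False
    then have "pair_block Q Q j = []" "pair_block (A \<union> Q) (B \<union> Q) j = pair_block A B j"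
      by (auto simp: pair_block_def)
    then show ?thesis
      using Cons.IH[of "xs @ pair_block A B j"] by simp
  qed
qed simp

text \<open>A plane of \<open>Q\<close> that meets \<open>A \<union> B\<close> repeats a coordinate
  and kills the product; otherwise the lists merge without sign.\<close>

lemma wedge_dx_pairset:
  assumes A: "A \<subseteq> {..<8}" and B: "B \<subseteq> {..<8}" and Q: "Q \<subseteq> {..<8}"
    and k: "k = card A + card B" and l: "l = 2 * card Q"
  shows "wedge k l (dx (pairset A B)) (dx (pairset Q Q)) =
    (if Q \<inter> (A \<union> B) = {} then dx (pairset (A \<union> Q) (B \<union> Q)) else (\<lambda>_. 0))"
proof -
  let ?xs = "pair_list A B [0..<8]" and ?ys = "pair_list Q Q [0..<8]"
  have fin: "finite A" "finite B" "finite Q" using A B Q finite_subset by blast+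
  have "length ?xs = k" "length ?ys = l"
    unfolding sorted_list_of_pairset[OF A B, symmetric] sorted_list_of_pairset[OF Q Q, symmetric]
    by (simp_all add: card_pairset fin k l)
  then have wedge: "wedge k l (dx (pairset A B)) (dx (pairset Q Q)) = det_form (map coord (?xs @ ?ys))"
    using wedge_det_form[of "map coord ?xs" "map coord ?ys"]
    unfolding dx_pairset[OF A B] dx_pairset[OF Q Q] by simp
  show ?thesis
  proof (cases "Q \<inter> (A \<union> B) = {}")
    case True
    have "A \<union> Q \<subseteq> {..<8}" "B \<union> Q \<subseteq> {..<8}" using A B Q by auto
    then have "det_form (map coord (?xs @ ?ys)) = dx (pairset (A \<union> Q) (B \<union> Q))"
      using det_form_merge[OF True, of "[]" "[0..<8]"] by (simp add: dx_pairset fun_eq_iff)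
    then show ?thesis
      unfolding wedge if_P[OF True] .
  next
    case False
    then obtain j where j: "j \<in> Q" "j \<in> A \<or> j \<in> B" "j < 8" using Q by auto
    have "A \<inter> set [0..<8] = A" "B \<inter> set [0..<8] = B" "Q \<inter> set [0..<8] = Q" using A B Q by auto
    then have "set ?xs \<inter> set ?ys \<noteq> {}"
      unfolding set_pair_list using j by (auto simp: pairset_def)
    then have "\<not> distinct (map coord (?xs @ ?ys))"
      by (auto simp: distinct_map)
    then show ?thesis
      unfolding wedge if_not_P[OF False] by (intro ext det_form_eq_0)
  qed
qed

section \<open>The Kaehler form and its powers\<close>

lemma det_form_pair: "det_form [f, g] v = f (v 0) * g (v 1) - f (v 1) * g (v 0)"
proof -
  have "{p. p permutes {..<2}} = {id, Transposition.transpose 0 (1 :: nat)}"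
    by (auto simp: lessThan_nat_numeral lessThan_Suc permutes_doubleton_iff insert_commute)
  moreover have "id \<noteq> Transposition.transpose 0 (1 :: nat)"
    by (metis id_apply transpose_apply_first zero_neq_one)
  ultimately show ?thesis
    by (simp add: det_form_def sign_swap_id numeral_2_eq_2)
qed

lemma kaehler_form_cplx:
  "kaehler_form cplx = (\<lambda>v. \<Sum>j\<in>{..<8}. eps j * dx (pairset {j} {j}) v)"
proof
  fix v
  have "dx (pairset {j} {j}) v = coord (2 * j + 1) (v 0) * coord (2 * j + 2) (v 1) - coord (2 * j + 1) (v 1) * coord (2 * j + 2) (v 0)"
    if "j \<in> {..<8}" for j
  proof -
    have "sorted_list_of_set (pairset {j} {j}) = [2 * j + 1, 2 * j + 2]"
      by (rule sorted_distinct_set_unique) (auto simp: pairset_def)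
    then show ?thesis by (simp add: dx_eq det_form_pair)
  qed
  then have "(\<Sum>j\<in>{..<8}. eps j * dx (pairset {j} {j}) v) =
    (\<Sum>j\<in>{..<8}. eps j * (coord (2 * j + 1) (v 0) * coord (2 * j + 2) (v 1) - coord (2 * j + 1) (v 1) * coord (2 * j + 2) (v 0)))"
    by (intro sum.cong refl) simp
  moreover have "{..<8 :: nat} = {0, 1, 2, 3, 4, 5, 6, 7}" by auto
  then have "kaehler_form cplx v =
    (\<Sum>j\<in>{..<8}. eps j * (coord (2 * j + 1) (v 0) * coord (2 * j + 2) (v 1) - coord (2 * j + 1) (v 1) * coord (2 * j + 2) (v 0)))"
    by (simp add: kaehler_form_def hprod_def inner_vec_def sum_16 cplx_def eps_def coord_def numeral_2_eq_2[symmetric]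
      algebra_simps)
  ultimately show "kaehler_form cplx v = (\<Sum>j\<in>{..<8}. eps j * dx (pairset {j} {j}) v)"
    by (simp only:)
qed

abbreviation subsets :: "nat \<Rightarrow> nat set set" where
  "subsets n \<equiv> {Q. Q \<subseteq> {..<8} \<and> card Q = n}"

text \<open>The divided power \<open>\<omega> ^ n / n!\<close>, by
  \<open>wedge_power_kaehler\<close>.\<close>

definition theta :: "nat \<Rightarrow> (real^16, real) form" where
  "theta n v = (\<Sum>Q\<in>subsets n. prod eps Q * dx (pairset Q Q) v)"

lemma finite_subsets: "finite (subsets n)"
  by (rule finite_subset[of _ "Pow {..<8}"]) auto

text \<open>Wedging with the plane \<open>j\<close> adds it to \<open>Q\<close> if it is new and
  gives 0 otherwise. Each set of \<open>Suc n\<close> planes arises from \<open>Suc n\<close>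
  choices of the added one.\<close>

lemma wedge_kaehler_theta: "wedge 2 (2 * n) (kaehler_form cplx) (theta n) v = real (Suc n) * theta (Suc n) v"
proof -
  let ?f = "\<lambda>Q. prod eps Q * dx (pairset Q Q) v"
  have fin: "finite Q" if "Q \<in> subsets k" for Q k using that finite_subset[of Q "{..<8}"] by simp
  have "wedge 2 (2 * n) (kaehler_form cplx) (theta n) v =
    (\<Sum>j\<in>{..<8}. \<Sum>Q\<in>subsets n. eps j * (prod eps Q * wedge 2 (2 * n) (dx (pairset {j} {j})) (dx (pairset Q Q)) v))"
    unfolding kaehler_form_cplx theta_def[abs_def] wedge_sum_left wedge_sum_right sum_distrib_left ..
  also have "\<dots> = (\<Sum>j\<in>{..<8}. \<Sum>Q\<in>subsets n. if j \<notin> Q then ?f (insert j Q) else 0)"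
  proof (intro sum.cong refl)
    fix j Q assume j: "j \<in> {..<8 :: nat}" and Q: "Q \<in> subsets n"
    have "wedge 2 (2 * n) (dx (pairset {j} {j})) (dx (pairset Q Q)) =
      (if Q \<inter> ({j} \<union> {j}) = {} then dx (pairset ({j} \<union> Q) ({j} \<union> Q)) else (\<lambda>_. 0))"
      by (rule wedge_dx_pairset) (use j Q in auto)
    then show "eps j * (prod eps Q * wedge 2 (2 * n) (dx (pairset {j} {j})) (dx (pairset Q Q)) v) =
      (if j \<notin> Q then ?f (insert j Q) else 0)"
      using fin[OF Q] by (simp add: mult.assoc)
  qed
  also have "\<dots> = (\<Sum>(j, Q)\<in>{..<8} \<times> subsets n. if j \<notin> Q then ?f (insert j Q) else 0)"
    by (rule sum.cartesian_product)
  also have "\<dots> = (\<Sum>(j, Q)\<in>{(j, Q). j < 8 \<and> Q \<in> subsets n \<and> j \<notin> Q}. ?f (insert j Q))"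
    by (rule sum.mono_neutral_cong_right) (auto intro!: finite_cartesian_product finite_subsets)
  \<comment> \<open>Reindex by the enlarged set together with the element that was added to
    it.\<close>
  also have "\<dots> = (\<Sum>(Q, j)\<in>Sigma (subsets (Suc n)) id. ?f Q)"
  proof (rule sum.reindex_bij_witness[of _ "\<lambda>(Q, j). (j, Q - {j})" "\<lambda>(j, Q). (insert j Q, j)"])
    fix p assume "p \<in> {(j, Q). j < 8 \<and> Q \<in> subsets n \<and> j \<notin> Q}"
    then obtain j Q where p: "p = (j, Q)" "j < 8" "Q \<in> subsets n" "j \<notin> Q" by auto
    have "insert j Q - {j} = Q" using p(4) by simp
    then show "(case case p of (j, Q) \<Rightarrow> (insert j Q, j) of (Q, j) \<Rightarrow> (j, Q - {j})) = p"
      by (simp only: p(1) prod.case)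
    have "insert j Q \<in> subsets (Suc n)" using p fin[OF p(3)] by simp
    then show "(case p of (j, Q) \<Rightarrow> (insert j Q, j)) \<in> Sigma (subsets (Suc n)) id"
      unfolding p(1) prod.case by (intro SigmaI) simp_all
    show "(case case p of (j, Q) \<Rightarrow> (insert j Q, j) of (Q, j) \<Rightarrow> ?f Q) = (case p of (j, Q) \<Rightarrow> ?f (insert j Q))"
      unfolding p(1) prod.case ..
  next
    fix p assume "p \<in> Sigma (subsets (Suc n)) id"
    then obtain j Q where p: "p = (Q, j)" "Q \<in> subsets (Suc n)" "j \<in> Q" by auto
    have "insert j (Q - {j}) = Q" using p(3) by blast
    then show "(case case p of (Q, j) \<Rightarrow> (j, Q - {j}) of (j, Q) \<Rightarrow> (insert j Q, j)) = p"
      by (simp only: p(1) prod.case)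
    have "j < 8" "Q - {j} \<subseteq> {..<8}" using p(2,3) by auto
    moreover have "card (Q - {j}) = n" using p(2,3) fin[OF p(2)] by simp
    ultimately show "(case p of (Q, j) \<Rightarrow> (j, Q - {j})) \<in> {(j, Q). j < 8 \<and> Q \<in> subsets n \<and> j \<notin> Q}"
      unfolding p(1) by simp
  qed
  also have "\<dots> = (\<Sum>Q\<in>subsets (Suc n). \<Sum>j\<in>id Q. ?f Q)"
  proof (rule sum.Sigma[symmetric, OF finite_subsets], rule ballI)
    show "finite (id Q)" if "Q \<in> subsets (Suc n)" for Q
      using fin[OF that] by (simp only: id_apply)
  qed
  also have "\<dots> = (\<Sum>Q\<in>subsets (Suc n). real (Suc n) * ?f Q)"
  proof (intro sum.cong refl)
    fix Q assume "Q \<in> subsets (Suc n)"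
    then have "card Q = Suc n" by simp
    then show "(\<Sum>j\<in>id Q. ?f Q) = real (Suc n) * ?f Q" by (simp only: id_apply sum_constant)
  qed
  also have "\<dots> = real (Suc n) * theta (Suc n) v"
    by (simp only: theta_def sum_distrib_left)
  finally show ?thesis .
qed

lemma wedge_scale_right: "wedge k l \<alpha> (\<lambda>v. c * \<beta> v) = (\<lambda>v. c * wedge k l \<alpha> \<beta> v)"
  using wedge_sum_right[of k l \<alpha> "\<lambda>_. c" "\<lambda>_. \<beta>" "{()}"] by simp

lemma wedge_power_kaehler: "wedge_power 2 (kaehler_form cplx) n = (\<lambda>v. fact n * theta n v)"
proof (induction n)
  case 0
  have "subsets 0 = {{}}" using finite_subset[of _ "{..<8::nat}"] by (auto simp: card_eq_0_iff)
  then show ?case by (simp add: theta_def pairset_def dx_def)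
next
  case (Suc n)
  show ?case
    by (simp only: wedge_power.simps Suc.IH wedge_scale_right wedge_kaehler_theta fact_Suc) (simp add: mult_ac)
qed

section \<open>Expansion of the holomorphic volume forms\<close>

lemma wedge_linear_left:
  "wedge 1 n (\<lambda>v. d * (f (v 0) + c * g (v 0))) \<beta> v =
    d * (wedge 1 n (\<lambda>v. f (v 0)) \<beta> v + c * wedge 1 n (\<lambda>v. g (v 0)) \<beta> v)"
  using fun_cong[OF wedge_sum_left[of 1 n "\<lambda>k. if k then d * c else d" "\<lambda>k v. if k then g (v 0) else f (v 0)" UNIV \<beta>], of v]
  by (simp add: UNIV_bool algebra_simps)

text \<open>Distributivity: \<open>S\<close> is the set of factors contributing their
  \<open>g\<close> term. In the induction step the subsets without and with the new head correspond
  to its \<open>f\<close> and \<open>g\<close> terms.\<close>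

lemma wedge_list_expand:
  assumes "distinct js"
  shows "wedge_list (map (\<lambda>j x. d j * (f j x + c j * g j x)) js) v =
    prod d (set js) * (\<Sum>S\<in>Pow (set js). prod c S * wedge_list (map (\<lambda>j. if j \<in> S then g j else f j) js) v)"
  using assms
proof (induction js arbitrary: v)
  case (Cons j js)
  let ?w = "\<lambda>S. wedge_list (map (\<lambda>j. if j \<in> S then g j else f j) js)"
  let ?w' = "\<lambda>S. wedge_list (map (\<lambda>j. if j \<in> S then g j else f j) (j # js))"
  have j: "j \<notin> set js" and IH: "wedge_list (map (\<lambda>j x. d j * (f j x + c j * g j x)) js) =
      (\<lambda>v. prod d (set js) * (\<Sum>S\<in>Pow (set js). prod c S * ?w S v))"
    using Cons by auto
  have fj: "wedge 1 (length js) (\<lambda>v. f j (v 0)) (?w S) = ?w' S"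
    and gj: "wedge 1 (length js) (\<lambda>v. g j (v 0)) (?w S) = ?w' (insert j S)" if "S \<in> Pow (set js)" for S
  proof -
    have m: "map (\<lambda>i. if i \<in> insert j S then g i else f i) js = map (\<lambda>i. if i \<in> S then g i else f i) js"
      using j by (intro map_cong refl) auto
    have "j \<notin> S" using that j by auto
    then show "wedge 1 (length js) (\<lambda>v. f j (v 0)) (?w S) = ?w' S" by simp
    show "wedge 1 (length js) (\<lambda>v. g j (v 0)) (?w S) = ?w' (insert j S)"
      by (simp only: list.map wedge_list.simps length_map m insertI1 if_True)
  qed
  have c: "prod c (insert j S) = c j * prod c S" if "S \<in> Pow (set js)" for S
    using that j finite_subset[of S "set js"] by (subst prod.insert) auto
  have e1: "(\<Sum>S\<in>Pow (set js). prod c S * wedge 1 (length js) (\<lambda>v. f j (v 0)) (?w S) v) =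
      (\<Sum>S\<in>Pow (set js). prod c S * ?w' S v)"
    by (intro sum.cong refl) (simp only: fj)
  have e2: "c j * (\<Sum>S\<in>Pow (set js). prod c S * wedge 1 (length js) (\<lambda>v. g j (v 0)) (?w S) v) =
      (\<Sum>S\<in>Pow (set js). prod c (insert j S) * ?w' (insert j S) v)"
    unfolding sum_distrib_left by (intro sum.cong refl) (simp only: gj c mult.assoc)
  have "wedge_list (map (\<lambda>j x. d j * (f j x + c j * g j x)) (j # js)) v =
    d j * prod d (set js) * ((\<Sum>S\<in>Pow (set js). prod c S * wedge 1 (length js) (\<lambda>v. f j (v 0)) (?w S) v) +
      c j * (\<Sum>S\<in>Pow (set js). prod c S * wedge 1 (length js) (\<lambda>v. g j (v 0)) (?w S) v))"
    by (simp only: list.map wedge_list.simps length_map wedge_linear_left IH wedge_scale_right wedge_sum_right)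
      (simp add: algebra_simps sum_distrib_left sum.distrib)
  also have "\<dots> = d j * prod d (set js) * ((\<Sum>S\<in>Pow (set js). prod c S * ?w' S v) +
      (\<Sum>S\<in>Pow (set js). prod c (insert j S) * ?w' (insert j S) v))"
    by (simp only: e1 e2)
  also have "(\<Sum>S\<in>Pow (set js). prod c (insert j S) * ?w' (insert j S) v) =
      (\<Sum>S\<in>insert j ` Pow (set js). prod c S * ?w' S v)"
    by (subst sum.reindex) (use j in \<open>auto simp: inj_on_def\<close>)
  also have "(\<Sum>S\<in>Pow (set js). prod c S * ?w' S v) + (\<Sum>S\<in>insert j ` Pow (set js). prod c S * ?w' S v) =
    (\<Sum>S\<in>Pow (set (j # js)). prod c S * ?w' S v)"
    unfolding list.set Pow_insert by (rule sum.union_disjoint[symmetric]) (use j in auto)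
  also have "d j * prod d (set js) = prod d (set (j # js))"
    using j by simp
  finally show ?case .
qed simp

lemma det_form_of_real:
  "det_form (map (\<lambda>f x. complex_of_real (f x)) fs) v = of_real (det_form fs v)"
  by (simp add: det_form_def)

text \<open>The two signs make the real parts of \<open>\<Omega>1\<close> and \<open>\<Omega>2\<close> enter with the right sign; they cancel in \<open>\<Omega>\<close>.\<close>

definition zeta :: "nat \<Rightarrow> complex" where
  "zeta j = (if j \<in> {0, 4} then -1 else 1)"

definition ccoord :: "nat \<Rightarrow> real^16 \<Rightarrow> complex" where
  "ccoord j x = zeta j * (coord (2 * j + 1) x + \<i> * eps j * coord (2 * j + 2) x)"

text \<open>After distributing, each term is a real form with the coefficient
  \<open>\<Prod>j\<in>S. \<i> * eps j\<close>; the product of the \<open>zeta\<close> values is real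
  and comes out of the real part.\<close>

lemma Re_wedge_ccoord:
  assumes "m \<le> n" "n \<le> 8" and H: "H = {m..<n}" and z: "prod zeta H = of_real z"
  shows "Re (wedge_list (map ccoord [m..<n]) v) =
    z * (\<Sum>S\<in>Pow H. Re (\<Prod>j\<in>S. \<i> * eps j) * dx (pairset (H - S) S) v)"
proof -
  let ?g = "\<lambda>j x. complex_of_real (coord (2 * j + 2) x)" and ?f = "\<lambda>j x. complex_of_real (coord (2 * j + 1) x)"
  have w: "wedge_list (map (\<lambda>j. if j \<in> S then ?g j else ?f j) [m..<n]) v = of_real (dx (pairset (H - S) S) v)"
    if "S \<in> Pow H" for S
  proof -
    have S: "S \<subseteq> {m..<n}" using that H by simp
    have sub: "H - S \<subseteq> {..<8}" "S \<subseteq> {..<8}" using S assms by auto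
    have "[0..<8] = [0..<m] @ [m..<n] @ [n..<8]"
      using assms(1,2) upt_add_eq_append[of 0 m "8 - m"] upt_add_eq_append[of m n "8 - n"] by simp
    moreover have "pair_list (H - S) S [0..<m] = []" "pair_list (H - S) S [n..<8] = []"
      using S H by (auto simp: pair_list_def pair_block_def)
    \<comment> \<open>Every plane of \<open>H\<close> contributes exactly one index, so the list is
      already in increasing order and no sign arises.\<close>
    moreover have "pair_list (H - S) S js = map (\<lambda>j. if j \<in> S then 2 * j + 2 else 2 * j + 1) js" if "set js \<subseteq> H" for js
      using that by (induction js) (auto simp: pair_block_def)
    then have "pair_list (H - S) S [m..<n] = map (\<lambda>j. if j \<in> S then 2 * j + 2 else 2 * j + 1) [m..<n]"
      using H by simp
    ultimately have "pair_list (H - S) S [0..<8] = map (\<lambda>j. if j \<in> S then 2 * j + 2 else 2 * j + 1) [m..<n]"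
      by simp
    then have "dx (pairset (H - S) S) v = det_form (map (\<lambda>j. coord (if j \<in> S then 2 * j + 2 else 2 * j + 1)) [m..<n]) v"
      unfolding dx_pairset[OF sub] by (simp only: map_map o_def)
    moreover have "map (\<lambda>j. if j \<in> S then ?g j else ?f j) [m..<n] =
      map (\<lambda>f x. complex_of_real (f x)) (map (\<lambda>j. coord (if j \<in> S then 2 * j + 2 else 2 * j + 1)) [m..<n])"
      by simp
    ultimately show ?thesis
      by (simp only: wedge_list_eq_det_form det_form_of_real)
  qed
  have "wedge_list (map ccoord [m..<n]) v =
    prod zeta (set [m..<n]) * (\<Sum>S\<in>Pow (set [m..<n]). (\<Prod>j\<in>S. \<i> * eps j) * wedge_list (map (\<lambda>j. if j \<in> S then ?g j else ?f j) [m..<n]) v)"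
    unfolding ccoord_def[abs_def] by (rule wedge_list_expand) simp
  also have "set [m..<n] = H" using H by simp
  also have "(\<Sum>S\<in>Pow H. (\<Prod>j\<in>S. \<i> * eps j) * wedge_list (map (\<lambda>j. if j \<in> S then ?g j else ?f j) [m..<n]) v) =
    (\<Sum>S\<in>Pow H. (\<Prod>j\<in>S. \<i> * eps j) * of_real (dx (pairset (H - S) S) v))"
    by (intro sum.cong refl) (simp only: w)
  finally show ?thesis
    by (simp add: z)
qed

text \<open>The terms of degree 8 for which \<open>H\<close> is the set of planes met in exactly one
  index: \<open>S\<close> are the planes of \<open>H\<close> met in their even index,
  \<open>Q\<close> those met in both indices.\<close>

definition phi_part :: "nat set \<Rightarrow> (real^16, real) form" where
  "phi_part H v = (\<Sum>S\<in>Pow H. \<Sum>Q\<in>{Q. Q \<subseteq> {..<8} - H \<and> 2 * card Q + card H = 8}.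
     Re (\<Prod>j\<in>S \<union> Q. \<i> * eps j) * dx (pairset ((H - S) \<union> Q) (S \<union> Q)) v)"

text \<open>Terms are grouped by the symmetric difference \<open>H\<close> of \<open>A\<close> and
  \<open>B\<close>; then \<open>S = B - A\<close> and \<open>Q = A \<inter> B\<close> determine the
  pair.\<close>

lemma component_phi_8_parts: "component 8 phi v = (\<Sum>H\<in>supports. phi_part H v)"
proof -
  let ?g = "\<lambda>(A, B). Re (\<Prod>j\<in>B. \<i> * eps j) * dx (pairset A B) v"
  have fin: "finite (phi_pairs 8)"
    by (rule finite_subset[of _ "Pow {..<8} \<times> Pow {..<8}"]) (auto simp: phi_pairs_def)
  have "finite supports" by (simp add: supports_def)
  then have "component 8 phi v = (\<Sum>H\<in>supports. \<Sum>p\<in>{p \<in> phi_pairs 8. (case p of (A, B) \<Rightarrow> symm_diff A B) = H}. ?g p)"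
    unfolding component_phi_pairs using fin by (intro sum.group[symmetric]) (auto simp: phi_pairs_def)
  also have "\<dots> = (\<Sum>H\<in>supports. phi_part H v)"
  proof (intro sum.cong refl)
    fix H assume H: "H \<in> supports"
    then have H8: "H \<subseteq> {..<8}" by (auto simp: supports_def)
    then have finH: "finite H" using finite_subset by blast
    let ?Q = "{Q. Q \<subseteq> {..<8} - H \<and> 2 * card Q + card H = 8}"
    have "phi_part H v = (\<Sum>(S, Q)\<in>Pow H \<times> ?Q. ?g ((H - S) \<union> Q, S \<union> Q))"
      unfolding phi_part_def prod.case by (rule sum.cartesian_product)
    also have "\<dots> = (\<Sum>p\<in>{p \<in> phi_pairs 8. (case p of (A, B) \<Rightarrow> symm_diff A B) = H}. ?g p)"
    proof (rule sum.reindex_bij_witness[of _ "\<lambda>(A, B). (B - A, A \<inter> B)" "\<lambda>(S, Q). ((H - S) \<union> Q, S \<union> Q)"])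
      fix p assume "p \<in> Pow H \<times> ?Q"
      then obtain S Q where p: "p = (S, Q)" "S \<subseteq> H" "Q \<subseteq> {..<8}" "Q \<inter> H = {}" "2 * card Q + card H = 8"
        by auto
      have 1: "(S \<union> Q) - ((H - S) \<union> Q) = S" "((H - S) \<union> Q) \<inter> (S \<union> Q) = Q" "symm_diff ((H - S) \<union> Q) (S \<union> Q) = H"
        using p by blast+
      have fin: "finite S" "finite Q" using p finH finite_subset by blast+
      have "card ((H - S) \<union> Q) = card (H - S) + card Q" "card (S \<union> Q) = card S + card Q"
        using p finH fin by (auto intro!: card_Un_disjoint)
      moreover have "card (H - S) + card S = card H"
        using p finH fin by (simp add: card_Diff_subset card_mono)
      ultimately have "card ((H - S) \<union> Q) + card (S \<union> Q) = 8" using p(5) by simp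
      moreover have "(H - S) \<union> Q \<subseteq> {..<8}" "S \<union> Q \<subseteq> {..<8}" using p H8 by auto
      ultimately have "((H - S) \<union> Q, S \<union> Q) \<in> phi_pairs 8"
        using H 1(3) by (simp only: phi_pairs_def mem_Collect_eq prod.case simp_thms)
      then show "(case p of (S, Q) \<Rightarrow> ((H - S) \<union> Q, S \<union> Q)) \<in> {p \<in> phi_pairs 8. (case p of (A, B) \<Rightarrow> symm_diff A B) = H}"
        using 1(3) by (simp only: p(1) mem_Collect_eq prod.case simp_thms)
      show "(case case p of (S, Q) \<Rightarrow> ((H - S) \<union> Q, S \<union> Q) of (A, B) \<Rightarrow> (B - A, A \<inter> B)) = p"
        by (simp only: p(1) prod.case 1)
      show "?g (case p of (S, Q) \<Rightarrow> ((H - S) \<union> Q, S \<union> Q)) = (case p of (S, Q) \<Rightarrow> ?g ((H - S) \<union> Q, S \<union> Q))"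
        by (simp only: p(1) prod.case)
    next
      fix p assume "p \<in> {p \<in> phi_pairs 8. (case p of (A, B) \<Rightarrow> symm_diff A B) = H}"
      then obtain A B where p: "p = (A, B)" "A \<subseteq> {..<8}" "B \<subseteq> {..<8}" "card A + card B = 8" "symm_diff A B = H"
        by (auto simp: phi_pairs_def)
      have fin: "finite A" "finite B" using p finite_subset by blast+
      have 1: "(H - (B - A)) \<union> (A \<inter> B) = A" "(B - A) \<union> (A \<inter> B) = B" "B - A \<subseteq> H" "A \<inter> B \<subseteq> {..<8} - H"
        using p by blast+
      have "card H = card (A - B) + card (B - A)"
        unfolding p(5)[symmetric] using fin by (intro card_Un_disjoint) auto
      then have "2 * card (A \<inter> B) + card H = 8"
        using p(4) card_Int_Diff[OF fin(1), of B] card_Int_Diff[OF fin(2), of A, unfolded Int_commute[of B]] by presburger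
      then show "(case p of (A, B) \<Rightarrow> (B - A, A \<inter> B)) \<in> Pow H \<times> ?Q"
        using 1(3,4) by (simp only: p(1) prod.case mem_Times_iff fst_conv snd_conv Pow_iff mem_Collect_eq simp_thms)
      show "(case case p of (A, B) \<Rightarrow> (B - A, A \<inter> B) of (S, Q) \<Rightarrow> ((H - S) \<union> Q, S \<union> Q)) = p"
        by (simp only: p(1) prod.case 1)
    qed
    finally show "(\<Sum>p\<in>{p \<in> phi_pairs 8. (case p of (A, B) \<Rightarrow> symm_diff A B) = H}. ?g p) = phi_part H v" ..
  qed
  finally show ?thesis .
qed

lemma prod_i_eps: "(\<Prod>j\<in>Q. \<i> * eps j) = \<i> ^ card Q * of_real (prod eps Q)"
  by (simp add: prod.distrib)

lemma phi_part_empty: "phi_part {} v = theta 4 v"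
proof -
  have Q: "{Q. Q \<subseteq> {..<8} - {} \<and> 2 * card Q + card {} = 8} = subsets 4" by auto
  have "Re (\<Prod>j\<in>Q. \<i> * eps j) = prod eps Q" if "Q \<in> subsets 4" for Q
  proof -
    have "card Q = 4" using that by simp
    moreover have "\<i> ^ 4 = 1" by (simp add: numeral_eq_Suc)
    ultimately show ?thesis
      by (simp only: prod_i_eps mult_1 Re_complex_of_real)
  qed
  moreover have "phi_part {} v = (\<Sum>Q\<in>subsets 4. Re (\<Prod>j\<in>Q. \<i> * eps j) * dx (pairset Q Q) v)"
    unfolding phi_part_def Q by simp
  ultimately show ?thesis
    unfolding theta_def by (simp only:) (intro sum.cong refl, simp only:)
qed

lemma phi_part_full:
  "phi_part {..<8} v = (\<Sum>S\<in>Pow {..<8}. Re (\<Prod>j\<in>S. \<i> * eps j) * dx (pairset ({..<8} - S) S) v)"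
proof -
  have "{Q. Q \<subseteq> {..<8} - {..<8 :: nat} \<and> 2 * card Q + card {..<8 :: nat} = 8} = {{}}" by auto
  then show ?thesis by (simp add: phi_part_def)
qed

lemma wedge_add_left:
  "wedge k l (\<lambda>u. \<alpha> u + \<alpha>' u) \<beta> v = wedge k l \<alpha> \<beta> v + wedge k l \<alpha>' \<beta> v"
  using fun_cong[OF wedge_sum_left[of k l "\<lambda>_. 1" "\<lambda>b. if b then \<alpha> else \<alpha>'" UNIV \<beta>], of v]
  by (simp add: UNIV_bool add.commute)

text \<open>The two planes of \<open>Q\<close> contribute \<open>\<i>\<^sup>2 = -1\<close> to the
  coefficient in \<open>phi\<close>. The factor \<open>- 1\<close> on the left, which will come from
  \<open>zeta\<close>, accounts for this.\<close>

lemma wedge_theta_2: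
  assumes H: "H \<subseteq> {..<8}" "card H = 4"
  shows "wedge 4 4 (\<lambda>u. - 1 * (\<Sum>S\<in>Pow H. Re (\<Prod>j\<in>S. \<i> * eps j) * dx (pairset (H - S) S) u)) (theta 2) v = phi_part H v"
proof -
  let ?r = "\<lambda>S. Re (\<Prod>j\<in>S. \<i> * eps j)"
  let ?Q = "{Q. Q \<subseteq> {..<8} - H \<and> 2 * card Q + card H = 8}"
  have finH: "finite H" using H finite_subset by blast
  have term_eq: "(\<Sum>Q\<in>subsets 2. prod eps Q * wedge 4 4 (dx (pairset (H - S) S)) (dx (pairset Q Q)) v) =
    (\<Sum>Q\<in>?Q. prod eps Q * dx (pairset ((H - S) \<union> Q) (S \<union> Q)) v)" if "S \<subseteq> H" for S
  proof -
    have HS: "H - S \<subseteq> {..<8}" "S \<subseteq> {..<8}" "(H - S) \<union> S = H" using that H by auto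
    have "finite S" using that finH finite_subset by blast
    then have "card (H - S) + card S = 4"
      using that H finH card_mono[OF finH that] by (simp add: card_Diff_subset)
    then have "wedge 4 4 (dx (pairset (H - S) S)) (dx (pairset Q Q)) =
      (if Q \<inter> ((H - S) \<union> S) = {} then dx (pairset ((H - S) \<union> Q) (S \<union> Q)) else (\<lambda>_. 0))" if "Q \<in> subsets 2" for Q
      using HS that by (intro wedge_dx_pairset) auto
    then have "(\<Sum>Q\<in>subsets 2. prod eps Q * wedge 4 4 (dx (pairset (H - S) S)) (dx (pairset Q Q)) v) =
      (\<Sum>Q\<in>subsets 2. if Q \<inter> H = {} then prod eps Q * dx (pairset ((H - S) \<union> Q) (S \<union> Q)) v else 0)"
      unfolding HS(3) by (intro sum.cong refl) simp
    also have "\<dots> = (\<Sum>Q\<in>?Q. prod eps Q * dx (pairset ((H - S) \<union> Q) (S \<union> Q)) v)"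
      by (rule sum.mono_neutral_cong_right[OF finite_subsets]) (use H in auto)
    finally show ?thesis .
  qed
  have "(\<lambda>u. - 1 * (\<Sum>S\<in>Pow H. ?r S * dx (pairset (H - S) S) u)) = (\<lambda>u. \<Sum>S\<in>Pow H. (- ?r S) * dx (pairset (H - S) S) u)"
    by (simp add: sum_negf)
  then have "wedge 4 4 (\<lambda>u. - 1 * (\<Sum>S\<in>Pow H. ?r S * dx (pairset (H - S) S) u)) (theta 2) v =
    (\<Sum>S\<in>Pow H. (- ?r S) * (\<Sum>Q\<in>subsets 2. prod eps Q * wedge 4 4 (dx (pairset (H - S) S)) (dx (pairset Q Q)) v))"
    by (simp only: wedge_sum_left theta_def[abs_def] wedge_sum_right)
  also have "\<dots> = (\<Sum>S\<in>Pow H. (- ?r S) * (\<Sum>Q\<in>?Q. prod eps Q * dx (pairset ((H - S) \<union> Q) (S \<union> Q)) v))"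
    by (intro sum.cong refl) (simp only: term_eq Pow_iff)
  also have "\<dots> = phi_part H v"
    unfolding phi_part_def sum_distrib_left
  proof (intro sum.cong refl)
    fix S Q assume S: "S \<in> Pow H" and Q: "Q \<in> ?Q"
    have fin: "finite S" "finite Q" using S Q finH finite_subset[of Q "{..<8}"] finite_subset[of S H] by auto
    have "card Q = 2" using Q H by simp
    then have "(\<Prod>j\<in>Q. \<i> * eps j) = - of_real (prod eps Q)"
      by (simp only: prod_i_eps power2_i) simp
    moreover have "(\<Prod>j\<in>S \<union> Q. \<i> * eps j) = (\<Prod>j\<in>S. \<i> * eps j) * (\<Prod>j\<in>Q. \<i> * eps j)"
      using fin S Q by (intro prod.union_disjoint) auto
    ultimately have "Re (\<Prod>j\<in>S \<union> Q. \<i> * eps j) = - ?r S * prod eps Q"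
      by (simp del: of_real_prod)
    then show "- ?r S * (prod eps Q * dx (pairset ((H - S) \<union> Q) (S \<union> Q)) v) =
      Re (\<Prod>j\<in>S \<union> Q. \<i> * eps j) * dx (pairset ((H - S) \<union> Q) (S \<union> Q)) v"
      by (simp only: mult.assoc)
  qed
  finally show ?thesis .
qed

section \<open>Complex subspaces spanned by coordinate planes\<close>

lemma less_8_cases: "j < 8 \<Longrightarrow> j \<in> {0, 1, 2, 3, 4, 5, 6, 7 :: nat}"
  by auto

definition ebasis :: "nat \<Rightarrow> real^16" where
  "ebasis i = axis (of_nat i) 1"

lemma inner_ebasis: "x \<bullet> ebasis i = coord i x"
  by (simp add: inner_axis coord_def ebasis_def)

lemma coord_ebasis: "p \<in> {1..16} \<Longrightarrow> q \<in> {1..16} \<Longrightarrow> coord p (ebasis q) = (if p = q then 1 else 0)"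
  using inj_on_eq_iff[OF bij_betw_imp_inj_on[OF bij_betw_of_nat_16], of p q] by (auto simp: coord_def axis_def ebasis_def)

lemma coord_eqI: "(\<And>p. p \<in> {1..16} \<Longrightarrow> coord p x = coord p y) \<Longrightarrow> x = y"
  unfolding vec_eq_iff coord_def using bij_betw_imp_surj_on[OF bij_betw_of_nat_16] by (metis UNIV_I imageE)

lemma pair_indexE:
  assumes "p \<in> {1..16::nat}"
  obtains j where "j < 8" "p = 2 * j + 1 \<or> p = 2 * j + 2"
proof
  show "(p - 1) div 2 < 8" "p = 2 * ((p - 1) div 2) + 1 \<or> p = 2 * ((p - 1) div 2) + 2"
    using assms by auto
qed

lemma coord_cplx:
  assumes "j < 8"
  shows "coord (2 * j + 1) (cplx v) = - eps j * coord (2 * j + 2) v" "coord (2 * j + 2) (cplx v) = eps j * coord (2 * j + 1) v"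
  using less_8_cases[OF assms] by (auto simp: coord_def cplx_def eps_def numeral_2_eq_2[symmetric])

text \<open>The orthogonal projection onto a coordinate plane, which is a complex line for
  \<open>cplx\<close>.\<close>

definition pair_proj :: "nat \<Rightarrow> real^16 \<Rightarrow> real^16" where
  "pair_proj j v = coord (2 * j + 1) v *\<^sub>R ebasis (2 * j + 1) + coord (2 * j + 2) v *\<^sub>R ebasis (2 * j + 2)"

lemma coord_pair_proj:
  assumes "i < 8" "j < 8"
  shows "coord (2 * i + 1) (pair_proj j v) = (if i = j then coord (2 * i + 1) v else 0)"
    "coord (2 * i + 2) (pair_proj j v) = (if i = j then coord (2 * i + 2) v else 0)"
proof -
  have mem: "2 * i + 1 \<in> {1..16}" "2 * i + 2 \<in> {1..16}" "2 * j + 1 \<in> {1..16}" "2 * j + 2 \<in> {1..16}"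
    using assms by auto
  have neq: "2 * i + 1 \<noteq> 2 * j + 2" "2 * i + 2 \<noteq> 2 * j + 1" "2 * i + 1 = 2 * j + 1 \<longleftrightarrow> i = j" "2 * i + 2 = 2 * j + 2 \<longleftrightarrow> i = j"
    by presburger+
  show "coord (2 * i + 1) (pair_proj j v) = (if i = j then coord (2 * i + 1) v else 0)"
    "coord (2 * i + 2) (pair_proj j v) = (if i = j then coord (2 * i + 2) v else 0)"
    unfolding pair_proj_def linear_add[OF linear_coord] linear_cmul[OF linear_coord]
      coord_ebasis[OF mem(1,3)] coord_ebasis[OF mem(1,4)] coord_ebasis[OF mem(2,3)] coord_ebasis[OF mem(2,4)]
    using neq by simp_all
qed

lemma sum_pair_proj: "(\<Sum>j<8. pair_proj j v) = v"
proof (rule coord_eqI)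
  fix p :: nat assume "p \<in> {1..16}"
  then obtain i where i: "i < 8" "p = 2 * i + 1 \<or> p = 2 * i + 2" by (rule pair_indexE)
  have "(\<Sum>j<8. coord p (pair_proj j v)) = (\<Sum>j<8. if j = i then coord p v else 0)"
    using i by (intro sum.cong refl) (auto simp: coord_pair_proj simp del: One_nat_def add_2_eq_Suc' Suc_eq_plus1 add_Suc_right)
  then show "coord p (\<Sum>j<8. pair_proj j v) = coord p v"
    using i by (simp add: linear_sum[OF linear_coord])
qed

definition pair_space :: "nat set \<Rightarrow> (real^16) set" where
  "pair_space H = {v. \<forall>j<8. j \<notin> H \<longrightarrow> coord (2 * j + 1) v = 0 \<and> coord (2 * j + 2) v = 0}"

lemma subspace_pair_space: "subspace (pair_space H)"
  by (auto simp: subspace_def pair_space_def linear_add[OF linear_coord] linear_cmul[OF linear_coord] linear_0[OF linear_coord])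

lemma pair_space_full: "pair_space {..<8} = UNIV"
  by (auto simp: pair_space_def)

lemma cplx_pair_space: "v \<in> pair_space H \<Longrightarrow> cplx v \<in> pair_space H"
  unfolding pair_space_def mem_Collect_eq
proof (intro allI impI)
  fix j assume v: "\<forall>j<8. j \<notin> H \<longrightarrow> coord (2 * j + 1) v = 0 \<and> coord (2 * j + 2) v = 0" and j: "j < 8" "j \<notin> H"
  from v j have "coord (2 * j + 1) v = 0" "coord (2 * j + 2) v = 0" by blast+
  then show "coord (2 * j + 1) (cplx v) = 0 \<and> coord (2 * j + 2) (cplx v) = 0"
    unfolding coord_cplx[OF j(1)] by simp
qed

lemma sum_pair_proj_mem: "H \<subseteq> {..<8} \<Longrightarrow> (\<Sum>j\<in>H. pair_proj j v) \<in> pair_space H"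
proof (intro subspace_sum[OF subspace_pair_space])
  fix j assume "H \<subseteq> {..<8}" "j \<in> H"
  then show "pair_proj j v \<in> pair_space H"
    unfolding pair_space_def mem_Collect_eq
  proof (intro allI impI)
    fix i assume "i < 8" "i \<notin> H"
    with \<open>H \<subseteq> {..<8}\<close> \<open>j \<in> H\<close> have "j < 8" "i \<noteq> j" by auto
    then show "coord (2 * i + 1) (pair_proj j v) = 0 \<and> coord (2 * i + 2) (pair_proj j v) = 0"
      unfolding coord_pair_proj[OF \<open>i < 8\<close> \<open>j < 8\<close>] by simp
  qed
qed

lemma inner_pair_proj: "pair_proj j v \<bullet> w = coord (2 * j + 1) v * coord (2 * j + 1) w + coord (2 * j + 2) v * coord (2 * j + 2) w"
  by (simp only: pair_proj_def inner_add_left inner_scaleR_left inner_commute[of "ebasis _"] inner_ebasis)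

lemma pair_proj_outside: "w \<in> pair_space H \<Longrightarrow> j < 8 \<Longrightarrow> j \<notin> H \<Longrightarrow> pair_proj j v \<bullet> w = 0"
  by (simp add: inner_pair_proj pair_space_def)

lemma split_pair_proj:
  assumes "H \<subseteq> {..<8}"
  shows "v = (\<Sum>j\<in>H. pair_proj j v) + (\<Sum>j\<in>{..<8} - H. pair_proj j v)"
  using sum.subset_diff[OF assms, of "\<lambda>j. pair_proj j v"] sum_pair_proj[of v] by (simp add: add.commute)

text \<open>Two candidates differ by a vector of \<open>Y\<close> that is orthogonal to itself, so
  the definite description is determined.\<close>

lemma orth_projI:
  assumes "subspace Y" "y \<in> Y" "\<And>w. w \<in> Y \<Longrightarrow> (v - y) \<bullet> w = 0"
  shows "orth_proj Y v = y"
  unfolding orth_proj_def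
proof (rule the_equality)
  fix y' assume y': "y' \<in> Y \<and> (\<forall>w\<in>Y. (v - y') \<bullet> w = 0)"
  then have d: "y' - y \<in> Y" using assms(1,2) by (simp add: subspace_diff)
  have "(y' - y) \<bullet> (y' - y) = (v - y) \<bullet> (y' - y) - (v - y') \<bullet> (y' - y)"
    by (simp add: inner_diff_left)
  also have "\<dots> = 0" using assms(3)[OF d] y' d by simp
  finally show "y' = y" by simp
qed (use assms in auto)

lemma orth_proj_pair_space:
  assumes "H \<subseteq> {..<8}"
  shows "orth_proj (pair_space H) v = (\<Sum>j\<in>H. pair_proj j v)"
proof (rule orth_projI[OF subspace_pair_space sum_pair_proj_mem[OF assms]])
  fix w assume w: "w \<in> pair_space H"
  have "v - (\<Sum>j\<in>H. pair_proj j v) = (\<Sum>j\<in>{..<8} - H. pair_proj j v)"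
    using split_pair_proj[OF assms, of v] by (metis add_diff_cancel_left')
  then show "(v - (\<Sum>j\<in>H. pair_proj j v)) \<bullet> w = 0"
    using pair_proj_outside[OF w] by (simp add: inner_sum_left)
qed

lemma dim_pair_space:
  assumes "H \<subseteq> {..<8}"
  shows "dim (pair_space H) = 2 * card H"
proof -
  let ?d = "of_nat ` pairset H H :: 16 set"
  have sub: "pairset H H \<subseteq> {1..16}" by (rule pairset_subset[OF assms assms])
  note inj = bij_betw_imp_inj_on[OF bij_betw_of_nat_16]
  have "pair_space H = {x. \<forall>i. i \<notin> ?d \<longrightarrow> x $ i = 0}"
  proof (intro equalityI subsetI CollectI allI impI)
    fix x i assume x: "x \<in> pair_space H" and i: "i \<notin> ?d"
    obtain p where p: "p \<in> {1..16}" "i = of_nat p"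
      using bij_betw_imp_surj_on[OF bij_betw_of_nat_16] by (metis UNIV_I imageE)
    obtain j where j: "j < 8" "p = 2 * j + 1 \<or> p = 2 * j + 2" using p(1) by (rule pair_indexE)
    then have "j \<notin> H" using i p(2) by (auto simp: pairset_def)
    then show "x $ i = 0" using x j p(2) by (auto simp: pair_space_def coord_def)
  next
    fix x :: "real^16" assume x: "x \<in> {x. \<forall>i. i \<notin> ?d \<longrightarrow> x $ i = 0}"
    have zero: "coord p x = 0" if "p \<in> {1..16}" "p \<notin> pairset H H" for p
    proof -
      have "of_nat p \<notin> ?d"
        using inj_on_image_mem_iff[OF inj that(1) sub] that(2) by simp
      then show ?thesis using x by (simp add: coord_def)
    qed
    show "x \<in> pair_space H"
      unfolding pair_space_def mem_Collect_eq
    proof (intro allI impI conjI)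
      fix j assume j: "j < 8" "j \<notin> H"
      have range: "2 * j + 1 \<in> {1..16}" "2 * j + 2 \<in> {1..16}" using j(1) by simp_all
      show "coord (2 * j + 1) x = 0"
        by (rule zero[OF range(1)]) (simp only: mem_pairset j(2) simp_thms)
      show "coord (2 * j + 2) x = 0"
        by (rule zero[OF range(2)]) (simp only: mem_pairset j(2) simp_thms)
    qed
  qed
  then have "dim (pair_space H) = card ?d"
    by (simp only: dim_vec_eq[symmetric] dim_substandard_cart)
  also have "\<dots> = card (pairset H H)"
    by (rule card_image[OF inj_on_subset[OF inj sub]])
  also have "\<dots> = 2 * card H"
    using assms finite_subset[of H "{..<8}"] by (simp add: card_pairset)
  finally show ?thesis .
qed

text \<open>The coordinate \<open>ccoord j\<close> carries the sign \<open>zeta j\<close>, so the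
  basis vector carries its inverse, which is the same sign; \<open>Re\<close> makes it a real
  scalar.\<close>

definition ubasis :: "nat \<Rightarrow> real^16" where
  "ubasis j = Re (zeta j) *\<^sub>R ebasis (2 * j + 1)"

lemma cplx_ebasis: "j < 8 \<Longrightarrow> cplx (ebasis (2 * j + 1)) = eps j *\<^sub>R ebasis (2 * j + 2)"
  using less_8_cases[of j] by (auto simp: vec_eq_iff forall_16 cplx_def eps_def axis_def ebasis_def numeral_2_eq_2[symmetric])

lemma Re_zeta_square: "Re (zeta j) * Re (zeta j) = 1"
  by (simp add: zeta_def)

lemma cscale_ccoord:
  assumes "j < 8"
  shows "cscale cplx (ccoord j v) (ubasis j) = pair_proj j v"
proof -
  have "Re (ccoord j v) * Re (zeta j) = coord (2 * j + 1) v" "Im (ccoord j v) * (Re (zeta j) * eps j) = coord (2 * j + 2) v"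
    by (auto simp: ccoord_def zeta_def eps_def)
  then show ?thesis
    by (simp only: cscale_def ubasis_def linear_cmul[OF linear_cplx] cplx_ebasis[OF assms] pair_proj_def scaleR_scaleR mult.assoc)
qed

lemma hprod_ubasis:
  assumes "i < 8" "j < 8"
  shows "hprod cplx (ubasis i) (ubasis j) = (if i = j then 1 else 0)"
proof -
  have mem: "2 * i + 1 \<in> {1..16}" "2 * i + 2 \<in> {1..16}" "2 * j + 1 \<in> {1..16}" "2 * j + 1 \<noteq> 2 * i + 2"
    using assms by auto presburger
  have "ubasis i \<bullet> ubasis j = Re (zeta j) * (Re (zeta i) * coord (2 * j + 1) (ebasis (2 * i + 1)))"
    by (simp only: ubasis_def inner_scaleR_left inner_scaleR_right inner_ebasis linear_cmul[OF linear_coord] real_scaleR_def mult_ac)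
  also have "\<dots> = (if i = j then 1 else 0)"
    using Re_zeta_square[of j] unfolding coord_ebasis[OF mem(3,1)] by auto
  finally have 1: "ubasis i \<bullet> ubasis j = (if i = j then 1 else 0)" .
  have "cplx (ubasis i) \<bullet> ubasis j = Re (zeta j) * (Re (zeta i) * (eps i * coord (2 * j + 1) (ebasis (2 * i + 2))))"
    unfolding ubasis_def linear_cmul[OF linear_cplx] cplx_ebasis[OF assms(1)]
    by (simp only: inner_scaleR_left inner_scaleR_right inner_ebasis linear_cmul[OF linear_coord] real_scaleR_def mult_ac)
  also have "\<dots> = 0"
    unfolding coord_ebasis[OF mem(3,2)] using mem(4) by simp
  finally show ?thesis
    using 1 by (simp add: hprod_def complex_eq_iff)
qed

lemma ubasis_mem: "j < 8 \<Longrightarrow> j \<in> H \<Longrightarrow> ubasis j \<in> pair_space H"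
  unfolding ubasis_def
proof (intro subspace_scale[OF subspace_pair_space])
  assume j: "j < 8" "j \<in> H"
  show "ebasis (2 * j + 1) \<in> pair_space H"
    unfolding pair_space_def mem_Collect_eq
  proof (intro allI impI)
    fix i assume i: "i < 8" "i \<notin> H"
    have mem: "2 * i + 1 \<in> {1..16}" "2 * i + 2 \<in> {1..16}" "2 * j + 1 \<in> {1..16}" "2 * i + 2 \<noteq> 2 * j + 1" "2 * i + 1 \<noteq> 2 * j + 1"
      using i j by auto presburger
    show "coord (2 * i + 1) (ebasis (2 * j + 1)) = 0 \<and> coord (2 * i + 2) (ebasis (2 * j + 1)) = 0"
      unfolding coord_ebasis[OF mem(1,3)] coord_ebasis[OF mem(2,3)] using mem(4,5) by simp
  qed
qed

text \<open>Bases are enumerated from 0, hence the shift by \<open>m\<close>. The functions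
  \<open>ccoord\<close> are the extended coordinates because orthogonal projection onto the subspace
  is the sum of the projections onto its planes.\<close>

lemma holomorphic_volume_form_pair_space:
  assumes H: "H = {m..<m + d}" "m + d \<le> 8"
  shows "holomorphic_volume_form cplx (pair_space H) d (wedge_list (map ccoord [m..<m + d]))"
proof -
  let ?b = "\<lambda>i. ubasis (m + i)" and ?Z = "\<lambda>i. ccoord (m + i)"
  have H8: "H \<subseteq> {..<8}" using H by auto
  have sum: "(\<Sum>i<d. cscale cplx (?Z i v) (?b i)) = (\<Sum>j\<in>H. pair_proj j v)" for v
  proof -
    have "(\<Sum>i<d. cscale cplx (?Z i v) (?b i)) = (\<Sum>i<d. pair_proj (m + i) v)"
      using H by (intro sum.cong refl cscale_ccoord) auto
    also have "\<dots> = (\<Sum>j\<in>H. pair_proj j v)"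
      unfolding H(1) by (rule sum.reindex_bij_witness[of _ "\<lambda>j. j - m" "\<lambda>i. m + i"]) auto
    finally show ?thesis .
  qed
  have mem: "v = (\<Sum>j\<in>H. pair_proj j v)" if v: "v \<in> pair_space H" for v
  proof -
    have "pair_proj j v = 0" if "j \<in> {..<8} - H" for j
      using v that by (simp add: pair_space_def pair_proj_def)
    then have "(\<Sum>j\<in>{..<8} - H. pair_proj j v) = 0" by (intro sum.neutral) blast
    then show ?thesis using split_pair_proj[OF H8, of v] by simp
  qed
  have "unitary_basis cplx (pair_space H) d ?b"
    unfolding unitary_basis_def
  proof (intro conjI allI impI ballI)
    show "?b i \<in> pair_space H" if "i < d" for i
      using that H by (intro ubasis_mem) auto
    show "hprod cplx (?b i) (?b j) = (if i = j then 1 else 0)" if "i < d" "j < d" for i j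
      using that H hprod_ubasis[of "m + i" "m + j"] by simp
    show "\<exists>z. v = (\<Sum>i<d. cscale cplx (z i) (?b i))" if "v \<in> pair_space H" for v
      by (rule exI[of _ "\<lambda>i. ?Z i v"]) (unfold sum, rule mem[OF that])
  qed
  moreover have "coordinate_functions cplx (pair_space H) d ?b ?Z"
    unfolding coordinate_functions_def sum orth_proj_pair_space[OF H8] by blast
  moreover have "map ccoord [m..<m + d] = map ?Z [0..<d]"
    by (rule nth_equalityI) simp_all
  ultimately show ?thesis
    unfolding holomorphic_volume_form_def by (intro exI[of _ ?b] exI[of _ ?Z]) simp
qed

lemma complex_subspace_pair_space:
  assumes "H \<subseteq> {..<8}"
  shows "complex_subspace cplx (pair_space H) (card H)"
  using cplx_pair_space by (auto simp: complex_subspace_def subspace_pair_space dim_pair_space[OF assms])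

lemma inner_pair_space:
  assumes "H \<subseteq> {..<8}" "x \<in> pair_space H" "y \<in> pair_space ({..<8} - H)"
  shows "x \<bullet> y = 0"
proof -
  have "pair_proj j x \<bullet> y = 0" if "j < 8" for j
    using assms that unfolding inner_pair_proj pair_space_def by (cases "j \<in> H") auto
  then have "(\<Sum>j<8. pair_proj j x) \<bullet> y = 0"
    by (simp add: inner_sum_left)
  then show ?thesis by (simp only: sum_pair_proj)
qed

lemma component_phi_8:
  defines "\<Omega>1 \<equiv> wedge_list (map ccoord [0..<4])" and "\<Omega>2 \<equiv> wedge_list (map ccoord [4..<8])"
    and "\<Omega> \<equiv> wedge_list (map ccoord [0..<8])"
  shows "component 8 phi = (\<lambda>v. Re (\<Omega> v) + 1 / fact 4 * wedge_power 2 (kaehler_form cplx) 4 v +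
      wedge 4 4 (\<lambda>u. Re (\<Omega>1 u + \<Omega>2 u)) (\<lambda>u. 1 / 2 * wedge_power 2 (kaehler_form cplx) 2 u) v)"
proof
  fix v
  let ?H1 = "{..<4 :: nat}" and ?H2 = "{4..<8 :: nat}"
  let ?F = "\<lambda>H u. - 1 * (\<Sum>S\<in>Pow H. Re (\<Prod>j\<in>S. \<i> * eps j) * dx (pairset (H - S) S) u)"
  have H: "?H1 \<subseteq> {..<8}" "?H2 \<subseteq> {..<8}" "card ?H1 = 4" "card ?H2 = 4" by auto
  have z1: "prod zeta ?H1 = of_real (- 1)" by (simp add: numeral_eq_Suc zeta_def)
  have z2: "prod zeta ?H2 = of_real (- 1)" by (simp add: numeral_eq_Suc atLeastLessThanSuc zeta_def)
  have z: "prod zeta {..<8} = of_real 1" by (simp add: numeral_eq_Suc zeta_def)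
  have \<Omega>: "Re (\<Omega> v) = phi_part {..<8} v"
    using Re_wedge_ccoord[OF _ _ _ z, of 0 8 v] unfolding \<Omega>_def phi_part_full by (simp add: atLeast0LessThan)
  have \<Omega>12: "Re (\<Omega>1 u + \<Omega>2 u) = ?F ?H1 u + ?F ?H2 u" for u
  proof -
    have "Re (\<Omega>1 u) = ?F ?H1 u"
      unfolding \<Omega>1_def by (rule Re_wedge_ccoord) (simp_all add: z1 atLeast0LessThan)
    moreover have "Re (\<Omega>2 u) = ?F ?H2 u"
      unfolding \<Omega>2_def by (rule Re_wedge_ccoord) (simp_all add: z2)
    ultimately show ?thesis by (simp only: plus_complex.sel)
  qed
  have theta: "1 / fact 4 * wedge_power 2 (kaehler_form cplx) 4 v = phi_part {} v"
    "(\<lambda>u. 1 / 2 * wedge_power 2 (kaehler_form cplx) 2 u) = theta 2"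
    by (simp_all add: wedge_power_kaehler phi_part_empty fun_eq_iff)
  have wedge: "wedge 4 4 (\<lambda>u. Re (\<Omega>1 u + \<Omega>2 u)) (theta 2) v = phi_part ?H1 v + phi_part ?H2 v"
    unfolding \<Omega>12 wedge_add_left wedge_theta_2[OF H(1,3)] wedge_theta_2[OF H(2,4)] ..
  \<comment> \<open>The four supports are told apart by whether they contain 0 and 4, so the sum
    over \<open>supports\<close> has four separate terms.\<close>
  have neq: "x \<noteq> y" if "(i \<in> x) \<noteq> (i \<in> y)" for i :: nat and x y
    using that by blast
  have "{} \<noteq> ?H1" "{} \<noteq> {..<8 :: nat}" "?H1 \<noteq> ?H2" "?H2 \<noteq> {..<8}"
    by (rule neq[of 0], simp)+
  moreover have "{} \<noteq> ?H2" "?H1 \<noteq> {..<8}"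
    by (rule neq[of 4], simp)+
  ultimately have "component 8 phi v = phi_part {} v + (phi_part ?H1 v + (phi_part ?H2 v + phi_part {..<8} v))"
    unfolding component_phi_8_parts supports_def
    by (subst sum.insert; simp only: finite.intros insert_iff empty_iff simp_thms sum.insert sum.empty add_0_right)+
  then show "component 8 phi v = Re (\<Omega> v) + 1 / fact 4 * wedge_power 2 (kaehler_form cplx) 4 v +
      wedge 4 4 (\<lambda>u. Re (\<Omega>1 u + \<Omega>2 u)) (\<lambda>u. 1 / 2 * wedge_power 2 (kaehler_form cplx) 2 u) v"
    by (simp only: \<Omega> theta wedge add_ac)
qed

lemma hprod_pair_space:
  assumes "H \<subseteq> {..<8}" "x \<in> pair_space H" "y \<in> pair_space ({..<8} - H)"
  shows "hprod cplx x y = 0"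
  using inner_pair_space[OF assms] inner_pair_space[OF assms(1) cplx_pair_space[OF assms(2)] assms(3)]
  by (simp add: hprod_def complex_eq_iff)

lemma pair_space_sum:
  assumes "H \<subseteq> {..<8}"
  shows "\<exists>x\<in>pair_space H. \<exists>y\<in>pair_space ({..<8} - H). v = x + y"
proof (rule bexI, rule bexI)
  show "v = (\<Sum>j\<in>H. pair_proj j v) + (\<Sum>j\<in>{..<8} - H. pair_proj j v)"
    by (rule split_pair_proj[OF assms])
qed (rule sum_pair_proj_mem, use assms in blast)+

theorem theorem1p7:
  shows
    "(\<forall>j. odd j \<longrightarrow> component j phi = (\<lambda>_. 0)) \<and>
     component 0 phi = (\<lambda>_. 1) \<and>
     component 16 phi = volume_form \<and>
     (\<forall>k\<le>8. calibration (2 * k) (component (2 * k) phi)) \<and>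
     (\<exists>(J :: real^16 \<Rightarrow> real^16) X1 X2 \<Omega>1 \<Omega>2 \<Omega>.
        orthogonal_complex_structure J \<and>
        complex_subspace J X1 4 \<and> complex_subspace J X2 4 \<and>
        (\<forall>x\<in>X1. \<forall>y\<in>X2. hprod J x y = 0) \<and>
        (\<forall>v. \<exists>x\<in>X1. \<exists>y\<in>X2. v = x + y) \<and>
        holomorphic_volume_form J X1 4 \<Omega>1 \<and>
        holomorphic_volume_form J X2 4 \<Omega>2 \<and>
        holomorphic_volume_form J UNIV 8 \<Omega> \<and>
        component 8 phi = (\<lambda>v.
          Re (\<Omega> v) +
          1 / fact 4 * wedge_power 2 (kaehler_form J) 4 v +
          wedge 4 4 (\<lambda>u. Re (\<Omega>1 u + \<Omega>2 u))
            (\<lambda>u. 1 / 2 * wedge_power 2 (kaehler_form J) 2 u) v))"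
proof (intro conjI)
  show "\<forall>j. odd j \<longrightarrow> component j phi = (\<lambda>_. 0)"
    using component_phi_odd by blast
  show "component 0 phi = (\<lambda>_. 1)" by (rule component_phi_0)
  show "component 16 phi = volume_form" by (rule component_phi_16)
  show "\<forall>k\<le>8. calibration (2 * k) (component (2 * k) phi)"
    using calibration_component_phi by blast
  let ?H1 = "{..<4 :: nat}" and ?H2 = "{4..<8 :: nat}"
  let ?X1 = "pair_space ?H1" and ?X2 = "pair_space ?H2"
  let ?\<Omega>1 = "wedge_list (map ccoord [0..<4])" and ?\<Omega>2 = "wedge_list (map ccoord [4..<8])"
    and ?\<Omega> = "wedge_list (map ccoord [0..<8])"
  have H: "?H1 \<subseteq> {..<8}" "?H2 \<subseteq> {..<8}" "{..<8} - ?H1 = ?H2" by auto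
  have hprod: "\<forall>x\<in>?X1. \<forall>y\<in>?X2. hprod cplx x y = 0"
    using hprod_pair_space[OF H(1)] unfolding H(3) by blast
  have split: "\<forall>v. \<exists>x\<in>?X1. \<exists>y\<in>?X2. v = x + y"
    using pair_space_sum[OF H(1)] unfolding H(3) by (rule allI)
  have subspaces: "complex_subspace cplx ?X1 4" "complex_subspace cplx ?X2 4"
    using complex_subspace_pair_space[OF H(1)] complex_subspace_pair_space[OF H(2)] by simp_all
  have vol1: "holomorphic_volume_form cplx ?X1 4 ?\<Omega>1"
    using holomorphic_volume_form_pair_space[of ?H1 0 4] by (simp add: atLeast0LessThan)
  have vol2: "holomorphic_volume_form cplx ?X2 4 ?\<Omega>2"
    using holomorphic_volume_form_pair_space[of ?H2 4 4] by simp
  have vol: "holomorphic_volume_form cplx UNIV 8 ?\<Omega>"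
    using holomorphic_volume_form_pair_space[of "{..<8}" 0 8] by (simp add: atLeast0LessThan pair_space_full)
  show "\<exists>(J :: real^16 \<Rightarrow> real^16) X1 X2 \<Omega>1 \<Omega>2 \<Omega>.
        orthogonal_complex_structure J \<and>
        complex_subspace J X1 4 \<and> complex_subspace J X2 4 \<and>
        (\<forall>x\<in>X1. \<forall>y\<in>X2. hprod J x y = 0) \<and>
        (\<forall>v. \<exists>x\<in>X1. \<exists>y\<in>X2. v = x + y) \<and>
        holomorphic_volume_form J X1 4 \<Omega>1 \<and>
        holomorphic_volume_form J X2 4 \<Omega>2 \<and>
        holomorphic_volume_form J UNIV 8 \<Omega> \<and>
        component 8 phi = (\<lambda>v.
          Re (\<Omega> v) +
          1 / fact 4 * wedge_power 2 (kaehler_form J) 4 v +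
          wedge 4 4 (\<lambda>u. Re (\<Omega>1 u + \<Omega>2 u))
            (\<lambda>u. 1 / 2 * wedge_power 2 (kaehler_form J) 2 u) v)"
    by (rule exI[of _ cplx], rule exI[of _ ?X1], rule exI[of _ ?X2], rule exI[of _ ?\<Omega>1], rule exI[of _ ?\<Omega>2],
        rule exI[of _ ?\<Omega>], intro conjI)
      (rule orthogonal_complex_structure_cplx subspaces hprod split vol1 vol2 vol component_phi_8)+
qed

end
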